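(* For every fixed $\alpha>0$ there is $c_T(\alpha)>1$ such that $$F_c(-u/2)=\ln\det\bigl(I+(e^u-1)S_c\bigr)\ \ge\ uc+\frac{u^2}{4\pi^2}\ln c\qquad\text{for all }c\ge c_T(\alpha)\text{ and }2\le u\le\alpha\ln c.$$ Thus the bound $\ln\det(I+(e^u-1)S_c)\ge uc+\kappa_T u^2\ln c$ for all $c\ge c_T$, $u\in[L_T,\alpha\ln c]$ holds with $L_T=2$ and $\kappa_T=1/(4\pi^2)$; only the lower threshold $c_T$ depends on $\alpha$.
   Context: For $c>0$, $S_c$ is the positive trace-class integral operator on $L^2(0,c)$ with kernel $\frac{\sin(\pi(x-y))}{\pi(x-y)}$ (equal to $1$ for $x=y$). For real $v$, $F_c(v)=\ln\det\bigl(I-(1-e^{-2v})S_c\bigr)$, where $\det$ is the Fredholm determinant. $\ln$ is the natural logarithm. *)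

theory Defs
  imports "HOL-Analysis.Analysis" "Jordan_Normal_Form.Determinant"
begin

text \<open>
  The Fredholm determinant \<open>det (I + K)\<close> of the integral operator
  \<open>(K f) x = \<integral> K x y * f y \<partial>M\<close> on \<open>L\<^sup>2(M)\<close>, given by Fredholm's series
  \[ \sum_{n \ge 0} \frac{1}{n!} \int_{M^n} \det (K(x_i, x_j))_{i,j<n} \, dx_0 \cdots dx_{n-1}. \]
  It is meant for finite \<open>M\<close> and bounded measurable \<open>K\<close>, where the series converges absolutely by
  Hadamard's inequality. The value depends on \<open>K\<close> on the diagonal, so a trace-class operator
  has to be represented by its continuous kernel.
\<close>

definition fredholm_det :: "'a measure \<Rightarrow> ('a \<Rightarrow> 'a \<Rightarrow> real) \<Rightarrow> real" where
  "fredholm_det M K =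
     (\<Sum>n. (1 / fact n) *
        (\<integral>x. Determinant.det (Matrix.mat n n (\<lambda>(i, j). K (x i) (x j))) \<partial>(Pi\<^sub>M {..<n} (\<lambda>_. M))))"

definition sine_kernel :: "real \<Rightarrow> real \<Rightarrow> real" where
  "sine_kernel x y = (if x = y then 1 else sin (pi * (x - y)) / (pi * (x - y)))"

text \<open>\<open>det (I + z S\<^sub>c)\<close>, where \<open>S\<^sub>c\<close> is the operator on \<open>L\<^sup>2(0, c)\<close> with the sine kernel.\<close>

definition sine_det :: "real \<Rightarrow> real \<Rightarrow> real" where
  "sine_det c z =
     fredholm_det (restrict_space lborel {0<..<c}) (\<lambda>x y. z * sine_kernel x y)"

definition F :: "real \<Rightarrow> real \<Rightarrow> real" where
  "F c v = ln (sine_det c (- (1 - exp (- 2 * v))))"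

end

(* The matrices det(I + z A_n), where A_n samples the sine kernel on a grid of n points of (0,c), are
   Toeplitz determinants of the symbol f equal to e^u on an arc of relative length c/n and to 1
   elsewhere. Fredholm's series is the limit of their expansions into principal minors, so it
   suffices to bound these Toeplitz determinants from below, uniformly as n grows.

   Let q be a polynomial of degree at most n without zeros in the closed unit disc. The rational
   functions p/q with deg p < n have an explicit orthonormal basis (Takenaka-Malmquist), whose squared
   moduli are Poisson kernels at the points reflected from the zeros of q. Jensen's inequality in
   the diagonalising basis of the compression of f |q|^2 to this space gives, with -ln q = sum A_k z^k
   and f_k the Fourier coefficients of the indicator function of the arc,
     ln D_n(f) >= u c + sum_k k (2 u f_k A_k - A_k^2).
   The optimal choice A_k = u f_k is affordable for frequencies k between n/c and n/c^(1/4): take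
   for q the Taylor polynomial of degree n of exp(-sum A_k z^k); the truncation error is of size
   exp(-c^(1/4) + O(ln^2 c)). The gain is (u/pi)^2 times the sum of sin^2(pi k c/n)/k, which is at least
   u^2/(2 pi^2) (3/4 ln c - O(1)). *)

theory Submission
  imports Defs "Jordan_Normal_Form.Schur_Decomposition" "Jordan_Normal_Form.Spectral_Radius"
    "HOL-Combinatorics.Permutations" "HOL-Probability.Sinc_Integral"
    "HOL-Complex_Analysis.Complex_Analysis" "HOL-Real_Asymp.Real_Asymp"
begin

text \<open>Bookkeeping behind the displayed bound: expanding q times the basis functions in
  monomials gives a coefficient matrix B, and the Gram determinant for the weight f |q|^2 is |det
  B|^2 D_n(f). With a_i the points reflected from the zeros of q, let E be the logarithm of |det
  B|^2, which is the product of all |1 - conj(a_i) a_j|. Averaging ln |q|^2 against the Poisson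
  kernels produces 2 E, so one E survives. Expanding the logarithms, E is minus the sum of
  |sigma_k|^2 / k with the power sums sigma_k = k A_k of the conj(a_i). The obstacle is the degree:
  q must be a polynomial of degree at most n, and exp(- sum A_k z^k) is not. Using frequencies up to
  m costs a truncation error of at most u exp(1 - n/m + 4 S), where S bounds the exponent and is
  O(ln^2 c) for u of order ln c. So n/m must outgrow ln^2 c. Taking n/m = c^p lowers the gain to (1
  - p) u^2 ln c / (2 pi^2), and p < 1/2 leaves an excess over the claimed u^2 ln c / (4 pi^2) that
  pays for all errors; p = 1/4 is one such choice.\<close>

section \<open>Diagonalisation of Hermitian matrices\<close>

no_notation Finite_Cartesian_Product.vec_nth (infixl "$" 90) and Formal_Power_Series.fps_nth (infixl "$" 75)

lemma mat_adjoint_carrier [simp, intro]: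
  "A \<in> carrier_mat m n \<Longrightarrow> mat_adjoint A \<in> carrier_mat n m"
  by (auto simp: mat_adjoint_def)

lemma dim_mat_adjoint [simp]:
  "dim_row (mat_adjoint A) = dim_col A" "dim_col (mat_adjoint A) = dim_row A"
  by (auto simp: mat_adjoint_def)

lemma index_mat_adjoint [simp]:
  fixes A :: "complex mat"
  shows "i < dim_col A \<Longrightarrow> j < dim_row A \<Longrightarrow> mat_adjoint A $$ (i, j) = cnj (A $$ (j, i))"
  by (simp add: mat_adjoint_def mat_of_rows_index)

lemma mat_adjoint_mult:
  fixes A B :: "complex mat"
  assumes "A \<in> carrier_mat m n" "B \<in> carrier_mat n k"
  shows "mat_adjoint (A * B) = mat_adjoint B * mat_adjoint A"
  using assms by (intro eq_matI) (auto simp: scalar_prod_def mult.commute)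

lemma det_mat_adjoint:
  fixes A :: "complex mat"
  assumes "A \<in> carrier_mat n n"
  shows "Determinant.det (mat_adjoint A) = cnj (Determinant.det A)"
proof -
  have "mat_adjoint A = map_mat cnj (transpose_mat A)"
    using assms by (intro eq_matI) auto
  moreover have "Determinant.det (map_mat cnj B) = cnj (Determinant.det B)" if "B \<in> carrier_mat n n" for B
    using that by (auto simp: det_def' cnj_sum cnj_prod intro!: sum.cong prod.cong)
  ultimately show ?thesis using assms by (simp add: det_transpose[of A n])
qed

definition hermitian_mat :: "complex mat \<Rightarrow> bool" where
  "hermitian_mat A \<longleftrightarrow> mat_adjoint A = A"

text \<open>The reflection exchanging $e_0$ and $v$; the sign of $t$ keeps its denominator $1 - t$ away from $0$.\<close>

lemma householder_unitary:
  fixes v :: "complex Matrix.vec"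
  assumes v: "v \<in> carrier_vec (Suc n)" and norm: "(\<Sum>i<Suc n. (cmod (v $ i))\<^sup>2) = 1"
    and v0: "v $ 0 = of_real t" "t \<le> 0"
  obtains H where "H \<in> carrier_mat (Suc n) (Suc n)" "mat_adjoint H = H" "H * H = 1\<^sub>m (Suc n)"
    "col H 0 = v"
proof
  define u where "u i = v $ i - (if i = 0 then 1 else 0)" for i
  \<comment> \<open>As v is a unit vector with real first entry t, |u|^2 = 2 (1 - t); this is the
    usual Householder form I - 2 u u^H / |u|^2.\<close>
  define H where "H = Matrix.mat (Suc n) (Suc n) (\<lambda>(i, j). (if i = j then 1 else 0) - u i * cnj (u j) / of_real (1 - t))"
  show H: "H \<in> carrier_mat (Suc n) (Suc n)" by (simp add: H_def)
  show "mat_adjoint H = H" by (intro eq_matI) (auto simp: H_def)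
  have t1: "1 - complex_of_real t \<noteq> 0" using v0(2) by (auto simp: complex_eq_iff)
  have "(\<Sum>i<Suc n. cnj (u i) * u i) = (\<Sum>i<Suc n. of_real ((cmod (v $ i))\<^sup>2) + (if i = 0 then 1 - 2 * of_real t else 0))"
    using v0 by (intro sum.cong refl) (auto simp: u_def complex_norm_square complex_norm_square[symmetric] power2_eq_square[of "of_real t"] algebra_simps)
  also have "\<dots> = of_real (\<Sum>i<Suc n. (cmod (v $ i))\<^sup>2) + (1 - 2 * of_real t)"
    unfolding sum.distrib of_real_sum by (simp add: sum.delta del: sum.lessThan_Suc)
  also have "\<dots> = 2 * of_real (1 - t)" unfolding norm by simp
  finally have uu: "(\<Sum>i<Suc n. cnj (u i) * u i) = 2 * of_real (1 - t)" .
  show "H * H = 1\<^sub>m (Suc n)"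
  proof (intro eq_matI)
    fix i j assume "i < dim_row (1\<^sub>m (Suc n) :: complex mat)" "j < dim_col (1\<^sub>m (Suc n) :: complex mat)"
    then have ij: "i < Suc n" "j < Suc n" by auto
    let ?s = "complex_of_real (1 - t)"
    have "(H * H) $$ (i, j) = (\<Sum>k<Suc n. ((if i = k then 1 else 0) - u i * cnj (u k) / ?s) * ((if k = j then 1 else 0) - u k * cnj (u j) / ?s))"
      using ij by (simp add: H_def scalar_prod_def atLeast0LessThan)
    also have "\<dots> = (\<Sum>k<Suc n. (if i = k then (if i = j then 1 else 0) else 0) - (if i = k then u i * cnj (u j) / ?s else 0)
        - (if k = j then u i * cnj (u j) / ?s else 0) + u i * cnj (u j) / ?s^2 * (cnj (u k) * u k))"
      by (intro sum.cong refl) (auto simp: algebra_simps power2_eq_square)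
    also have "\<dots> = (if i = j then 1 else 0) - 2 * (u i * cnj (u j) / ?s) + u i * cnj (u j) / ?s^2 * (2 * ?s)"
      unfolding sum.distrib sum_subtractf sum_distrib_left[symmetric] uu using ij by simp
    also have "\<dots> = (if i = j then 1 else 0)"
    proof -
      have "p / s\<^sup>2 * (2 * s) = 2 * (p / s)" if "s \<noteq> 0" for p s :: complex
        using that by (simp add: power2_eq_square)
      from this[of ?s] show ?thesis using t1 by simp
    qed
    finally show "(H * H) $$ (i, j) = 1\<^sub>m (Suc n) $$ (i, j)" using ij by simp
  qed (use H in auto)
  show "col H 0 = v"
  proof (intro eq_vecI)
    fix i assume "i < dim_vec v"
    then have "i < Suc n" using v by simp
    moreover have "(of_real t - 1) / (1 - complex_of_real t) = - 1" using t1 by (simp add: field_simps)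
    ultimately show "col H 0 $ i = v $ i" using t1
      by (auto simp: H_def u_def v0 field_simps)
  qed (use H v in auto)
qed

text \<open>A complex matrix of positive size has an eigenvalue. The free phase of the eigenvector
  is spent on making its first entry real and nonpositive, the form that
  \<open>householder_unitary\<close> accepts.\<close>

lemma exists_normalized_eigenvector:
  fixes A :: "complex mat"
  assumes A: "A \<in> carrier_mat (Suc n) (Suc n)"
  obtains v k t where "v \<in> carrier_vec (Suc n)" "A *\<^sub>v v = k \<cdot>\<^sub>v v"
    "(\<Sum>i<Suc n. (cmod (v $ i))\<^sup>2) = 1" "v $ 0 = of_real t" "t \<le> 0"
proof -
  obtain k where "eigenvalue A k"
    using spectrum_non_empty[OF A] by (auto simp: spectrum_def)
  then obtain w where w: "w \<in> carrier_vec (Suc n)" "w \<noteq> 0\<^sub>v (Suc n)" "A *\<^sub>v w = k \<cdot>\<^sub>v w"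
    using A by (auto simp: eigenvalue_def eigenvector_def)
  define N where "N = sqrt (\<Sum>i<Suc n. (cmod (w $ i))\<^sup>2)"
  obtain i where i: "i < Suc n" "w $ i \<noteq> 0"
    using w by (metis carrier_vecD eq_vecI index_zero_vec(1) index_zero_vec(2))
  have "(cmod (w $ i))\<^sup>2 \<le> (\<Sum>i<Suc n. (cmod (w $ i))\<^sup>2)"
    using i by (intro member_le_sum) auto
  moreover have "0 < (cmod (w $ i))\<^sup>2" using i by simp
  ultimately have "0 < (\<Sum>i<Suc n. (cmod (w $ i))\<^sup>2)" by linarith
  then have N: "N > 0" "N\<^sup>2 = (\<Sum>i<Suc n. (cmod (w $ i))\<^sup>2)"
    unfolding N_def by (simp_all del: sum.lessThan_Suc)
  define ph where "ph = (if w $ 0 = 0 then 1 else - cnj (w $ 0) / of_real (cmod (w $ 0)))"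
  have ph: "cmod ph = 1" by (auto simp: ph_def norm_divide)
  define s where "s = ph / of_real N"
  have s: "cmod s = 1 / N" using N ph by (simp add: s_def norm_divide)
  have cc: "w $ 0 * cnj (w $ 0) = of_real ((cmod (w $ 0))\<^sup>2)"
    by (metis complex_norm_square)
  show ?thesis
  proof
    show "s \<cdot>\<^sub>v w \<in> carrier_vec (Suc n)" using w by simp
    show "A *\<^sub>v (s \<cdot>\<^sub>v w) = k \<cdot>\<^sub>v (s \<cdot>\<^sub>v w)"
      using A w by (simp add: mult_mat_vec smult_smult_assoc mult.commute)
    show "(\<Sum>i<Suc n. (cmod ((s \<cdot>\<^sub>v w) $ i))\<^sup>2) = 1"
    proof -
      have "(\<Sum>i<Suc n. (cmod ((s \<cdot>\<^sub>v w) $ i))\<^sup>2) = (\<Sum>i<Suc n. (1/N)\<^sup>2 * (cmod (w $ i))\<^sup>2)"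
        using w by (intro sum.cong refl) (auto simp: norm_mult s power_mult_distrib power_divide)
      also have "\<dots> = (1/N)\<^sup>2 * N\<^sup>2" unfolding N(2) sum_distrib_left by simp
      finally show ?thesis using N(1) by (simp add: power_divide)
    qed
    show "(s \<cdot>\<^sub>v w) $ 0 = of_real (- cmod (w $ 0) / N)"
      using w N cc by (auto simp: s_def ph_def power2_eq_square field_simps)
    show "- cmod (w $ 0) / N \<le> 0" using N by simp
  qed
qed

text \<open>Deflation: conjugating by the reflection whose first column is a unit eigenvector clears
  the first column, Hermitian symmetry then clears the first row, and the induction continues with
  the trailing block. It carries only one of the two unitarity equations; for square matrices the
  other follows.\<close>

theorem hermitian_diagonalization:
  fixes A :: "complex mat"
  assumes "A \<in> carrier_mat n n" "hermitian_mat A"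
  obtains U d where "U \<in> carrier_mat n n" "mat_adjoint U * U = 1\<^sub>m n" "U * mat_adjoint U = 1\<^sub>m n"
    "mat_adjoint U * A * U = mat_diag n (\<lambda>i. complex_of_real (d i))"
proof -
  have "\<exists>U d. U \<in> carrier_mat n n \<and> mat_adjoint U * U = 1\<^sub>m n \<and>
    mat_adjoint U * A * U = mat_diag n (\<lambda>i. complex_of_real (d i))"
    using assms
  proof (induction n arbitrary: A)
    case 0
    then show ?case by (intro exI[of _ "1\<^sub>m 0"] exI[of _ "\<lambda>_. 0"]) (auto intro!: eq_matI simp: mat_diag_def)
  next
    case (Suc n)
    note A = Suc.prems(1)
    obtain v k t where v: "v \<in> carrier_vec (Suc n)" "A *\<^sub>v v = k \<cdot>\<^sub>v v"
      "(\<Sum>i<Suc n. (cmod (v $ i))\<^sup>2) = 1" "v $ 0 = of_real t" "t \<le> 0"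
      using exists_normalized_eigenvector[OF A] .
    obtain H where H: "H \<in> carrier_mat (Suc n) (Suc n)" "mat_adjoint H = H" "H * H = 1\<^sub>m (Suc n)" "col H 0 = v"
      using householder_unitary[OF v(1,3-5)] .
    define A' where "A' = H * A * H"
    have A': "A' \<in> carrier_mat (Suc n) (Suc n)" using A H by (simp add: A'_def)
    have herm': "mat_adjoint A' = A'"
    proof -
      have "mat_adjoint A' = mat_adjoint H * mat_adjoint (H * A)"
        unfolding A'_def by (rule mat_adjoint_mult) (use A H in auto)
      also have "mat_adjoint (H * A) = mat_adjoint A * mat_adjoint H"
        by (rule mat_adjoint_mult) (use A H in auto)
      finally show ?thesis
        using A H Suc.prems(2) by (simp add: A'_def hermitian_mat_def assoc_mult_mat[of H "Suc n" "Suc n" A "Suc n" H "Suc n"])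
    qed
    have sym: "A' $$ (i, j) = cnj (A' $$ (j, i))" if "i < Suc n" "j < Suc n" for i j
      using index_mat_adjoint[of i A' j] herm' A' that by auto
    have e0: "H *\<^sub>v v = unit_vec (Suc n) 0"
    proof -
      have "H *\<^sub>v v = col (H * H) 0" using col_mult2[OF H(1) H(1), of 0] H(4) by simp
      then show ?thesis unfolding H(3) by simp
    qed
    have c0: "col A' 0 = k \<cdot>\<^sub>v unit_vec (Suc n) 0"
    proof -
      have "col A' 0 = (H * A) *\<^sub>v v"
        using col_mult2[OF mult_carrier_mat[OF H(1) A] H(1), of 0] H(4) unfolding A'_def by simp
      also have "\<dots> = H *\<^sub>v (A *\<^sub>v v)" by (rule assoc_mult_mat_vec[OF H(1) A v(1)])
      also have "\<dots> = k \<cdot>\<^sub>v unit_vec (Suc n) 0" using v H e0 by (simp add: mult_mat_vec)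
      finally show ?thesis .
    qed
    have col0: "A' $$ (i, 0) = (if i = 0 then k else 0)" if "i < Suc n" for i
    proof -
      have "A' $$ (i, 0) = col A' 0 $ i" using A' that by simp
      then show ?thesis using that by (simp add: c0)
    qed
    have k: "k = of_real (Re k)"
      using sym[of 0 0] col0[of 0] by (simp add: complex_eq_iff)
    have row0: "A' $$ (0, j) = (if j = 0 then k else 0)" if "j < Suc n" for j
      using sym[of 0 j] col0[of j] k that by (metis complex_cnj_complex_of_real complex_cnj_zero zero_less_Suc)
    define A2 where "A2 = Matrix.mat n n (\<lambda>(i, j). A' $$ (Suc i, Suc j))"
    have A2: "A2 \<in> carrier_mat n n" by (simp add: A2_def)
    have "hermitian_mat A2" unfolding hermitian_mat_def
      by (intro eq_matI) (auto simp: A2_def intro!: sym[symmetric])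
    then obtain U2 d2 where U2: "U2 \<in> carrier_mat n n" "mat_adjoint U2 * U2 = 1\<^sub>m n"
      "mat_adjoint U2 * A2 * U2 = mat_diag n (\<lambda>i. complex_of_real (d2 i))"
      using Suc.IH[OF A2] by blast
    let ?fb = "\<lambda>x X. four_block_mat (Matrix.mat 1 1 (\<lambda>_. x)) (0\<^sub>m 1 n) (0\<^sub>m n 1) X :: complex mat"
    have fbA: "A' = ?fb k A2"
      using A' col0 row0 by (intro eq_matI) (auto simp: A2_def less_Suc_eq_0_disj)
    have fbm: "?fb x X * ?fb y Y = ?fb (x * y) (X * Y)" if "X \<in> carrier_mat n n" "Y \<in> carrier_mat n n" for x y X Y
      using that by (subst mult_four_block_mat[of _ 1 1 _ n _ n _ _ 1 _ n])
        (auto intro!: eq_matI simp: scalar_prod_def)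
    have fbc: "?fb x X \<in> carrier_mat (Suc n) (Suc n)" if "X \<in> carrier_mat n n" for x X
      using that by auto
    have fba: "mat_adjoint (?fb 1 U2) = ?fb 1 (mat_adjoint U2)"
      using U2(1) by (intro eq_matI) (auto simp: less_Suc_eq_0_disj)
    define U where "U = H * ?fb 1 U2"
    have U: "U \<in> carrier_mat (Suc n) (Suc n)" using H fbc[OF U2(1)] by (simp add: U_def)
    have Ua: "mat_adjoint U = ?fb 1 (mat_adjoint U2) * H"
      unfolding U_def mat_adjoint_mult[OF H(1) fbc[OF U2(1)]] fba H(2) ..
    note as = assoc_mult_mat[of _ "Suc n" "Suc n" _ "Suc n" _ "Suc n"]
    have c1: "?fb 1 U2 \<in> carrier_mat (Suc n) (Suc n)" "?fb 1 (mat_adjoint U2) \<in> carrier_mat (Suc n) (Suc n)"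
      using U2(1) by (auto intro!: fbc)
    have "mat_adjoint U * U = ?fb 1 (mat_adjoint U2) * (H * (H * ?fb 1 U2))"
      unfolding Ua unfolding U_def using c1 H(1) by (subst as) auto
    also have "H * (H * ?fb 1 U2) = ?fb 1 U2"
      using c1 H by (subst as[symmetric]) auto
    finally have UU: "mat_adjoint U * U = 1\<^sub>m (Suc n)"
      unfolding fbm[OF mat_adjoint_carrier[OF U2(1)] U2(1)] U2(2)
      by (auto intro!: eq_matI simp: less_Suc_eq_0_disj split: if_splits)
    have "mat_adjoint U * A * U = ?fb 1 (mat_adjoint U2) * (H * A * H) * ?fb 1 U2"
      unfolding Ua unfolding U_def using c1 H(1) A by (simp add: as)
    also have "\<dots> = ?fb k (mat_adjoint U2 * A2 * U2)"
      unfolding A'_def[symmetric] fbA fbm[OF mat_adjoint_carrier[OF U2(1)] A2]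
        fbm[OF mult_carrier_mat[OF mat_adjoint_carrier[OF U2(1)] A2] U2(1)] by simp
    also have "\<dots> = mat_diag (Suc n) (\<lambda>i. complex_of_real (case i of 0 \<Rightarrow> Re k | Suc i \<Rightarrow> d2 i))"
      unfolding U2(3) using k[symmetric] by (intro eq_matI) (auto simp: less_Suc_eq_0_disj mat_diag_def split: if_splits)
    finally show ?case using U UU by blast
  qed
  then obtain U d where *: "U \<in> carrier_mat n n" "mat_adjoint U * U = 1\<^sub>m n"
    "mat_adjoint U * A * U = mat_diag n (\<lambda>i. complex_of_real (d i))" by blast
  moreover have "U * mat_adjoint U = 1\<^sub>m n"
    by (rule mat_mult_left_right_inverse[OF mat_adjoint_carrier[OF *(1)] *(1,2)])
  ultimately show ?thesis using that by blast
qed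

section \<open>Determinants of Gram matrices\<close>

lemma unitary_conj_entry:
  fixes A U :: "complex mat"
  assumes "A \<in> carrier_mat n n" "U \<in> carrier_mat n n" "k < n" "l < n"
  shows "(mat_adjoint U * A * U) $$ (k, l) = (\<Sum>i<n. \<Sum>j<n. cnj (U $$ (i, k)) * A $$ (i, j) * U $$ (j, l))"
proof -
  have "(mat_adjoint U * A * U) $$ (k, l) = (\<Sum>j<n. (\<Sum>i<n. cnj (U $$ (i, k)) * A $$ (i, j)) * U $$ (j, l))"
    using assms by (simp add: scalar_prod_def atLeast0LessThan)
  also have "\<dots> = (\<Sum>j<n. \<Sum>i<n. cnj (U $$ (i, k)) * A $$ (i, j) * U $$ (j, l))"
    by (simp add: sum_distrib_right)
  finally show ?thesis by (subst sum.swap) simp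
qed

lemma unitary_det:
  fixes A U :: "complex mat"
  assumes A: "A \<in> carrier_mat n n" and U: "U \<in> carrier_mat n n" "mat_adjoint U * U = 1\<^sub>m n"
    and D: "mat_adjoint U * A * U = mat_diag n d"
  shows "Determinant.det A = (\<Prod>i<n. d i)"
proof -
  have "(\<Prod>i<n. d i) = Determinant.det (mat_adjoint U * A * U)"
    unfolding D by (subst det_upper_triangular[of _ n])
      (auto simp: mat_diag_def diag_mat_def upper_triangular_def prod.list_conv_set_nth atLeast0LessThan)
  also have "\<dots> = Determinant.det A * Determinant.det (mat_adjoint U * U)"
    by (simp add: det_mult[OF mult_carrier_mat[OF mat_adjoint_carrier[OF U(1)] A] U(1)]
        det_mult[OF mat_adjoint_carrier[OF U(1)] A] det_mult[OF mat_adjoint_carrier[OF U(1)] U(1)])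
  finally show ?thesis using U by simp
qed

text \<open>The arithmetic-geometric mean inequality with mean 1: each factor is at most
  \<open>exp (d i - 1)\<close>, and these exponents sum to 0.\<close>

lemma prod_le_one_of_sum_eq:
  fixes d :: "nat \<Rightarrow> real"
  assumes "\<And>i. i < n \<Longrightarrow> 0 \<le> d i" "(\<Sum>i<n. d i) = real n"
  shows "(\<Prod>i<n. d i) \<le> 1"
proof -
  have "(\<Prod>i<n. d i) \<le> (\<Prod>i<n. exp (d i - 1))"
    using assms(1) exp_ge_add_one_self[of "d _ - 1"] by (intro prod_mono) auto
  also have "\<dots> = exp (\<Sum>i<n. (d i - 1))" by (simp add: exp_sum)
  finally show ?thesis using assms(2) by (simp add: sum_subtractf)
qed

text \<open>The eigenvalues are nonnegative and sum to the trace n, so their product is at most 1.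
  Positivity is asked of the quadratic form, because for the sine kernel that form is visibly an
  integral of squares.\<close>

lemma hadamard_psd:
  fixes A :: "complex mat"
  assumes A: "A \<in> carrier_mat n n" "hermitian_mat A"
    and psd: "\<And>x. 0 \<le> Re (\<Sum>i<n. \<Sum>j<n. cnj (x i) * A $$ (i, j) * x j)"
    and diag: "\<And>i. i < n \<Longrightarrow> A $$ (i, i) = 1"
  shows "cmod (Determinant.det A) \<le> 1"
proof -
  obtain U d where U: "U \<in> carrier_mat n n" "mat_adjoint U * U = 1\<^sub>m n" "U * mat_adjoint U = 1\<^sub>m n"
    "mat_adjoint U * A * U = mat_diag n (\<lambda>i. complex_of_real (d i))"
    using hermitian_diagonalization[OF A] .
  have d: "complex_of_real (d k) = (\<Sum>i<n. \<Sum>j<n. cnj (U $$ (i, k)) * A $$ (i, j) * U $$ (j, k))" if "k < n" for k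
    using unitary_conj_entry[OF A(1) U(1) that that] that by (simp add: U(4) mat_diag_def)
  have nonneg: "0 \<le> d k" if "k < n" for k
    using psd[of "\<lambda>i. U $$ (i, k)"] d[OF that, symmetric] by simp
  have UU: "(\<Sum>k<n. U $$ (j, k) * cnj (U $$ (i, k))) = (if i = j then 1 else 0)" if "i < n" "j < n" for i j
    using arg_cong[OF U(3), of "\<lambda>X. X $$ (j, i)"] that U(1) by (auto simp: scalar_prod_def atLeast0LessThan)
  have "complex_of_real (\<Sum>k<n. d k) = (\<Sum>k<n. \<Sum>i<n. \<Sum>j<n. A $$ (i, j) * (U $$ (j, k) * cnj (U $$ (i, k))))"
    by (simp add: d ac_simps)
  also have "\<dots> = (\<Sum>i<n. \<Sum>j<n. \<Sum>k<n. A $$ (i, j) * (U $$ (j, k) * cnj (U $$ (i, k))))"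
    by (subst sum.swap, rule sum.cong[OF refl], rule sum.swap)
  also have "\<dots> = (\<Sum>i<n. \<Sum>j<n. if i = j then A $$ (i, j) else 0)"
    by (intro sum.cong refl) (simp add: sum_distrib_left[symmetric] UU)
  also have "\<dots> = of_nat n" by (simp add: diag)
  finally have "(\<Sum>k<n. d k) = real n" by (metis of_real_eq_iff of_real_of_nat_eq)
  then have "(\<Prod>i<n. d i) \<le> 1" using nonneg by (intro prod_le_one_of_sum_eq) auto
  moreover have "0 \<le> (\<Prod>i<n. d i)" using nonneg by (intro prod_nonneg) auto
  moreover have "Determinant.det A = complex_of_real (\<Prod>i<n. d i)"
    using unitary_det[OF A(1) U(1,2,4)] by simp
  ultimately show ?thesis by (simp only: norm_of_real abs_of_nonneg)
qed

section \<open>Jensen's inequality and weighted Gram determinants\<close>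

lemma ln_integral_ge:
  fixes g \<rho> :: "'a \<Rightarrow> real"
  assumes "finite_measure M" "g \<in> borel_measurable M" "\<rho> \<in> borel_measurable M"
    and g: "\<And>x. x \<in> space M \<Longrightarrow> l \<le> g x \<and> g x \<le> L" and l: "0 < l"
    and \<rho>: "\<And>x. x \<in> space M \<Longrightarrow> 0 \<le> \<rho> x \<and> \<rho> x \<le> C"
    and one: "(\<integral>x. \<rho> x \<partial>M) = 1"
  shows "0 < (\<integral>x. g x * \<rho> x \<partial>M)" "(\<integral>x. ln (g x) * \<rho> x \<partial>M) \<le> ln (\<integral>x. g x * \<rho> x \<partial>M)"
proof -
  interpret finite_measure M by fact
  note [measurable] = assms(2,3)
  have i1: "integrable M \<rho>" using \<rho> by (intro integrable_const_bound[of _ C]) auto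
  have i2: "integrable M (\<lambda>x. g x * \<rho> x)"
  proof (rule integrable_const_bound[of _ "L * C"])
    show "AE x in M. norm (g x * \<rho> x) \<le> L * C"
    proof (rule AE_I2)
      fix x assume "x \<in> space M"
      then have "0 \<le> g x" "g x \<le> L" "0 \<le> \<rho> x" "\<rho> x \<le> C" using g[of x] \<rho>[of x] l by auto
      then show "norm (g x * \<rho> x) \<le> L * C" by (auto simp: abs_mult intro!: mult_mono)
    qed
  qed auto
  have i3: "integrable M (\<lambda>x. ln (g x) * \<rho> x)"
  proof (rule integrable_const_bound[of _ "(\<bar>ln l\<bar> + \<bar>ln L\<bar>) * C"])
    show "AE x in M. norm (ln (g x) * \<rho> x) \<le> (\<bar>ln l\<bar> + \<bar>ln L\<bar>) * C"
    proof (rule AE_I2)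
      fix x assume "x \<in> space M"
      then have *: "l \<le> g x" "g x \<le> L" "0 \<le> \<rho> x" "\<rho> x \<le> C" using g[of x] \<rho>[of x] by auto
      then have "ln l \<le> ln (g x)" "ln (g x) \<le> ln L" using l by auto
      then have "\<bar>ln (g x)\<bar> \<le> \<bar>ln l\<bar> + \<bar>ln L\<bar>" by linarith
      then show "norm (ln (g x) * \<rho> x) \<le> (\<bar>ln l\<bar> + \<bar>ln L\<bar>) * C"
        using * by (auto simp: abs_mult intro!: mult_mono)
    qed
  qed auto
  define m where "m = (\<integral>x. g x * \<rho> x \<partial>M)"
  have "(\<integral>x. l * \<rho> x \<partial>M) \<le> m"
    unfolding m_def using g \<rho> i1 i2 by (intro integral_mono) (auto intro!: mult_right_mono)
  then have m: "0 < m" using l one by simp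
  then show "0 < (\<integral>x. g x * \<rho> x \<partial>M)" by (simp add: m_def)
  \<comment> \<open>The tangent inequality \<open>ln y \<le> y - 1\<close> at y = g/m, weighted by
    \<rho>; its right-hand side integrates to 0 by the choice of m.\<close>
  have "(\<integral>x. ln (g x) * \<rho> x - ln m * \<rho> x \<partial>M) \<le> (\<integral>x. (g x * \<rho> x) / m - \<rho> x \<partial>M)"
  proof (rule integral_mono)
    fix x assume x: "x \<in> space M"
    then have gx: "0 < g x" using g[of x] l by auto
    have "ln (g x / m) \<le> g x / m - 1" using gx m by (intro ln_le_minus_one) auto
    then have "ln (g x) - ln m \<le> g x / m - 1" using gx m by (simp add: ln_div)
    from mult_right_mono[OF this, of "\<rho> x"]
    show "ln (g x) * \<rho> x - ln m * \<rho> x \<le> (g x * \<rho> x) / m - \<rho> x"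
      using \<rho>[OF x] by (simp add: algebra_simps)
  qed (use i1 i2 i3 in auto)
  also have "(\<integral>x. (g x * \<rho> x) / m - \<rho> x \<partial>M) = 0"
    using i1 i2 m one by (simp add: m_def[symmetric])
  also have "(\<integral>x. ln (g x) * \<rho> x - ln m * \<rho> x \<partial>M) = (\<integral>x. ln (g x) * \<rho> x \<partial>M) - ln m"
    using i1 i3 one by simp
  finally show "(\<integral>x. ln (g x) * \<rho> x \<partial>M) \<le> ln (\<integral>x. g x * \<rho> x \<partial>M)" by (simp add: m_def)
qed

text \<open>In a unitarily rotated frame that diagonalises the Gram matrix for the weight $g$, this is Jensen's
  inequality for each frame function separately.\<close>

theorem gibbs_det_bound:
  fixes v :: "nat \<Rightarrow> 'a \<Rightarrow> complex" and g :: "'a \<Rightarrow> real"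
  assumes fin: "finite_measure M" and g_meas: "g \<in> borel_measurable M"
    and v_meas: "\<And>i. i < n \<Longrightarrow> v i \<in> borel_measurable M"
    and g: "\<And>x. x \<in> space M \<Longrightarrow> l \<le> g x \<and> g x \<le> L" and l: "0 < l"
    and v: "\<And>i x. i < n \<Longrightarrow> x \<in> space M \<Longrightarrow> cmod (v i x) \<le> C"
    and orth: "\<And>i j. i < n \<Longrightarrow> j < n \<Longrightarrow> (\<integral>x. v i x * cnj (v j x) \<partial>M) = (if i = j then 1 else 0)"
  shows "\<exists>D>0. Determinant.det (Matrix.mat n n (\<lambda>(i, j). \<integral>x. of_real (g x) * (v i x * cnj (v j x)) \<partial>M)) = of_real D \<and>
    (\<Sum>i<n. \<integral>x. ln (g x) * (cmod (v i x))\<^sup>2 \<partial>M) \<le> ln D"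
proof -
  interpret finite_measure M by fact
  note [measurable] = g_meas v_meas
  have gb: "\<bar>g x\<bar> \<le> L" if "x \<in> space M" for x using g[OF that] l by auto
  have vv: "cmod (v i x * cnj (v j x)) \<le> C * C" if "i < n" "j < n" "x \<in> space M" for i j x
  proof -
    have "0 \<le> C" using v[OF that(1,3)] norm_ge_zero[of "v i x"] by linarith
    then show ?thesis
      using v[of i x] v[of j x] that unfolding norm_mult complex_mod_cnj by (intro mult_mono) auto
  qed
  have cnj_meas [measurable]: "cnj \<in> borel_measurable borel"
    by (intro borel_measurable_continuous_onI continuous_intros)
  have meas [measurable]: "(\<lambda>x. v i x * cnj (v j x)) \<in> borel_measurable M" if "i < n" "j < n" for i j
    using that v_meas by (intro borel_measurable_times) (auto intro: measurable_compose)
  have int1: "integrable M (\<lambda>x. v i x * cnj (v j x))" if "i < n" "j < n" for i j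
    using that vv by (intro integrable_const_bound[of _ "C * C"]) auto
  have int2: "integrable M (\<lambda>x. of_real (g x) * (v i x * cnj (v j x)))" if "i < n" "j < n" for i j
  proof (rule integrable_const_bound[of _ "L * (C * C)"])
    show "AE x in M. norm (of_real (g x) * (v i x * cnj (v j x))) \<le> L * (C * C)"
    proof (rule AE_I2)
      fix x assume x: "x \<in> space M"
      have "0 \<le> L" using gb[OF x] by linarith
      then have "\<bar>g x\<bar> * cmod (v i x * cnj (v j x)) \<le> L * (C * C)"
        using gb[OF x] vv[OF that x] by (intro mult_mono) auto
      then show "norm (of_real (g x) * (v i x * cnj (v j x))) \<le> L * (C * C)"
        by (simp add: norm_mult)
    qed
  qed (use that in auto)
  define A where "A = Matrix.mat n n (\<lambda>(i, j). \<integral>x. of_real (g x) * (v i x * cnj (v j x)) \<partial>M)"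
  have A: "A \<in> carrier_mat n n" by (simp add: A_def)
  have "cnj (\<integral>x. of_real (g x) * (v j x * cnj (v i x)) \<partial>M) = (\<integral>x. of_real (g x) * (v i x * cnj (v j x)) \<partial>M)" for i j
    by (subst Bochner_Integration.integral_cnj[symmetric]) (simp add: mult.commute)
  then have "hermitian_mat A" unfolding hermitian_mat_def A_def
    by (intro eq_matI) auto
  then obtain U d where U: "U \<in> carrier_mat n n" "mat_adjoint U * U = 1\<^sub>m n" "U * mat_adjoint U = 1\<^sub>m n"
    "mat_adjoint U * A * U = mat_diag n (\<lambda>i. complex_of_real (d i))"
    using hermitian_diagonalization[OF A] by blast
  \<comment> \<open>The conjugate on U makes the Gram matrix of the \<open>w k\<close> with weight
    \<open>g\<close> equal to \<open>mat_adjoint U * A * U\<close>, hence diagonal.\<close>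
  define w where "w k x = (\<Sum>i<n. cnj (U $$ (i, k)) * v i x)" for k x
  have w_meas [measurable]: "w k \<in> borel_measurable M" for k unfolding w_def by measurable
  have ww: "w k x * cnj (w l x) = (\<Sum>i<n. \<Sum>j<n. cnj (U $$ (i, k)) * U $$ (j, l) * (v i x * cnj (v j x)))" for k l x
    unfolding w_def cnj_sum sum_product by (simp add: ac_simps)
  have UU: "(\<Sum>k<n. U $$ (j, k) * cnj (U $$ (i, k))) = (if i = j then 1 else 0)" if "i < n" "j < n" for i j
    using arg_cong[OF U(3), of "\<lambda>X. X $$ (j, i)"] that U(1) by (auto simp: scalar_prod_def atLeast0LessThan)
  have UU': "(\<Sum>i<n. cnj (U $$ (i, k)) * U $$ (i, l)) = (if k = l then 1 else 0)" if "k < n" "l < n" for k l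
    using arg_cong[OF U(2), of "\<lambda>X. X $$ (k, l)"] that U(1) by (auto simp: scalar_prod_def atLeast0LessThan)
  \<comment> \<open>A unitary rotation preserves the pointwise sum of squared moduli, so the
    averages of \<open>ln g\<close> have the same total for \<open>v\<close> and for
    \<open>w\<close>.\<close>
  have sumsq: "(\<Sum>k<n. (cmod (w k x))\<^sup>2) = (\<Sum>i<n. (cmod (v i x))\<^sup>2)" for x
  proof -
    have "complex_of_real (\<Sum>k<n. (cmod (w k x))\<^sup>2) = (\<Sum>k<n. \<Sum>i<n. \<Sum>j<n. (v i x * cnj (v j x)) * (U $$ (j, k) * cnj (U $$ (i, k))))"
      by (simp add: complex_norm_square ww ac_simps del: of_real_power)
    also have "\<dots> = (\<Sum>i<n. \<Sum>j<n. \<Sum>k<n. (v i x * cnj (v j x)) * (U $$ (j, k) * cnj (U $$ (i, k))))"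
      by (subst sum.swap, rule sum.cong[OF refl], rule sum.swap)
    also have "\<dots> = (\<Sum>i<n. \<Sum>j<n. if i = j then v i x * cnj (v j x) else 0)"
      by (intro sum.cong refl) (simp add: sum_distrib_left[symmetric] UU)
    also have "\<dots> = complex_of_real (\<Sum>i<n. (cmod (v i x))\<^sup>2)" by (simp add: complex_norm_square del: of_real_power)
    finally show ?thesis by (simp only: of_real_eq_iff)
  qed
  have w_one: "(\<integral>x. (cmod (w k x))\<^sup>2 \<partial>M) = 1" if k: "k < n" for k
  proof -
    have "complex_of_real (\<integral>x. (cmod (w k x))\<^sup>2 \<partial>M) = (\<integral>x. w k x * cnj (w k x) \<partial>M)"
      by (simp add: integral_complex_of_real[symmetric] complex_norm_square del: integral_complex_of_real of_real_power)
    also have "\<dots> = (\<Sum>i<n. \<Sum>j<n. cnj (U $$ (i, k)) * U $$ (j, k) * (\<integral>x. v i x * cnj (v j x) \<partial>M))"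
      unfolding ww using int1 by (subst Bochner_Integration.integral_sum; (intro Bochner_Integration.integrable_sum)?; auto)+
    also have "\<dots> = (\<Sum>i<n. \<Sum>j<n. if i = j then cnj (U $$ (i, k)) * U $$ (j, k) else 0)"
      by (intro sum.cong refl) (auto simp: orth)
    also have "\<dots> = 1" using UU'[OF k k] by simp
    finally show ?thesis by (simp only: of_real_eq_1_iff)
  qed
  have w_d: "(\<integral>x. g x * (cmod (w k x))\<^sup>2 \<partial>M) = d k" if k: "k < n" for k
  proof -
    have "complex_of_real (\<integral>x. g x * (cmod (w k x))\<^sup>2 \<partial>M) = (\<integral>x. of_real (g x) * (w k x * cnj (w k x)) \<partial>M)"
      by (simp add: integral_complex_of_real[symmetric] complex_norm_square del: integral_complex_of_real of_real_power)
    also have "\<dots> = (\<integral>x. (\<Sum>i<n. \<Sum>j<n. cnj (U $$ (i, k)) * U $$ (j, k) * (of_real (g x) * (v i x * cnj (v j x)))) \<partial>M)"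
      by (simp add: ww sum_distrib_left ac_simps)
    also have "\<dots> = (\<Sum>i<n. \<Sum>j<n. cnj (U $$ (i, k)) * U $$ (j, k) * A $$ (i, j))"
      using int2 by (subst Bochner_Integration.integral_sum; (intro Bochner_Integration.integrable_sum)?; auto simp: A_def)+
    also have "\<dots> = (mat_adjoint U * A * U) $$ (k, k)"
      using k by (simp add: unitary_conj_entry[OF A U(1)] ac_simps)
    finally show ?thesis using k by (simp add: U(4) mat_diag_def)
  qed
  have wC: "(cmod (w k x))\<^sup>2 \<le> real n * C\<^sup>2" if "k < n" "x \<in> space M" for k x
  proof -
    have "(cmod (w k x))\<^sup>2 \<le> (\<Sum>k<n. (cmod (w k x))\<^sup>2)" using that by (intro member_le_sum) auto
    also have "\<dots> \<le> (\<Sum>i<n. C\<^sup>2)" unfolding sumsq using v that by (intro sum_mono power_mono) auto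
    finally show ?thesis by simp
  qed
  have jensen: "0 < d k" "(\<integral>x. ln (g x) * (cmod (w k x))\<^sup>2 \<partial>M) \<le> ln (d k)" if k: "k < n" for k
    using ln_integral_ge[OF fin g_meas _ g l, of "\<lambda>x. (cmod (w k x))\<^sup>2" "real n * C\<^sup>2"] wC w_one w_d k by auto
  have lnb: "\<bar>ln (g x)\<bar> \<le> \<bar>ln l\<bar> + \<bar>ln L\<bar>" if "x \<in> space M" for x
  proof -
    have "ln l \<le> ln (g x)" "ln (g x) \<le> ln L" using g[OF that] l by auto
    then show ?thesis by linarith
  qed
  have int3: "integrable M (\<lambda>x. ln (g x) * (cmod (h x))\<^sup>2)" 
    if "h \<in> borel_measurable M" "\<And>x. x \<in> space M \<Longrightarrow> (cmod (h x))\<^sup>2 \<le> K" for h :: "'a \<Rightarrow> complex" and K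
  proof (rule integrable_const_bound[of _ "(\<bar>ln l\<bar> + \<bar>ln L\<bar>) * K"])
    show "AE x in M. norm (ln (g x) * (cmod (h x))\<^sup>2) \<le> (\<bar>ln l\<bar> + \<bar>ln L\<bar>) * K"
      using lnb that(2) unfolding norm_mult by (intro AE_I2 mult_mono) auto
  qed (use that in auto)
  have "(\<Sum>i<n. \<integral>x. ln (g x) * (cmod (v i x))\<^sup>2 \<partial>M) = (\<integral>x. ln (g x) * (\<Sum>i<n. (cmod (v i x))\<^sup>2) \<partial>M)"
    using v by (subst Bochner_Integration.integral_sum[symmetric]) (auto simp: sum_distrib_left intro!: int3[of _ "C\<^sup>2"] power_mono)
  also have "\<dots> = (\<Sum>k<n. \<integral>x. ln (g x) * (cmod (w k x))\<^sup>2 \<partial>M)"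
    using wC by (subst Bochner_Integration.integral_sum[symmetric]) (auto simp: sumsq[symmetric] sum_distrib_left intro!: int3[of _ "real n * C\<^sup>2"])
  also have "\<dots> \<le> (\<Sum>k<n. ln (d k))" using jensen by (intro sum_mono) auto
  also have "\<dots> = ln (\<Prod>k<n. d k)" by (intro ln_prod[symmetric]) (use jensen(1) in force)+
  finally have *: "(\<Sum>i<n. \<integral>x. ln (g x) * (cmod (v i x))\<^sup>2 \<partial>M) \<le> ln (\<Prod>k<n. d k)" .
  have "Determinant.det A = complex_of_real (\<Prod>k<n. d k)"
    using unitary_det[OF A U(1,2,4)] by simp
  moreover have "0 < (\<Prod>k<n. d k)" using jensen by (intro prod_pos) auto
  ultimately show ?thesis using * unfolding A_def by blast
qed

section \<open>Expansion of a determinant into principal minors\<close>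

lemma det_mat_eq_sum_permutes:
  "Determinant.det (Matrix.mat n n f) = (\<Sum>p | p permutes {..<n}. of_int (sign p) * (\<Prod>i<n. f (i, p i)))"
proof -
  have "p i < n" if "p permutes {..<n}" "i < n" for p i
    using permutes_in_image[OF that(1), of i] that(2) by simp
  then show ?thesis
    by (subst det_def'[of _ n]) (auto simp: atLeast0LessThan intro!: sum.cong prod.cong)
qed

text \<open>The principal minor of A with rows and columns in S. Using permutations of the set S
  itself avoids enumerating S.\<close>

definition minor_sum :: "(nat \<Rightarrow> nat \<Rightarrow> 'a :: comm_ring_1) \<Rightarrow> nat set \<Rightarrow> 'a" where
  "minor_sum A S = (\<Sum>p | p permutes S. of_int (sign p) * (\<Prod>i\<in>S. A i (p i)))"

text \<open>When the Leibniz product is multiplied out, S collects the indices at which the entry of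
  A is chosen. Off S the identity entries force the permutation to fix every index, so it permutes
  S.\<close>

lemma det_one_plus_eq_sum_minors:
  fixes A :: "nat \<Rightarrow> nat \<Rightarrow> 'a :: comm_ring_1"
  shows "Determinant.det (Matrix.mat n n (\<lambda>(i, j). (if i = j then 1 else 0) + z * A i j)) =
    (\<Sum>S\<in>Pow {..<n}. z ^ card S * minor_sum A S)"
proof -
  let ?N = "{..<n}"
  have "Determinant.det (Matrix.mat n n (\<lambda>(i, j). (if i = j then 1 else 0) + z * A i j)) =
    (\<Sum>p | p permutes ?N. of_int (sign p) * (\<Prod>i\<in>?N. z * A i (p i) + (if i = p i then 1 else 0)))"
    by (simp add: det_mat_eq_sum_permutes add.commute)
  also have "\<dots> = (\<Sum>p | p permutes ?N. \<Sum>S\<in>Pow ?N. of_int (sign p) *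
      ((\<Prod>i\<in>S. z * A i (p i)) * (\<Prod>i\<in>?N - S. if i = p i then 1 else 0)))"
    by (subst prod_add) (auto simp: sum_distrib_left)
  also have "\<dots> = (\<Sum>S\<in>Pow ?N. \<Sum>p | p permutes ?N. of_int (sign p) *
      ((\<Prod>i\<in>S. z * A i (p i)) * (\<Prod>i\<in>?N - S. if i = p i then 1 else 0)))"
    by (rule sum.swap)
  also have "\<dots> = (\<Sum>S\<in>Pow ?N. z ^ card S * minor_sum A S)"
  proof (intro sum.cong refl)
    fix S assume S: "S \<in> Pow ?N"
    have "(\<Sum>p | p permutes ?N. of_int (sign p) *
      ((\<Prod>i\<in>S. z * A i (p i)) * (\<Prod>i\<in>?N - S. if i = p i then 1 else 0))) =
      (\<Sum>p | p permutes S. of_int (sign p) * (\<Prod>i\<in>S. z * A i (p i)))"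
    proof (rule sum.mono_neutral_cong_right)
      show "finite {p. p permutes ?N}" by (simp add: finite_permutations)
      show "{p. p permutes S} \<subseteq> {p. p permutes ?N}" using S permutes_subset by auto
      show "\<forall>p\<in>{p. p permutes ?N} - {p. p permutes S}. of_int (sign p) *
        ((\<Prod>i\<in>S. z * A i (p i)) * (\<Prod>i\<in>?N - S. if i = p i then 1 else 0)) = 0"
      proof
        fix p assume "p \<in> {p. p permutes ?N} - {p. p permutes S}"
        then obtain i where i: "i \<in> ?N - S" "p i \<noteq> i" using permutes_superset[of p ?N S] by auto
        have "(\<Prod>i\<in>?N - S. if i = p i then 1 else 0 :: 'a) = 0"
          by (rule prod_zero, simp, rule bexI[OF _ i(1)]) (use i(2) in simp)
        then show "of_int (sign p) *
          ((\<Prod>i\<in>S. z * A i (p i)) * (\<Prod>i\<in>?N - S. if i = p i then 1 else 0)) = 0" by simp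
      qed
      show "of_int (sign p) * ((\<Prod>i\<in>S. z * A i (p i)) * (\<Prod>i\<in>?N - S. if i = p i then 1 else 0)) =
        of_int (sign p) * (\<Prod>i\<in>S. z * A i (p i))" if "p \<in> {p. p permutes S}" for p
      proof -
        have "(\<Prod>i\<in>?N - S. if i = p i then 1 else 0 :: 'a) = 1"
          using that by (intro prod.neutral) (auto simp: permutes_not_in)
        then show ?thesis by simp
      qed
    qed
    also have "\<dots> = z ^ card S * minor_sum A S"
      by (simp add: minor_sum_def prod.distrib sum_distrib_left ac_simps)
    finally show "(\<Sum>p | p permutes ?N. of_int (sign p) *
      ((\<Prod>i\<in>S. z * A i (p i)) * (\<Prod>i\<in>?N - S. if i = p i then 1 else 0))) = z ^ card S * minor_sum A S" .
  qed
  finally show ?thesis .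
qed

text \<open>Transporting permutations along the injection f preserves their signs, so the order in
  which f lists its image is irrelevant.\<close>

lemma det_reindex_eq_minor_sum:
  fixes A :: "nat \<Rightarrow> nat \<Rightarrow> 'a :: comm_ring_1"
  assumes f: "inj_on f {..<k}"
  shows "Determinant.det (Matrix.mat k k (\<lambda>(i, j). A (f i) (f j))) = minor_sum A (f ` {..<k})"
proof -
  have bij: "bij_betw f {..<k} (f ` {..<k})" using f by (simp add: inj_on_imp_bij_betw)
  have "minor_sum A (f ` {..<k}) =
    (\<Sum>p | p permutes {..<k}. of_int (sign (map_permutation {..<k} f p)) *
      (\<Prod>i\<in>f ` {..<k}. A i (map_permutation {..<k} f p i)))"
    unfolding minor_sum_def
    using sum.reindex_bij_betw[OF bij_betw_permutations[OF bij], of "\<lambda>p. of_int (sign p) * (\<Prod>i\<in>f ` {..<k}. A i (p i))", symmetric]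
    by (simp add: map_permutation_def restrict_id_def o_def)
  also have "\<dots> = (\<Sum>p | p permutes {..<k}. of_int (sign p) * (\<Prod>i<k. A (f i) (f (p i))))"
  proof (intro sum.cong refl)
    fix p assume "p \<in> {p. p permutes {..<k}}"
    then have p: "p permutes {..<k}" by simp
    have "(\<Prod>i\<in>f ` {..<k}. A i (map_permutation {..<k} f p i)) = (\<Prod>i<k. A (f i) (f (p i)))"
      by (subst prod.reindex[OF f]) (auto intro!: prod.cong simp: map_permutation_apply[OF f])
    then show "of_int (sign (map_permutation {..<k} f p)) *
      (\<Prod>i\<in>f ` {..<k}. A i (map_permutation {..<k} f p i)) = of_int (sign p) * (\<Prod>i<k. A (f i) (f (p i)))"
      using sign_map_permutation[OF f p] by simp
  qed
  finally show ?thesis by (simp add: det_mat_eq_sum_permutes)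
qed

lemma det_reindex_eq_0:
  fixes A :: "nat \<Rightarrow> nat \<Rightarrow> 'a :: comm_ring_1"
  assumes "\<not> inj_on f {..<k}"
  shows "Determinant.det (Matrix.mat k k (\<lambda>(i, j). A (f i) (f j))) = 0"
proof -
  obtain i j where "i < k" "j < k" "i \<noteq> j" "f i = f j" using assms by (auto simp: inj_on_def)
  then show ?thesis by (intro det_identical_rows[of _ k i j]) (auto intro!: eq_vecI)
qed

text \<open>A map that is not injective gives two equal rows, and each k-subset is the image of
  exactly k! injections. Sums over all maps, rather than over subsets, are what integration over a
  cube produces.\<close>

lemma sum_det_reindex:
  fixes A :: "nat \<Rightarrow> nat \<Rightarrow> 'a :: field_char_0"
  shows "(\<Sum>f\<in>{..<k} \<rightarrow>\<^sub>E {..<n}. Determinant.det (Matrix.mat k k (\<lambda>(i, j). A (f i) (f j)))) =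
    fact k * (\<Sum>S | S \<subseteq> {..<n} \<and> card S = k. minor_sum A S)"
proof -
  let ?I = "{f \<in> {..<k} \<rightarrow>\<^sub>E {..<n}. inj_on f {..<k}}"
  let ?S = "{S. S \<subseteq> {..<n} \<and> card S = k}"
  have fin: "finite ({..<k} \<rightarrow>\<^sub>E {..<n})" by (simp add: finite_PiE)
  have finS: "finite ?S" by (rule finite_subset[of _ "Pow {..<n}"]) auto
  have img: "f ` {..<k} \<in> ?S" if "f \<in> ?I" for f
    using that by (auto simp: card_image)
  have "(\<Sum>f\<in>{..<k} \<rightarrow>\<^sub>E {..<n}. Determinant.det (Matrix.mat k k (\<lambda>(i, j). A (f i) (f j)))) =
    (\<Sum>f\<in>?I. minor_sum A (f ` {..<k}))"
    using fin by (intro sum.mono_neutral_cong_right) (auto simp: det_reindex_eq_0 det_reindex_eq_minor_sum)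
  also have "\<dots> = (\<Sum>S\<in>?S. \<Sum>f\<in>{f \<in> ?I. f ` {..<k} = S}. minor_sum A (f ` {..<k}))"
    using img by (intro sum.group[symmetric] finS finite_subset[OF _ fin]) auto
  also have "\<dots> = (\<Sum>S\<in>?S. fact k * minor_sum A S)"
  proof (intro sum.cong refl)
    fix S assume S: "S \<in> ?S"
    then have finS: "finite S" using finite_subset by auto
    have "{f \<in> ?I. f ` {..<k} = S} = {f \<in> {..<k} \<rightarrow>\<^sub>E S. inj_on f {..<k}}"
    proof (intro equalityI subsetI)
      fix f assume f: "f \<in> {f \<in> {..<k} \<rightarrow>\<^sub>E S. inj_on f {..<k}}"
      then have "f ` {..<k} = S" using S finS
        by (intro card_subset_eq) (auto simp: card_image)
      moreover have "f \<in> {..<k} \<rightarrow>\<^sub>E {..<n}" using f S by (auto simp: PiE_def Pi_def)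
      ultimately show "f \<in> {f \<in> ?I. f ` {..<k} = S}" using f by auto
    qed (auto simp: PiE_def)
    then have "card {f \<in> ?I. f ` {..<k} = S} = fact k"
      using card_inj_on_subset_funcset[of "{..<k}" S "{..<k}"] finS S
      by (simp add: fact_prod_rev)
    then show "(\<Sum>f\<in>{f \<in> ?I. f ` {..<k} = S}. minor_sum A (f ` {..<k})) = fact k * minor_sum A S"
      by simp
  qed
  finally show ?thesis by (simp add: sum_distrib_left)
qed

text \<open>The discrete counterpart of Fredholm's series, with sums over maps in place of integrals
  over k-fold products.\<close>

lemma det_one_plus_expansion:
  fixes A :: "nat \<Rightarrow> nat \<Rightarrow> 'a :: field_char_0"
  shows "Determinant.det (Matrix.mat n n (\<lambda>(i, j). (if i = j then 1 else 0) + z * A i j)) =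
    (\<Sum>k\<le>n. z ^ k / fact k * (\<Sum>f\<in>{..<k} \<rightarrow>\<^sub>E {..<n}. Determinant.det (Matrix.mat k k (\<lambda>(i, j). A (f i) (f j)))))"
proof -
  have "(\<Sum>S\<in>Pow {..<n}. z ^ card S * minor_sum A S) =
      (\<Sum>k\<le>n. \<Sum>S\<in>{S \<in> Pow {..<n}. card S = k}. z ^ card S * minor_sum A S)"
  proof (intro sum.group[symmetric])
    show "card ` Pow {..<n} \<subseteq> {..n}"
    proof
      fix k assume "k \<in> card ` Pow {..<n}"
      then obtain S where "S \<subseteq> {..<n}" "k = card S" by auto
      then show "k \<in> {..n}" using card_mono[of "{..<n}" S] by simp
    qed
  qed auto
  also have "\<dots> = (\<Sum>k\<le>n. z ^ k * (\<Sum>S | S \<subseteq> {..<n} \<and> card S = k. minor_sum A S))"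
    by (intro sum.cong refl) (auto simp: sum_distrib_left intro!: sum.cong)
  finally show ?thesis
    unfolding det_one_plus_eq_sum_minors sum_det_reindex by (simp add: field_simps)
qed

text \<open>Lets the finite expansion be read as an infinite series in k, so that its limit can be
  taken term by term.\<close>

lemma sum_det_reindex_eq_0:
  fixes A :: "nat \<Rightarrow> nat \<Rightarrow> 'a :: field_char_0"
  assumes "n < k"
  shows "(\<Sum>f\<in>{..<k} \<rightarrow>\<^sub>E {..<n}. Determinant.det (Matrix.mat k k (\<lambda>(i, j). A (f i) (f j)))) = 0"
proof -
  have "card S \<noteq> k" if "S \<subseteq> {..<n}" for S
    using assms card_mono[OF _ that] by simp
  then have "{S. S \<subseteq> {..<n} \<and> card S = k} = {}" by blast
  then show ?thesis unfolding sum_det_reindex by (simp only: sum.empty mult_zero_right)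
qed

section \<open>The sine determinant as a limit of Toeplitz determinants\<close>

text \<open>The circle is parametrised by $t \in [-1/2, 1/2]$, so that integrals over \<open>arc (1 / 2)\<close> are means.\<close>

definition arc :: "real \<Rightarrow> real measure" where
  "arc x = restrict_space lborel {-x..x}"

lemma space_arc [simp]: "space (arc x) = {-x..x}"
  by (simp add: arc_def space_restrict_space)

lemma finite_measure_arc [simp, intro]: "finite_measure (arc x)"
  unfolding arc_def by (intro finite_measureI) (auto simp: emeasure_restrict_space space_restrict_space emeasure_lborel_Icc_eq)

lemma borel_measurable_arc:
  assumes "continuous_on UNIV h"
  shows "h \<in> borel_measurable (arc x)"
  unfolding arc_def using borel_measurable_continuous_onI[OF assms]
  by (intro measurable_restrict_space1) simp

lemma integrable_arc:
  fixes h :: "real \<Rightarrow> 'b :: {banach, second_countable_topology}"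
  assumes "continuous_on UNIV h"
  shows "integrable (arc x) h"
  unfolding arc_def using borel_integrable_atLeastAtMost'[OF continuous_on_subset[OF assms], of "-x" x]
  by (subst integrable_restrict_space) (auto simp: set_integrable_def)

lemma integral_arc:
  fixes h :: "real \<Rightarrow> 'b :: euclidean_space"
  assumes "continuous_on UNIV h"
  shows "(\<integral>t. h t \<partial>arc x) = integral {-x..x} h"
  unfolding arc_def using set_borel_integral_eq_integral(2)[OF borel_integrable_atLeastAtMost'[OF continuous_on_subset[OF assms]], of "-x" x]
  by (subst integral_restrict_space) (auto simp: set_lebesgue_integral_def)

lemma integral_cis_arc:
  assumes "0 \<le> x"
  shows "(\<integral>t. cis (2 * pi * s * t) \<partial>arc x) = (if s = 0 then of_real (2 * x) else of_real (sin (2 * pi * s * x) / (pi * s)))"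
proof (cases "s = 0")
  case True
  have "(\<integral>t. cis (2 * pi * s * t) \<partial>arc x) = integral {-x..x} (\<lambda>t. cis (2 * pi * s * t))"
    by (intro integral_arc continuous_intros)
  then show ?thesis using True assms by (simp add: scaleR_conv_of_real)
next
  case False
  have "((\<lambda>t. cis (2 * pi * s * t)) has_integral
      cis (2 * pi * s * x) / (2 * pi * s * \<i>) - cis (2 * pi * s * (-x)) / (2 * pi * s * \<i>)) {-x..x}"
  proof (rule fundamental_theorem_of_calculus)
    fix t
    have "((\<lambda>t. exp (\<i> * of_real (2 * pi * s) * of_real t) / (2 * pi * s * \<i>)) has_vector_derivative 
        exp (\<i> * of_real (2 * pi * s) * of_real t)) (at t within {-x..x})"
      using False
      by (auto intro!: derivative_eq_intros has_vector_derivative_real_field simp: field_simps)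
    then show "((\<lambda>t. cis (2 * pi * s * t) / (2 * pi * s * \<i>)) has_vector_derivative cis (2 * pi * s * t)) (at t within {-x..x})"
      by (simp add: cis_conv_exp mult.assoc)
  qed (use assms in auto)
  also have "cis (2 * pi * s * x) / (2 * pi * s * \<i>) - cis (2 * pi * s * (-x)) / (2 * pi * s * \<i>) = of_real (sin (2 * pi * s * x) / (pi * s))"
  proof -
    have "cis a - cis (- a) = 2 * \<i> * of_real (sin a)" for a by (simp add: complex_eq_iff)
    from this[of "2 * pi * s * x"] show ?thesis using False
      by (simp add: diff_divide_distrib[symmetric])
  qed
  finally show ?thesis using False
    by (subst integral_arc) (auto intro!: continuous_intros integral_unique)
qed

text \<open>The sine kernel is the Fourier transform of the indicator of [-1/2, 1/2]; this is the
  source of its positivity.\<close>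

lemma sine_kernel_eq_integral:
  "complex_of_real (sine_kernel x y) = (\<integral>t. cis (2 * pi * (x - y) * t) \<partial>arc (1 / 2))"
proof -
  have "2 * pi * (x - y) * (1 / 2) = pi * (x - y)" by simp
  then show ?thesis by (subst integral_cis_arc) (auto simp: sine_kernel_def)
qed

lemma of_real_det_mat:
  "complex_of_real (Determinant.det (Matrix.mat n n f)) = Determinant.det (Matrix.mat n n (\<lambda>p. complex_of_real (f p)))"
  by (simp add: det_mat_eq_sum_permutes)

lemma det_mat_scale:
  "Determinant.det (Matrix.mat k k (\<lambda>(i, j). s * f i j)) = s ^ k * Determinant.det (Matrix.mat k k (\<lambda>(i, j). f i j))"
  unfolding det_mat_eq_sum_permutes by (simp add: prod.distrib sum_distrib_left ac_simps)

lemma sine_kernel_commute: "sine_kernel x y = sine_kernel y x"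
  by (simp add: sine_kernel_def) (metis (no_types, opaque_lifting) minus_diff_eq minus_divide_divide mult_minus_right sin_minus)

text \<open>The quadratic form is the integral of a squared modulus of an exponential sum and the
  diagonal is 1, so Hadamard's inequality applies. The bound is uniform in the points and in n,
  which makes it a dominating constant for the integrands and the series alike.\<close>

lemma det_sine_kernel_le_1: "\<bar>Determinant.det (Matrix.mat n n (\<lambda>(i, j). sine_kernel (x i) (x j)))\<bar> \<le> 1"
proof -
  define A where "A = Matrix.mat n n (\<lambda>(i, j). complex_of_real (sine_kernel (x i) (x j)))"
  have "cmod (Determinant.det A) \<le> 1"
  proof (rule hadamard_psd)
    show "A \<in> carrier_mat n n" by (simp add: A_def)
    show "hermitian_mat A" unfolding hermitian_mat_def A_def
      by (intro eq_matI) (auto simp: sine_kernel_commute)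
    show "A $$ (i, i) = 1" if "i < n" for i using that by (simp add: A_def sine_kernel_def)
    fix y :: "nat \<Rightarrow> complex"
    have "(\<Sum>i<n. \<Sum>j<n. cnj (y i) * A $$ (i, j) * y j) =
      (\<Sum>i<n. \<Sum>j<n. \<integral>t. cnj (y i) * y j * cis (2 * pi * (x i - x j) * t) \<partial>arc (1 / 2))"
      by (auto simp: A_def sine_kernel_eq_integral ac_simps intro!: sum.cong)
    also have "\<dots> = (\<integral>t. (\<Sum>i<n. \<Sum>j<n. cnj (y i) * y j * cis (2 * pi * (x i - x j) * t)) \<partial>arc (1 / 2))"
      by (subst Bochner_Integration.integral_sum; (intro integrable_arc continuous_intros)?; simp?)+
    also have "\<dots> = (\<integral>t. of_real ((cmod (\<Sum>i<n. y i * cis (- 2 * pi * x i * t)))\<^sup>2) \<partial>arc (1 / 2))"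
    proof (rule Bochner_Integration.integral_cong[OF refl])
      fix t
      have "of_real ((cmod (\<Sum>i<n. y i * cis (- 2 * pi * x i * t)))\<^sup>2) =
          cnj (\<Sum>i<n. y i * cis (- 2 * pi * x i * t)) * (\<Sum>j<n. y j * cis (- 2 * pi * x j * t))"
        by (subst complex_norm_square) (simp add: mult.commute)
      also have "\<dots> = (\<Sum>i<n. \<Sum>j<n. cnj (y i) * y j * (cis (2 * pi * x i * t) * cis (- 2 * pi * x j * t)))"
        unfolding cnj_sum sum_product by (simp add: cis_cnj ac_simps)
      also have "\<dots> = (\<Sum>i<n. \<Sum>j<n. cnj (y i) * y j * cis (2 * pi * (x i - x j) * t))"
        by (simp add: cis_mult algebra_simps)
      finally show "(\<Sum>i<n. \<Sum>j<n. cnj (y i) * y j * cis (2 * pi * (x i - x j) * t)) =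
        of_real ((cmod (\<Sum>i<n. y i * cis (- 2 * pi * x i * t)))\<^sup>2)" ..
    qed
    also have "\<dots> = of_real (\<integral>t. (cmod (\<Sum>i<n. y i * cis (- 2 * pi * x i * t)))\<^sup>2 \<partial>arc (1 / 2))"
      by (rule integral_complex_of_real)
    finally show "0 \<le> Re (\<Sum>i<n. \<Sum>j<n. cnj (y i) * A $$ (i, j) * y j)" by simp
  qed
  moreover have "Determinant.det A = of_real (Determinant.det (Matrix.mat n n (\<lambda>(i, j). sine_kernel (x i) (x j))))"
    unfolding A_def of_real_det_mat by (simp add: case_prod_unfold)
  ultimately show ?thesis by simp
qed

lemma sine_kernel_eq_sinc: "sine_kernel x y = sinc (pi * (x - y))"
  by (simp add: sine_kernel_def)

lemma tendsto_sine_kernel: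
  assumes "(a \<longlongrightarrow> x) net" "(b \<longlongrightarrow> y) net"
  shows "((\<lambda>n. sine_kernel (a n) (b n)) \<longlongrightarrow> sine_kernel x y) net"
  unfolding sine_kernel_eq_sinc
  by (rule isCont_tendsto_compose[OF isCont_sinc]) (intro tendsto_intros assms)

lemma sine_kernel_measurable [measurable (raw)]:
  assumes [measurable]: "f \<in> borel_measurable M" "g \<in> borel_measurable M"
  shows "(\<lambda>x. sine_kernel (f x) (g x)) \<in> borel_measurable M"
  unfolding sine_kernel_def by measurable

lemma det_mat_measurable:
  assumes [measurable]: "\<And>i j. i < k \<Longrightarrow> j < k \<Longrightarrow> (\<lambda>x. f x i j) \<in> borel_measurable M"
  shows "(\<lambda>x. Determinant.det (Matrix.mat k k (\<lambda>(i, j). f x i j)) :: real) \<in> borel_measurable M"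
proof -
  have "(\<lambda>x. f x i (p i)) \<in> borel_measurable M" if "p permutes {..<k}" "i < k" for p i
    using permutes_in_image[OF that(1), of i] that(2) by (intro assms) auto
  then show ?thesis unfolding det_mat_eq_sum_permutes
    by (intro borel_measurable_sum borel_measurable_times borel_measurable_prod) auto
qed

section \<open>Riemann sums as integrals of step functions on a grid\<close>

definition cell :: "real \<Rightarrow> nat \<Rightarrow> real \<Rightarrow> nat" where
  "cell c n y = nat \<lfloor>real n * y / c\<rfloor>"

lemma cell_measurable [measurable]: "cell c n \<in> measurable borel (count_space UNIV)"
  unfolding cell_def by measurable

text \<open>The half-open cell of index 0 contains 0, which the open interval omits; the excluded
  point is a null set.\<close>

lemma cell_eq_iff:
  assumes "0 < c" "0 < n" "j < n" "y \<noteq> 0"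
  shows "y \<in> {0<..<c} \<and> cell c n y = j \<longleftrightarrow> y \<in> {real j * c / n..<(real j + 1) * c / n}"
proof
  assume "y \<in> {0<..<c} \<and> cell c n y = j"
  then have y: "0 < y" "y < c" "nat \<lfloor>real n * y / c\<rfloor> = j" by (auto simp: cell_def)
  then have "0 \<le> \<lfloor>real n * y / c\<rfloor>" using assms by auto
  then have "\<lfloor>real n * y / c\<rfloor> = int j" using y by linarith
  then have "real j \<le> real n * y / c" "real n * y / c < real j + 1" by (auto simp: floor_eq_iff)
  then show "y \<in> {real j * c / n..<(real j + 1) * c / n}" using assms by (auto simp: field_simps)
next
  assume y: "y \<in> {real j * c / n..<(real j + 1) * c / n}"
  have "0 \<le> real j * c / n" using assms by simp
  then have "0 < y" using y assms(4) by auto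
  have "(real j + 1) * c / n \<le> real n * c / n"
    using assms by (intro divide_right_mono mult_right_mono) auto
  then have "y < c" using y assms by auto
  have "\<lfloor>real n * y / c\<rfloor> = int j" using y assms by (intro floor_unique) (auto simp: field_simps)
  then show "y \<in> {0<..<c} \<and> cell c n y = j" using \<open>0 < y\<close> \<open>y < c\<close> by (simp add: cell_def)
qed

lemma cell_less:
  assumes "0 < c" "0 < n" "y \<in> {0<..<c}"
  shows "cell c n y < n"
proof -
  have "real n * y / c < real n" using assms by (auto simp: field_simps)
  then have "\<lfloor>real n * y / c\<rfloor> < int n" by (simp add: floor_less_iff)
  then show ?thesis using assms by (simp add: cell_def nat_less_iff)
qed

lemma integral_cell:
  assumes "0 < c" "0 < n" "j < n"
  shows "(\<integral>y. (if cell c n y = j then 1 else 0 :: real) \<partial>restrict_space lborel {0<..<c}) = c / n"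
proof -
  have "(\<integral>y. (if cell c n y = j then 1 else 0 :: real) \<partial>restrict_space lborel {0<..<c}) =
    (\<integral>y. indicator {0<..<c} y *\<^sub>R (if cell c n y = j then 1 else 0 :: real) \<partial>lborel)"
    by (rule integral_restrict_space) simp
  also have "\<dots> = (\<integral>y. indicator {real j * c / n..<(real j + 1) * c / n} y \<partial>lborel)"
  proof (rule integral_cong_AE)
    show "AE y in lborel. indicator {0<..<c} y *\<^sub>R (if cell c n y = j then 1 else 0 :: real) =
      indicator {real j * c / n..<(real j + 1) * c / n} y"
      using AE_lborel_singleton[of 0]
    proof eventually_elim
      case (elim y)
      then show ?case using cell_eq_iff[OF assms, of y] by (auto simp: indicator_def)
    qed
  qed auto
  also have "\<dots> = c / n" using assms by (simp add: field_simps)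
  finally show ?thesis .
qed

lemma tendsto_cell:
  assumes "0 < c" "0 < y"
  shows "(\<lambda>n. c * real (cell c n y) / n) \<longlonglongrightarrow> y"
proof (rule tendsto_sandwich[of "\<lambda>n. y - c / real n" _ _ "\<lambda>_. y"])
  have fl: "real_of_int \<lfloor>real n * y / c\<rfloor> = real (cell c n y)" for n
    using assms by (simp add: cell_def)
  have *: "real (cell c n y) \<le> real n * y / c" "real n * y / c < real (cell c n y) + 1"
    for n using fl[of n] by linarith+
  show "\<forall>\<^sub>F n in sequentially. y - c / n \<le> c * real (cell c n y) / n"
    using eventually_gt_at_top[of 0]
  proof eventually_elim
    case (elim n)
    have "real n * y < c * real (cell c n y) + c" using *(2)[of n] assms by (simp add: field_simps)
    moreover have "(y - c / real n) * real n = real n * y - c" using elim by (simp add: left_diff_distrib)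
    ultimately have "(y - c / real n) * real n \<le> c * real (cell c n y)" by linarith
    then show ?case using elim by (simp add: pos_le_divide_eq)
  qed
  show "\<forall>\<^sub>F n in sequentially. c * real (cell c n y) / n \<le> y"
    using eventually_gt_at_top[of 0]
  proof eventually_elim
    case (elim n)
    then show ?case using *(1)[of n] assms by (simp add: field_simps)
  qed
  show "(\<lambda>n. y - c / real n) \<longlonglongrightarrow> y" by real_asymp
qed simp

context
  fixes c :: real
  assumes c: "0 < c"
begin

abbreviation (input) "Ic \<equiv> restrict_space lborel {0<..<c}"

lemma finite_measure_Ic: "finite_measure Ic"
  using less_imp_le[OF c] by (intro finite_measureI) (simp add: emeasure_restrict_space space_restrict_space)

lemma product_sigma_finite_Ic: "product_sigma_finite (\<lambda>_ :: nat. Ic)"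
  by (intro product_sigma_finite.intro finite_measure.axioms(1)[OF finite_measure_Ic])

lemma emeasure_PiM_Ic: "emeasure (Pi\<^sub>M {..<k :: nat} (\<lambda>_. Ic)) (space (Pi\<^sub>M {..<k} (\<lambda>_. Ic))) = ennreal (c ^ k)"
proof -
  interpret product_sigma_finite "\<lambda>_ :: nat. Ic" by (rule product_sigma_finite_Ic)
  have "emeasure (Pi\<^sub>M {..<k :: nat} (\<lambda>_. Ic)) (space (Pi\<^sub>M {..<k} (\<lambda>_. Ic))) = (\<Prod>a<k. emeasure Ic (space Ic))"
    unfolding space_PiM by (rule emeasure_PiM) (simp, rule sets.top)
  also have "emeasure Ic (space Ic) = ennreal c"
    using less_imp_le[OF c] by (simp add: emeasure_restrict_space space_restrict_space)
  finally show ?thesis using c by (simp add: ennreal_power)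
qed

lemma finite_measure_PiM_Ic: "finite_measure (Pi\<^sub>M {..<k :: nat} (\<lambda>_. Ic))"
  by (intro finite_measureI) (simp add: emeasure_PiM_Ic)

lemma measure_PiM_Ic: "measure (Pi\<^sub>M {..<k :: nat} (\<lambda>_. Ic)) (space (Pi\<^sub>M {..<k} (\<lambda>_. Ic))) = c ^ k"
  using c by (simp add: measure_def emeasure_PiM_Ic)

text \<open>A function of the cell indices is a finite combination of products of cell indicators,
  and the product measure gives each cell of the cube the mass (c/n)^k. The hypothesis on G lets the
  map of indices be replaced by its restriction to the first k, which is extensional.\<close>

lemma Riemann_sum_eq_integral:
  fixes G :: "(nat \<Rightarrow> nat) \<Rightarrow> real"
  assumes n: "0 < n" and G: "\<And>f g. (\<And>a. a < k \<Longrightarrow> f a = g a) \<Longrightarrow> G f = G g"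
  shows "(\<integral>x. G (\<lambda>a. cell c n (x a)) \<partial>Pi\<^sub>M {..<k} (\<lambda>_. Ic)) = (\<Sum>f\<in>{..<k} \<rightarrow>\<^sub>E {..<n}. G f * (c / n) ^ k)"
proof -
  interpret product_sigma_finite "\<lambda>_ :: nat. Ic" by (rule product_sigma_finite_Ic)
  interpret I: finite_measure Ic by (rule finite_measure_Ic)
  interpret P: finite_measure "Pi\<^sub>M {..<k} (\<lambda>_. Ic)" by (rule finite_measure_PiM_Ic)
  have cm [measurable]: "cell c n \<in> measurable Ic (count_space UNIV)"
    by (intro measurable_restrict_space1) simp
  have fin: "finite ({..<k} \<rightarrow>\<^sub>E {..<n})" by (simp add: finite_PiE)
  have eq: "G (\<lambda>a. cell c n (x a)) = (\<Sum>f\<in>{..<k} \<rightarrow>\<^sub>E {..<n}. G f * (\<Prod>a<k. if cell c n (x a) = f a then 1 else 0))"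
    if x: "x \<in> space (Pi\<^sub>M {..<k} (\<lambda>_. Ic))" for x
  proof -
    define h where "h = restrict (\<lambda>a. cell c n (x a)) {..<k}"
    have xa: "x a \<in> {0<..<c}" if "a < k" for a
      using x that by (auto simp: space_PiM space_restrict_space PiE_def Pi_def)
    have h: "h \<in> {..<k} \<rightarrow>\<^sub>E {..<n}" using cell_less[OF c n xa] by (auto simp: h_def)
    have "G f * (\<Prod>a<k. if cell c n (x a) = f a then 1 else 0) = (if f = h then G f else 0)"
      if f: "f \<in> {..<k} \<rightarrow>\<^sub>E {..<n}" for f
    proof (cases "f = h")
      case True
      then have "(\<Prod>a<k. if cell c n (x a) = f a then 1 else 0 :: real) = 1"
        by (intro prod.neutral) (auto simp: h_def)
      then show ?thesis using True by simp
    next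
      case False
      then obtain a where "a < k" "f a \<noteq> h a" using PiE_ext[OF f h] by auto
      then have "(\<Prod>a<k. if cell c n (x a) = f a then 1 else 0 :: real) = 0"
        by (intro prod_zero bexI[of _ a]) (auto simp: h_def)
      then show ?thesis using False by simp
    qed
    then have "(\<Sum>f\<in>{..<k} \<rightarrow>\<^sub>E {..<n}. G f * (\<Prod>a<k. if cell c n (x a) = f a then 1 else 0)) = G h"
      using fin h by (simp cong: sum.cong)
    also have "G h = G (\<lambda>a. cell c n (x a))" by (intro G) (auto simp: h_def)
    finally show ?thesis ..
  qed
  have int: "integrable (Pi\<^sub>M {..<k} (\<lambda>_. Ic)) (\<lambda>x. G f * (\<Prod>a<k. if cell c n (x a) = f a then 1 else 0))" for f
    by (intro integrable_mult_right product_integrable_prod I.integrable_const_bound[of _ 1]) auto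
  have "(\<integral>x. G (\<lambda>a. cell c n (x a)) \<partial>Pi\<^sub>M {..<k} (\<lambda>_. Ic)) =
    (\<integral>x. (\<Sum>f\<in>{..<k} \<rightarrow>\<^sub>E {..<n}. G f * (\<Prod>a<k. if cell c n (x a) = f a then 1 else 0)) \<partial>Pi\<^sub>M {..<k} (\<lambda>_. Ic))"
    by (rule Bochner_Integration.integral_cong[OF refl eq])
  also have "\<dots> = (\<Sum>f\<in>{..<k} \<rightarrow>\<^sub>E {..<n}. G f * (\<integral>x. (\<Prod>a<k. if cell c n (x a) = f a then 1 else 0) \<partial>Pi\<^sub>M {..<k} (\<lambda>_. Ic)))"
    using int by (subst Bochner_Integration.integral_sum) auto
  also have "\<dots> = (\<Sum>f\<in>{..<k} \<rightarrow>\<^sub>E {..<n}. G f * (c / n) ^ k)"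
  proof (intro sum.cong refl)
    fix f assume f: "f \<in> {..<k} \<rightarrow>\<^sub>E {..<n}"
    have "(\<integral>x. (\<Prod>a<k. if cell c n (x a) = f a then 1 else 0 :: real) \<partial>Pi\<^sub>M {..<k} (\<lambda>_. Ic)) =
        (\<Prod>a<k. \<integral>y. (if cell c n y = f a then 1 else 0 :: real) \<partial>Ic)"
      by (intro product_integral_prod I.integrable_const_bound[of _ 1]) auto
    also have "\<dots> = (\<Prod>a<k. c / n)" using f by (intro prod.cong refl integral_cell c n) auto
    finally show "G f * (\<integral>x. (\<Prod>a<k. if cell c n (x a) = f a then 1 else 0) \<partial>Pi\<^sub>M {..<k} (\<lambda>_. Ic)) = G f * (c / n) ^ k"
      by simp
  qed
  finally show ?thesis .
qed

end

text \<open>After expansion, the k-th term is the integral of the k-point minor evaluated at the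
  left endpoints of the cells. For fixed k, continuity of the kernel gives pointwise convergence and
  \<open>det_sine_kernel_le_1\<close> domination; the terms are bounded by |z c|^k / k!, so
  Tannery's theorem sums the limits.\<close>

theorem toeplitz_det_tendsto_sine_det:
  assumes c: "0 < c"
  shows "(\<lambda>n. Determinant.det (Matrix.mat n n (\<lambda>(i, j). (if i = j then 1 else 0) +
      z * (c / n * sine_kernel (c * real i / n) (c * real j / n))))) \<longlonglongrightarrow> sine_det c z"
proof -
  let ?P = "\<lambda>k. Pi\<^sub>M {..<k :: nat} (\<lambda>_. restrict_space lborel {0<..<c})"
  define D where "D k x = Determinant.det (Matrix.mat k k (\<lambda>(i, j). sine_kernel (x i) (x j)))" for k and x :: "nat \<Rightarrow> real"
  define a where "a k n = z ^ k / fact k * (\<integral>x. D k (\<lambda>i. c * real (cell c n (x i)) / n) \<partial>?P k)" for k n :: nat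
  define b where "b k = z ^ k / fact k * (\<integral>x. D k x \<partial>?P k)" for k
  have D1: "\<bar>D k x\<bar> \<le> 1" for k x unfolding D_def by (rule det_sine_kernel_le_1)
  have comp [measurable]: "(\<lambda>x. x i) \<in> borel_measurable (?P k)" if "i < k" for i k
    using measurable_component_singleton[of i "{..<k}" "\<lambda>_. restrict_space lborel {0<..<c}"] that
    by (auto simp: measurable_restrict_space2_iff)
  have cm: "(\<lambda>x. c * real (cell c n (x i)) / real n) \<in> borel_measurable (?P k)" if "i < k" for i k n
  proof -
    have "(\<lambda>x. cell c n (x i)) \<in> measurable (?P k) (count_space UNIV)"
      by (rule measurable_compose[OF comp[OF that] cell_measurable])
    then show ?thesis by (rule measurable_compose) simp
  qed
  have Dm: "(\<lambda>x. D k x) \<in> borel_measurable (?P k)" for k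
    unfolding D_def by (intro det_mat_measurable sine_kernel_measurable comp)
  have Dm': "(\<lambda>x. D k (\<lambda>i. c * real (cell c n (x i)) / n)) \<in> borel_measurable (?P k)" for k n
    unfolding D_def by (intro det_mat_measurable sine_kernel_measurable cm)
  have lim: "(\<lambda>n. a k n) \<longlonglongrightarrow> b k" for k
    unfolding a_def b_def
  proof (intro tendsto_mult tendsto_const)
    interpret finite_measure "?P k" using c by (rule finite_measure_PiM_Ic)
    show "(\<lambda>n. \<integral>x. D k (\<lambda>i. c * real (cell c n (x i)) / n) \<partial>?P k) \<longlonglongrightarrow> (\<integral>x. D k x \<partial>?P k)"
    proof (rule integral_dominated_convergence[where w = "\<lambda>_. 1"])
      show "AE x in ?P k. (\<lambda>n. D k (\<lambda>i. c * real (cell c n (x i)) / n)) \<longlonglongrightarrow> D k x"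
      proof (rule AE_I2)
        fix x assume x: "x \<in> space (?P k)"
        have "0 < x i" if "i < k" for i
          using x that by (auto simp: space_PiM space_restrict_space PiE_def Pi_def)
        then have sk: "(\<lambda>n. sine_kernel (c * real (cell c n (x i)) / n) (c * real (cell c n (x j)) / n)) \<longlonglongrightarrow> sine_kernel (x i) (x j)"
          if "i < k" "j < k" for i j
          using that c by (intro tendsto_sine_kernel tendsto_cell)
        have "p i < k" if "p permutes {..<k}" "i < k" for p i
          using permutes_in_image[OF that(1), of i] that(2) by simp
        then show "(\<lambda>n. D k (\<lambda>i. c * real (cell c n (x i)) / n)) \<longlonglongrightarrow> D k x"
          unfolding D_def det_mat_eq_sum_permutes
          by (intro tendsto_sum tendsto_mult tendsto_const tendsto_prod) (auto intro!: sk)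
      qed
    qed (use D1 Dm Dm' in auto)
  qed
  have bound: "norm (a k n) \<le> \<bar>z * c\<bar> ^ k / fact k" for k n
  proof -
    interpret finite_measure "?P k" using c by (rule finite_measure_PiM_Ic)
    have "\<bar>\<integral>x. D k (\<lambda>i. c * real (cell c n (x i)) / n) \<partial>?P k\<bar> \<le> (\<integral>x. \<bar>D k (\<lambda>i. c * real (cell c n (x i)) / n)\<bar> \<partial>?P k)"
      by (rule integral_abs_bound)
    also have "\<dots> \<le> (\<integral>x. 1 \<partial>?P k)"
      using D1 Dm' by (intro integral_mono integrable_abs integrable_const_bound[of _ 1]) auto
    also have "\<dots> = c ^ k" using c by (simp add: measure_PiM_Ic)
    finally have "\<bar>\<integral>x. D k (\<lambda>i. c * real (cell c n (x i)) / n) \<partial>?P k\<bar> \<le> c ^ k" .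
    from mult_left_mono[OF this, of "\<bar>z\<bar> ^ k / fact k"] show ?thesis using c
      by (simp add: a_def abs_mult power_abs power_mult_distrib)
  qed
  have "(\<lambda>n. \<Sum>k. a k n) \<longlonglongrightarrow> (\<Sum>k. b k)"
  proof -
    have "summable (\<lambda>k. \<bar>z * c\<bar> ^ k / fact k)"
      using summable_exp[of "\<bar>z * c\<bar>"] by (simp add: divide_inverse mult.commute)
    from tannerys_theorem[OF lim always_eventually this] show ?thesis using bound by auto
  qed
  moreover have "(\<Sum>k. b k) = sine_det c z"
  proof -
    have "Determinant.det (Matrix.mat k k (\<lambda>(i, j). z * sine_kernel (x i) (x j))) = z ^ k * D k x" for k x
      unfolding D_def by (rule det_mat_scale)
    then show ?thesis unfolding b_def sine_det_def fredholm_det_def by (simp add: field_simps)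
  qed
  moreover have "\<forall>\<^sub>F n in sequentially. (\<Sum>k. a k n) = Determinant.det (Matrix.mat n n (\<lambda>(i, j). (if i = j then 1 else 0) +
      z * (c / n * sine_kernel (c * real i / n) (c * real j / n))))"
    using eventually_gt_at_top[of 0]
  proof eventually_elim
    case (elim n)
    define A where "A i j = c / n * sine_kernel (c * real i / n) (c * real j / n)" for i j
    have sc: "Determinant.det (Matrix.mat k k (\<lambda>(i, j). A (f i) (f j))) = (c / n) ^ k * D k (\<lambda>i. c * real (f i) / n)" for f :: "nat \<Rightarrow> nat" and k
      unfolding A_def D_def by (rule det_mat_scale)
    have a: "a k n = z ^ k / fact k * (\<Sum>f\<in>{..<k} \<rightarrow>\<^sub>E {..<n}. Determinant.det (Matrix.mat k k (\<lambda>(i, j). A (f i) (f j))))" for k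
    proof -
      have "(\<integral>x. D k (\<lambda>i. c * real (cell c n (x i)) / n) \<partial>?P k) = (\<Sum>f\<in>{..<k} \<rightarrow>\<^sub>E {..<n}. D k (\<lambda>i. c * real (f i) / n) * (c / n) ^ k)"
      proof (rule Riemann_sum_eq_integral[OF c elim, of k "\<lambda>f. D k (\<lambda>i. c * real (f i) / n)"])
        fix f g :: "nat \<Rightarrow> nat" assume "\<And>a. a < k \<Longrightarrow> f a = g a"
        then have "Matrix.mat k k (\<lambda>(i, j). sine_kernel (c * real (f i) / n) (c * real (f j) / n)) =
          Matrix.mat k k (\<lambda>(i, j). sine_kernel (c * real (g i) / n) (c * real (g j) / n))"
          by (intro eq_matI) auto
        then show "D k (\<lambda>i. c * real (f i) / n) = D k (\<lambda>i. c * real (g i) / n)" by (simp add: D_def)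
      qed
      also have "\<dots> = (\<Sum>f\<in>{..<k} \<rightarrow>\<^sub>E {..<n}. Determinant.det (Matrix.mat k k (\<lambda>(i, j). A (f i) (f j))))"
        unfolding sc by (simp add: mult.commute)
      finally show ?thesis by (simp add: a_def)
    qed
    have "(\<Sum>k. a k n) = (\<Sum>k\<le>n. a k n)"
    proof (rule suminf_finite)
      fix k assume "k \<notin> {..n}"
      then show "a k n = 0" by (simp add: a sum_det_reindex_eq_0)
    qed simp
    also have "\<dots> = Determinant.det (Matrix.mat n n (\<lambda>(i, j). (if i = j then 1 else 0) + z * A i j))"
      unfolding det_one_plus_expansion a ..
    finally show ?case by (simp add: A_def)
  qed
  ultimately show ?thesis by (auto elim: Lim_transform_eventually)
qed

section \<open>Takenaka--Malmquist functions\<close>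

definition circ :: "real \<Rightarrow> complex" where
  "circ t = cis (2 * pi * t)"

lemma norm_circ [simp]: "cmod (circ t) = 1"
  by (simp add: circ_def)

lemma circ_nonzero [simp]: "circ t \<noteq> 0"
  by (metis norm_circ norm_zero zero_neq_one)

lemma continuous_on_circ [continuous_intros]: "continuous_on S f \<Longrightarrow> continuous_on S (\<lambda>t. circ (f t))"
  unfolding circ_def by (intro continuous_intros)

lemma continuous_on_compose_circ:
  assumes "continuous_on (cball 0 1) h"
  shows "continuous_on S (\<lambda>t. h (circ t))"
  by (rule continuous_on_compose2[OF assms]) (auto intro!: continuous_intros)

lemma circle_mean_Cauchy:
  assumes cont: "continuous_on (cball 0 1) h" and holo: "h holomorphic_on ball 0 1" and a: "cmod a < 1"
  shows "(\<integral>t. h (circ t) * circ t / (circ t - a) \<partial>arc (1 / 2)) = h a"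
proof -
  \<comment> \<open>\<open>circlepath\<close> is parametrised by [0, 1], the arc by [-1/2, 1/2]. The
    shift by 1/2 negates the point on the circle, hence Cauchy's formula is applied to
    \<open>h \<circ> uminus\<close> at -a.\<close>
  have "((\<lambda>u. (h \<circ> uminus) u / (u - (- a))) has_contour_integral (2 * of_real pi * \<i> * (h \<circ> uminus) (- a))) (circlepath 0 1)"
  proof (rule Cauchy_integral_circlepath)
    show "continuous_on (cball 0 1) (h \<circ> uminus)"
      by (intro continuous_on_compose continuous_intros continuous_on_subset[OF cont]) auto
    show "(h \<circ> uminus) holomorphic_on ball 0 1"
      by (intro holomorphic_on_compose holomorphic_intros holomorphic_on_subset[OF holo]) auto
  qed (use a in simp)
  then have H: "((\<lambda>x. (h \<circ> uminus) (circlepath 0 1 x) / (circlepath 0 1 x - - a) *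
      vector_derivative (circlepath 0 1) (at x within {0..1})) has_integral
      2 * of_real pi * \<i> * (h \<circ> uminus) (- a)) {0..1}"
    unfolding has_contour_integral_def .
  have "((\<lambda>x. h (- exp (2 * of_real pi * \<i> * of_real x)) / (exp (2 * of_real pi * \<i> * of_real x) + a) *
      (2 * pi * \<i> * exp (2 * of_real pi * \<i> * of_real x))) has_integral 2 * of_real pi * \<i> * (h \<circ> uminus) (- a)) {0..1}"
    by (rule has_integral_eq[OF _ H], simp add: vector_derivative_circlepath01) (simp add: circlepath)
  from has_integral_mult_right[OF this, of "1 / (2 * of_real pi * \<i>)"]
  have *: "((\<lambda>x. h (- circ x) * circ x / (circ x + a)) has_integral h a) {0..1}"
    by (simp add: circ_def cis_conv_exp mult_ac)
  have "((\<lambda>x. h (- circ x) * circ x / (circ x + a)) \<circ> ((+) (1 / 2)) has_integral h a) {-1/2..1/2}"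
    unfolding has_integral_shift_Icc_real using * by simp
  also have "(\<lambda>x. h (- circ x) * circ x / (circ x + a)) \<circ> ((+) (1 / 2)) = (\<lambda>t. h (circ t) * circ t / (circ t - a))"
  proof
    fix t :: real
    have "circ (1 / 2 + t) = - circ t" by (simp add: circ_def distrib_left cis_mult[symmetric])
    then have "((\<lambda>x. h (- circ x) * circ x / (circ x + a)) \<circ> ((+) (1 / 2))) t = h (circ t) * (- circ t) / (- (circ t - a))"
      by simp
    also have "\<dots> = h (circ t) * circ t / (circ t - a)" by (simp only: mult_minus_right minus_divide_divide)
    finally show "((\<lambda>x. h (- circ x) * circ x / (circ x + a)) \<circ> ((+) (1 / 2))) t = h (circ t) * circ t / (circ t - a)" .
  qed
  finally have "((\<lambda>t. h (circ t) * circ t / (circ t - a)) has_integral h a) {-1/2..1/2}" .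
  moreover have "circ t - a \<noteq> 0" for t using a norm_circ[of t] by auto
  ultimately show ?thesis
    by (subst integral_arc) (auto intro!: continuous_intros continuous_on_compose_circ[OF cont] integral_unique)
qed

corollary circle_mean_value:
  assumes "continuous_on (cball 0 1) h" "h holomorphic_on ball 0 1"
  shows "(\<integral>t. h (circ t) \<partial>arc (1 / 2)) = h 0"
  using circle_mean_Cauchy[OF assms, of 0] by simp

lemma cnj_circ: "cmod z = 1 \<Longrightarrow> cnj z = 1 / z"
  by (metis complex_div_cnj div_by_1 mult_1 of_real_1 power_one)

lemma one_minus_cnj_mult_nonzero:
  assumes "cmod a < 1" "cmod z \<le> 1"
  shows "1 - cnj a * z \<noteq> 0" "cnj a * z \<noteq> 1"
proof -
  have "cmod (cnj a * z) \<le> cmod a * 1"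
    unfolding norm_mult complex_mod_cnj using assms by (intro mult_left_mono) auto
  then have "cmod (cnj a * z) < 1" using assms by simp
  then show "cnj a * z \<noteq> 1" by (metis less_irrefl norm_one)
  then show "1 - cnj a * z \<noteq> 0" by auto
qed

text \<open>For distinct points these arise by Gram-Schmidt from the kernels 1 / (1 - conj(a_l) z);
  the product form also covers repeated points.\<close>

definition tm_fun :: "(nat \<Rightarrow> complex) \<Rightarrow> nat \<Rightarrow> complex \<Rightarrow> complex" where
  "tm_fun a j z = of_real (sqrt (1 - (cmod (a j))\<^sup>2)) * (\<Prod>l<j. z - a l) / (\<Prod>l\<le>j. 1 - cnj (a l) * z)"

text \<open>For j < n, the numerator of \<open>tm_fun a j\<close> over the common denominator formed
  by all n factors.\<close>

definition tm_poly :: "(nat \<Rightarrow> complex) \<Rightarrow> nat \<Rightarrow> nat \<Rightarrow> complex poly" where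
  "tm_poly a n j = Polynomial.smult (of_real (sqrt (1 - (cmod (a j))\<^sup>2))) ((\<Prod>l<j. [:- a l, 1:]) * (\<Prod>l\<in>{j<..<n}. [:1, - cnj (a l):]))"

text \<open>On the unit circle |1 - conj(a) z| = |z - a|, so there this is the Poisson kernel of the
  disc at a.\<close>

definition poisson :: "complex \<Rightarrow> complex \<Rightarrow> real" where
  "poisson a z = (1 - (cmod a)\<^sup>2) / (cmod (1 - cnj a * z))\<^sup>2"

lemma poly_tm_poly:
  assumes a: "\<And>i. i < n \<Longrightarrow> cmod (a i) < 1" and j: "j < n" and z: "cmod z \<le> 1"
  shows "poly (tm_poly a n j) z = tm_fun a j z * (\<Prod>l<n. 1 - cnj (a l) * z)"
proof -
  have "{..<n} = {..j} \<union> {j<..<n}" using j by auto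
  then have "(\<Prod>l<n. 1 - cnj (a l) * z) = (\<Prod>l\<le>j. 1 - cnj (a l) * z) * (\<Prod>l\<in>{j<..<n}. 1 - cnj (a l) * z)"
    by (simp add: prod.union_disjoint[symmetric] Int_def)
  moreover have "(\<Prod>l\<le>j. 1 - cnj (a l) * z) \<noteq> 0"
    using a j z by (auto simp: one_minus_cnj_mult_nonzero)
  ultimately show ?thesis
    by (simp add: tm_poly_def tm_fun_def poly_prod) (simp add: mult.commute)
qed

lemma norm_blaschke_factors:
  assumes "cmod z = 1"
  shows "cmod (z - a) = cmod (1 - cnj a * z)"
proof -
  have "z \<noteq> 0" using assms by auto
  then have "cnj (1 - cnj a * z) = (z - a) / z"
    by (simp add: cnj_circ[OF assms] field_simps)
  then show ?thesis using assms by (metis complex_mod_cnj div_by_1 norm_divide)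
qed

text \<open>On the circle every Blaschke factor (z - a_l) / (1 - conj(a_l) z) has modulus 1, which
  leaves only the denominator of index j.\<close>

lemma norm_tm_fun_square:
  assumes a: "\<And>i. i \<le> j \<Longrightarrow> cmod (a i) < 1" and z: "cmod z = 1"
  shows "(cmod (tm_fun a j z))\<^sup>2 = poisson (a j) z"
proof -
  have s: "(sqrt (1 - (cmod (a j))\<^sup>2))\<^sup>2 = 1 - (cmod (a j))\<^sup>2"
    using a[of j] by (simp add: abs_square_le_1)
  define X where "X = (\<Prod>l<j. cmod (1 - cnj (a l) * z))"
  have "cmod (\<Prod>l<j. z - a l) = X"
    unfolding X_def prod_norm[symmetric] by (simp add: norm_blaschke_factors[OF z])
  moreover have "cmod (\<Prod>l\<le>j. 1 - cnj (a l) * z) = X * cmod (1 - cnj (a j) * z)"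
    unfolding X_def prod_norm[symmetric] by (simp add: lessThan_Suc_atMost[symmetric])
  moreover have "X \<noteq> 0" unfolding X_def using a z by (auto simp: one_minus_cnj_mult_nonzero)
  ultimately show ?thesis
    by (simp add: tm_fun_def norm_mult norm_divide poisson_def power_mult_distrib power_divide s)
qed

text \<open>Replacing conj(z) by 1/z makes the kernel rational with the Cauchy factor z / (z - a),
  so that \<open>circle_mean_Cauchy\<close> can evaluate its integrals.\<close>

lemma poisson_eq:
  assumes "cmod a < 1" "cmod z = 1"
  shows "of_real (poisson a z) = (1 - (cmod a)\<^sup>2) / (1 - cnj a * z) * z / (z - a)"
proof -
  have z: "z \<noteq> 0" using assms by auto
  have nz: "1 - cnj a * z \<noteq> 0" using assms by (intro one_minus_cnj_mult_nonzero) auto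
  have za: "z - a \<noteq> 0" using assms by auto
  have "cnj (1 - cnj a * z) = (z - a) / z" using z by (simp add: cnj_circ[OF assms(2)] field_simps)
  then have "of_real ((cmod (1 - cnj a * z))\<^sup>2) = (1 - cnj a * z) * ((z - a) / z)"
    by (metis complex_norm_square)
  then show ?thesis using z nz za by (simp add: poisson_def del: of_real_power)
qed

lemma continuous_on_tm_fun:
  assumes "\<And>i. i \<le> j \<Longrightarrow> cmod (a i) < 1"
  shows "continuous_on (cball 0 1) (tm_fun a j)"
  unfolding tm_fun_def using assms by (intro continuous_intros) (auto simp: one_minus_cnj_mult_nonzero)

text \<open>On the circle conj(z) = 1/z turns the conjugated denominator into a multiple of the
  product of z - a_l over l \<le> j, which cancels against the numerator of
  \<open>tm_fun a i\<close>. What remains is holomorphic with a factor z, so its mean is 0.\<close>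

lemma tm_fun_orthonormal_less:
  assumes a: "\<And>l. l \<le> i \<Longrightarrow> cmod (a l) < 1" and ji: "j < i"
  shows "(\<integral>t. tm_fun a i (circ t) * cnj (tm_fun a j (circ t)) \<partial>arc (1 / 2)) = 0"
proof -
  define s where "s l = complex_of_real (sqrt (1 - (cmod (a l))\<^sup>2))" for l
  define h where "h z = s i * s j * z * (\<Prod>l\<in>{j<..<i}. z - a l) / (\<Prod>l\<in>{j..i}. 1 - cnj (a l) * z)" for z
  have nz: "cnj (a l) * z \<noteq> 1" if "l \<le> i" "cmod z \<le> 1" for l z
    using a[OF that(1)] that(2) by (rule one_minus_cnj_mult_nonzero)
  have "tm_fun a i z * cnj (tm_fun a j z) = h z" if z: "cmod z = 1" for z
  proof -
    have z0: "z \<noteq> 0" using z by auto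
    have "{..<i} = {..j} \<union> {j<..<i}" "{..i} = {..<j} \<union> {j..i}" using ji by auto
    then have sp: "(\<Prod>l<i. z - a l) = (\<Prod>l\<le>j. z - a l) * (\<Prod>l\<in>{j<..<i}. z - a l)"
      "(\<Prod>l\<le>i. 1 - cnj (a l) * z) = (\<Prod>l<j. 1 - cnj (a l) * z) * (\<Prod>l\<in>{j..i}. 1 - cnj (a l) * z)"
      by (simp_all add: prod.union_disjoint[symmetric] Int_def)
    have c1: "cnj (\<Prod>l<j. z - a l) = (\<Prod>l<j. 1 - cnj (a l) * z) / z ^ j"
    proof -
      have "cnj (\<Prod>l<j. z - a l) = (\<Prod>l<j. (1 - cnj (a l) * z) / z)"
        unfolding cnj_prod using z0 by (intro prod.cong refl) (simp add: cnj_circ[OF z] field_simps)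
      then show ?thesis by (simp add: prod_dividef)
    qed
    have c2: "cnj (\<Prod>l\<le>j. 1 - cnj (a l) * z) = (\<Prod>l\<le>j. z - a l) / (z ^ j * z)"
    proof -
      have "cnj (\<Prod>l\<le>j. 1 - cnj (a l) * z) = (\<Prod>l\<le>j. (z - a l) / z)"
        unfolding cnj_prod using z0 by (intro prod.cong refl) (simp add: cnj_circ[OF z] field_simps)
      then show ?thesis by (simp add: prod_dividef mult.commute)
    qed
    have n1: "(\<Prod>l<j. 1 - cnj (a l) * z) \<noteq> 0" using nz ji z by auto
    have za: "z \<noteq> a l" if "l \<le> i" for l using a[OF that] z by auto
    have n2: "(\<Prod>l\<le>j. z - a l) \<noteq> 0" using za ji by auto
    have n3: "(\<Prod>l\<in>{j..i}. 1 - cnj (a l) * z) \<noteq> 0" using nz ji z by auto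
    have "tm_fun a i z * cnj (tm_fun a j z) =
      s i * ((\<Prod>l\<le>j. z - a l) * (\<Prod>l\<in>{j<..<i}. z - a l)) / ((\<Prod>l<j. 1 - cnj (a l) * z) * (\<Prod>l\<in>{j..i}. 1 - cnj (a l) * z)) *
      (s j * ((\<Prod>l<j. 1 - cnj (a l) * z) / z ^ j) / ((\<Prod>l\<le>j. z - a l) / (z ^ j * z)))"
      by (simp only: tm_fun_def sp complex_cnj_mult complex_cnj_divide c1 c2 s_def complex_cnj_complex_of_real)
    also have "\<dots> = h z" unfolding h_def using n1 n2 n3 z0 by (simp add: field_simps)
    finally show ?thesis .
  qed
  then have "(\<integral>t. tm_fun a i (circ t) * cnj (tm_fun a j (circ t)) \<partial>arc (1 / 2)) = (\<integral>t. h (circ t) \<partial>arc (1 / 2))"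
    by simp
  also have "\<dots> = h 0"
  proof (rule circle_mean_value)
    show "continuous_on (cball 0 1) h" unfolding h_def by (intro continuous_intros) (auto simp: nz)
    show "h holomorphic_on ball 0 1" unfolding h_def by (intro holomorphic_intros) (auto simp: nz)
  qed
  finally show ?thesis by (simp add: h_def)
qed

text \<open>By \<open>poisson_eq\<close> this is Cauchy's formula for (1 - |a|^2) h(z) / (1 -
  conj(a) z), where the factor in front of h equals 1 at z = a.\<close>

lemma integral_poisson:
  assumes a: "cmod a < 1" and h: "continuous_on (cball 0 1) h" "h holomorphic_on ball 0 1"
  shows "(\<integral>t. of_real (poisson a (circ t)) * h (circ t) \<partial>arc (1 / 2)) = h a"
proof -
  define g where "g z = (1 - (cmod a)\<^sup>2) / (1 - cnj a * z) * h z" for z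
  have "(\<integral>t. of_real (poisson a (circ t)) * h (circ t) \<partial>arc (1 / 2)) = (\<integral>t. g (circ t) * circ t / (circ t - a) \<partial>arc (1 / 2))"
    by (simp add: poisson_eq[OF a] g_def mult_ac)
  also have "\<dots> = g a"
  proof (rule circle_mean_Cauchy)
    show "continuous_on (cball 0 1) g" unfolding g_def using a
      by (intro continuous_intros h) (auto simp: one_minus_cnj_mult_nonzero)
    show "g holomorphic_on ball 0 1" unfolding g_def using a
      by (intro holomorphic_intros h) (auto simp: one_minus_cnj_mult_nonzero)
  qed (rule a)
  also have "g a = h a"
  proof -
    have "1 - cnj a * a \<noteq> 0" using a by (intro one_minus_cnj_mult_nonzero) auto
    moreover have "cnj a * a = complex_of_real ((cmod a)\<^sup>2)" by (metis complex_norm_square mult.commute)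
    ultimately show ?thesis by (simp add: g_def)
  qed
  finally show ?thesis .
qed

lemma tm_fun_orthonormal:
  assumes a: "\<And>l. l < n \<Longrightarrow> cmod (a l) < 1" and ij: "i < n" "j < n"
  shows "(\<integral>t. tm_fun a i (circ t) * cnj (tm_fun a j (circ t)) \<partial>arc (1 / 2)) = (if i = j then 1 else 0)"
proof -
  consider "i = j" | "j < i" | "i < j" by linarith
  then show ?thesis
  proof cases
    case 1
    have "tm_fun a i (circ t) * cnj (tm_fun a i (circ t)) = of_real (poisson (a i) (circ t)) * 1" for t
      using norm_tm_fun_square[of i a "circ t"] a ij by (simp add: complex_norm_square[symmetric] del: of_real_power)
    then show ?thesis using 1 integral_poisson[OF a[OF ij(1)], of "\<lambda>_. 1"] by simp
  next
    case 2
    then show ?thesis using tm_fun_orthonormal_less[of i a j] a ij by simp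
  next
    case 3
    have "(\<integral>t. tm_fun a i (circ t) * cnj (tm_fun a j (circ t)) \<partial>arc (1 / 2)) =
      cnj (\<integral>t. tm_fun a j (circ t) * cnj (tm_fun a i (circ t)) \<partial>arc (1 / 2))"
      by (subst Bochner_Integration.integral_cnj[symmetric]) (simp add: mult.commute)
    then show ?thesis using 3 tm_fun_orthonormal_less[of j a i] a ij by simp
  qed
qed

text \<open>The logarithm of the modulus is the real part of a holomorphic function: each factor has
  positive real part, so the principal logarithm serves factor by factor.\<close>

lemma integral_poisson_ln_norm:
  fixes a :: "nat \<Rightarrow> complex"
  assumes a: "\<And>l. l < n \<Longrightarrow> cmod (a l) < 1" and b: "cmod b < 1"
  shows "(\<integral>t. poisson b (circ t) * ln (cmod (\<Prod>l<n. 1 - cnj (a l) * circ t)) \<partial>arc (1 / 2)) =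
    ln (cmod (\<Prod>l<n. 1 - cnj (a l) * b))"
proof -
  define h where "h z = (\<Sum>l<n. Ln (1 - cnj (a l) * z))" for z
  have re: "0 < Re (1 - cnj (a l) * z)" if "l < n" "cmod z \<le> 1" for l z
  proof -
    have "Re (cnj (a l) * z) \<le> cmod (cnj (a l) * z)" by (rule complex_Re_le_cmod)
    also have "\<dots> \<le> cmod (a l) * 1" unfolding norm_mult using that by (intro mult_mono) auto
    also have "\<dots> < 1" using a that by simp
    finally show ?thesis by simp
  qed
  have np: "1 - cnj (a l) * z \<notin> \<real>\<^sub>\<le>\<^sub>0" if "l < n" "cmod z \<le> 1" for l z
    using re[OF that] complex_nonpos_Reals_iff by auto
  have nz: "1 - cnj (a l) * z \<noteq> 0" if "l < n" "cmod z \<le> 1" for l z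
    using a[OF that(1)] that(2) by (rule one_minus_cnj_mult_nonzero)
  have Reh: "Re (h z) = ln (cmod (\<Prod>l<n. 1 - cnj (a l) * z))" if "cmod z \<le> 1" for z
  proof -
    have "Re (h z) = (\<Sum>l<n. ln (cmod (1 - cnj (a l) * z)))"
      unfolding h_def Re_sum using nz that by (intro sum.cong refl Re_Ln) auto
    also have "\<dots> = ln (\<Prod>l<n. cmod (1 - cnj (a l) * z))"
      by (subst ln_prod) (use nz[OF _ that] in simp_all)
    finally show ?thesis by (simp add: prod_norm)
  qed
  have conth: "continuous_on (cball 0 1) h"
    unfolding h_def by (intro continuous_intros continuous_on_Ln) (auto simp: np)
  have hol: "h holomorphic_on ball 0 1"
    unfolding h_def by (intro holomorphic_intros) (auto simp: np)
  have "h b = (\<integral>t. of_real (poisson b (circ t)) * h (circ t) \<partial>arc (1 / 2))"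
    by (rule integral_poisson[OF b conth hol, symmetric])
  then have "Re (h b) = Re (\<integral>t. of_real (poisson b (circ t)) * h (circ t) \<partial>arc (1 / 2))" by simp
  also have "\<dots> = (\<integral>t. Re (of_real (poisson b (circ t)) * h (circ t)) \<partial>arc (1 / 2))"
  proof (rule integral_Re[symmetric], rule integrable_arc)
    have "cmod (1 - cnj b * circ t) \<noteq> 0" for t
      using one_minus_cnj_mult_nonzero[OF b, of "circ t"] by simp
    then show "continuous_on UNIV (\<lambda>t. of_real (poisson b (circ t)) * h (circ t))"
      unfolding poisson_def by (intro continuous_intros continuous_on_compose_circ[OF conth]) auto
  qed
  finally show ?thesis using b by (simp add: Reh)
qed

section \<open>A lower bound for Toeplitz determinants\<close>

text \<open>Convolving with the powers of b divides by 1 - b X; only coefficients up to l enter, so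
  no power series is needed.\<close>

lemma sum_coeff_mult_geometric:
  fixes p :: "complex poly"
  shows "(\<Sum>k\<le>l. Polynomial.coeff (p * [:1, - b:]) k * b ^ (l - k)) = Polynomial.coeff p l"
proof (induction l)
  case 0
  then show ?case by (simp add: mult.commute[of p])
next
  case (Suc l)
  have "(\<Sum>k\<le>Suc l. Polynomial.coeff (p * [:1, - b:]) k * b ^ (Suc l - k)) =
    b * (\<Sum>k\<le>l. Polynomial.coeff (p * [:1, - b:]) k * b ^ (l - k)) + Polynomial.coeff (p * [:1, - b:]) (Suc l)"
    by (simp add: sum_distrib_left Suc_diff_le mult_ac)
  then show ?case unfolding Suc.IH by (simp add: mult.commute[of p])
qed

text \<open>For nonzero b both sides are b^n times the value of the polynomial at 1/b; this form
  includes b = 0.\<close>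

lemma sum_coeff_prod_linear:
  fixes a :: "nat \<Rightarrow> complex"
  shows "(\<Sum>k\<le>n. Polynomial.coeff (\<Prod>l<n. [:- a l, 1:]) k * b ^ (n - k)) = (\<Prod>l<n. 1 - a l * b)"
proof (induction n)
  case 0
  then show ?case by simp
next
  case (Suc n)
  let ?R = "\<Prod>l<n. [:- a l, 1:]"
  have deg: "Polynomial.degree ?R \<le> n"
    using degree_prod_sum_le[of "{..<n}" "\<lambda>l. [:- a l, 1:]"] by simp
  have "(\<Sum>k\<le>Suc n. Polynomial.coeff (?R * [:- a n, 1:]) k * b ^ (Suc n - k)) =
    (\<Sum>k\<le>Suc n. (case k of 0 \<Rightarrow> 0 | Suc k' \<Rightarrow> Polynomial.coeff ?R k') * b ^ (Suc n - k)) -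
    a n * (\<Sum>k\<le>Suc n. Polynomial.coeff ?R k * b ^ (Suc n - k))"
    unfolding sum_distrib_left sum_subtractf[symmetric]
    by (intro sum.cong refl) (simp add: mult.commute[of ?R] coeff_pCons algebra_simps split: nat.splits)
  also have "(\<Sum>k\<le>Suc n. (case k of 0 \<Rightarrow> 0 | Suc k' \<Rightarrow> Polynomial.coeff ?R k') * b ^ (Suc n - k)) = (\<Sum>k\<le>n. Polynomial.coeff ?R k * b ^ (n - k))"
    by (subst sum.atMost_Suc_shift) simp
  also have "(\<Sum>k\<le>Suc n. Polynomial.coeff ?R k * b ^ (Suc n - k)) = b * (\<Sum>k\<le>n. Polynomial.coeff ?R k * b ^ (n - k))"
    using coeff_eq_0[of ?R "Suc n"] deg by (simp add: sum_distrib_left Suc_diff_le mult_ac)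
  finally show ?case unfolding Suc.IH by (simp add: algebra_simps)
qed

lemma tm_poly_Suc:
  assumes "j < n"
  shows "tm_poly a (Suc n) j = tm_poly a n j * [:1, - cnj (a n):]"
proof -
  have "{j<..<Suc n} = insert n {j<..<n}" using assms by auto
  then show ?thesis by (simp add: tm_poly_def mult_ac del: mult_pCons_left mult_pCons_right)
qed

lemma degree_tm_poly:
  assumes "j < n"
  shows "Polynomial.degree (tm_poly a n j) < n"
proof -
  have "Polynomial.degree (\<Prod>l<j. [:- a l, 1:]) \<le> j"
    using degree_prod_sum_le[of "{..<j}" "\<lambda>l. [:- a l, 1:]"] by simp
  moreover have "Polynomial.degree (\<Prod>l\<in>{j<..<n}. [:1, - cnj (a l):]) \<le> (\<Sum>l\<in>{j<..<n}. 1)"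
  proof (rule order_trans[OF degree_prod_sum_le])
    have "Polynomial.degree [:1, x:] \<le> 1" for x :: complex
      by (rule order_trans[OF degree_pCons_le]) simp
    then show "sum (Polynomial.degree \<circ> (\<lambda>l. [:1, - cnj (a l):])) {j<..<n} \<le> (\<Sum>l\<in>{j<..<n}. 1)"
      unfolding o_def by (rule sum_mono)
  qed simp
  ultimately have "Polynomial.degree (tm_poly a n j) \<le> j + (n - Suc j)"
    unfolding tm_poly_def by (intro order_trans[OF degree_smult_le] order_trans[OF degree_mult_le]) simp
  then show ?thesis using assms by simp
qed

definition tm_mat :: "(nat \<Rightarrow> complex) \<Rightarrow> nat \<Rightarrow> complex mat" where
  "tm_mat a n = Matrix.mat n n (\<lambda>(j, k). Polynomial.coeff (tm_poly a n j) k)"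

text \<open>Multiplying on the right by the unipotent matrix of powers of conj(a_n) divides the row
  polynomials by 1 - conj(a_n) X. The rows j < n become those of the smaller system, whose degrees
  are below n, so the last column vanishes above the corner; the corner entry comes from
  \<open>sum_coeff_prod_linear\<close>.\<close>

lemma det_tm_mat:
  "Determinant.det (tm_mat a n) = (\<Prod>j<n. of_real (sqrt (1 - (cmod (a j))\<^sup>2)) * (\<Prod>l<j. 1 - a l * cnj (a j)))"
proof (induction n)
  case 0
  then show ?case by (simp add: tm_mat_def)
next
  case (Suc n)
  let ?b = "cnj (a n)"
  let ?s = "complex_of_real (sqrt (1 - (cmod (a n))\<^sup>2))"
  define D where "D = Matrix.mat (Suc n) (Suc n) (\<lambda>(k, l). if k \<le> l then ?b ^ (l - k) else 0)"
  define m where "m = ?s * (\<Prod>l<n. 1 - a l * ?b)"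
  have D: "D \<in> carrier_mat (Suc n) (Suc n)" by (simp add: D_def)
  have B: "tm_mat a (Suc n) \<in> carrier_mat (Suc n) (Suc n)" by (simp add: tm_mat_def)
  have "Determinant.det D = prod_list (diag_mat D)"
    by (rule det_upper_triangular[OF _ D]) (auto simp: D_def upper_triangular_def)
  also have "diag_mat D = map (\<lambda>_. 1) [0..<Suc n]"
    unfolding diag_mat_def by (intro map_cong) (auto simp: D_def)
  finally have detD: "Determinant.det D = 1" by (simp add: map_replicate_const)
  have entry: "(tm_mat a (Suc n) * D) $$ (j, l) = (\<Sum>k\<le>l. Polynomial.coeff (tm_poly a (Suc n) j) k * ?b ^ (l - k))"
    if "j < Suc n" "l < Suc n" for j l
  proof -
    have "(tm_mat a (Suc n) * D) $$ (j, l) = (\<Sum>k<Suc n. Polynomial.coeff (tm_poly a (Suc n) j) k * (if k \<le> l then ?b ^ (l - k) else 0))"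
      using that by (simp add: tm_mat_def D_def scalar_prod_def atLeast0LessThan del: sum.lessThan_Suc)
    also have "\<dots> = (\<Sum>k\<le>l. Polynomial.coeff (tm_poly a (Suc n) j) k * ?b ^ (l - k))"
      using that by (intro sum.mono_neutral_cong_right) auto
    finally show ?thesis .
  qed
  have e1: "(tm_mat a (Suc n) * D) $$ (j, l) = Polynomial.coeff (tm_poly a n j) l" if "j < n" "l < Suc n" for j l
    using that by (simp only: entry less_SucI tm_poly_Suc sum_coeff_mult_geometric)
  have e2: "(tm_mat a (Suc n) * D) $$ (n, n) = m"
  proof -
    have "tm_poly a (Suc n) n = Polynomial.smult ?s (\<Prod>l<n. [:- a l, 1:])"
    proof -
      have "{n<..<Suc n} = {}" by auto
      then show ?thesis by (simp add: tm_poly_def)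
    qed
    then have "(tm_mat a (Suc n) * D) $$ (n, n) = ?s * (\<Sum>k\<le>n. Polynomial.coeff (\<Prod>l<n. [:- a l, 1:]) k * ?b ^ (n - k))"
      by (simp add: entry sum_distrib_left mult.assoc)
    then show ?thesis by (simp add: m_def sum_coeff_prod_linear)
  qed
  have c0: "Polynomial.coeff (tm_poly a n j) n = 0" if "j < n" for j
    using degree_tm_poly[OF that] by (intro coeff_eq_0)
  define R where "R = Matrix.mat 1 n (\<lambda>(_, l). (tm_mat a (Suc n) * D) $$ (n, l))"
  have "tm_mat a (Suc n) * D = four_block_mat (tm_mat a n) (0\<^sub>m n 1) R (Matrix.mat 1 1 (\<lambda>_. m))"
  proof (rule eq_matI)
    fix i j assume "i < dim_row (four_block_mat (tm_mat a n) (0\<^sub>m n 1) R (Matrix.mat 1 1 (\<lambda>_. m)))"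
      "j < dim_col (four_block_mat (tm_mat a n) (0\<^sub>m n 1) R (Matrix.mat 1 1 (\<lambda>_. m)))"
    then have ij: "i < Suc n" "j < Suc n" by (auto simp: tm_mat_def)
    have dims: "dim_row (tm_mat a n) = n" "dim_col (tm_mat a n) = n" by (auto simp: tm_mat_def)
    show "(tm_mat a (Suc n) * D) $$ (i, j) = four_block_mat (tm_mat a n) (0\<^sub>m n 1) R (Matrix.mat 1 1 (\<lambda>_. m)) $$ (i, j)"
    proof (cases "i < n")
      case True
      then show ?thesis using ij e1[OF True ij(2)] c0[OF True] dims
        by (cases "j < n") (auto simp: tm_mat_def less_Suc_eq)
    next
      case False
      then have "i = n" using ij by simp
      then show ?thesis using ij e2 dims
        by (cases "j < n") (auto simp: R_def less_Suc_eq simp del: index_mult_mat)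
    qed
  qed (auto simp: tm_mat_def D_def)
  moreover have "Determinant.det (four_block_mat (tm_mat a n) (0\<^sub>m n 1) R (Matrix.mat 1 1 (\<lambda>_. m))) =
      Determinant.det (tm_mat a n) * Determinant.det (Matrix.mat 1 1 (\<lambda>_. m))"
    by (rule det_four_block_mat_upper_right_zero) (auto simp: tm_mat_def R_def)
  ultimately have "Determinant.det (tm_mat a (Suc n) * D) = Determinant.det (tm_mat a n) * m"
    by (simp add: det_single)
  moreover have "Determinant.det (tm_mat a (Suc n) * D) = Determinant.det (tm_mat a (Suc n))"
    unfolding det_mult[OF B D] detD by simp
  ultimately show ?case by (simp add: Suc.IH m_def)
qed

text \<open>Each unordered pair of distinct indices occurs twice in the double product, as |1 -
  conj(a_i) a_j| is symmetric; this accounts for the square. The diagonal gives the factors 1 -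
  |a_i|^2.\<close>

lemma norm_det_tm_mat_square:
  assumes "\<And>l. l < n \<Longrightarrow> cmod (a l) < 1"
  shows "(cmod (Determinant.det (tm_mat a n)))\<^sup>2 = (\<Prod>i<n. \<Prod>j<n. cmod (1 - cnj (a i) * a j))"
  using assms
proof (induction n)
  case 0
  then show ?case by (simp add: det_tm_mat)
next
  case (Suc n)
  have sq: "1 - (cmod (a n))\<^sup>2 \<ge> 0" using Suc.prems[of n] by (simp add: abs_square_le_1)
  have cc: "cmod (1 - cnj (a n) * a n) = 1 - (cmod (a n))\<^sup>2"
  proof -
    have "1 - cnj (a n) * a n = of_real (1 - (cmod (a n))\<^sup>2)"
      by (simp add: complex_norm_square mult.commute del: of_real_power)
    then show ?thesis using sq by (simp only: norm_of_real abs_of_nonneg)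
  qed
  have sym: "cmod (1 - cnj x * y) = cmod (1 - cnj y * x)" for x y
    by (metis complex_cnj_cnj complex_cnj_diff complex_cnj_mult complex_cnj_one complex_mod_cnj mult.commute)
  have "(cmod (Determinant.det (tm_mat a (Suc n))))\<^sup>2 =
    (cmod (Determinant.det (tm_mat a n)))\<^sup>2 * ((1 - (cmod (a n))\<^sup>2) * (\<Prod>l<n. cmod (1 - cnj (a n) * a l))\<^sup>2)"
    using sq by (simp add: det_tm_mat norm_mult power_mult_distrib prod_norm mult.commute)
  also have "\<dots> = (\<Prod>i<n. \<Prod>j<n. cmod (1 - cnj (a i) * a j)) * ((1 - (cmod (a n))\<^sup>2) * (\<Prod>l<n. cmod (1 - cnj (a n) * a l))\<^sup>2)"
    using Suc by simp
  also have "\<dots> = (\<Prod>i<Suc n. \<Prod>j<Suc n. cmod (1 - cnj (a i) * a j))"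
  proof -
    have "(\<Prod>l<n. cmod (1 - cnj (a l) * a n)) = (\<Prod>l<n. cmod (1 - cnj (a n) * a l))"
      by (intro prod.cong refl sym)
    then show ?thesis by (simp add: prod.distrib cc power2_eq_square)
  qed
  finally show ?case .
qed

section \<open>Fourier coefficients of the step symbol\<close>

lemma circ_power: "circ t ^ k = cis (2 * pi * real k * t)"
proof -
  have "circ t ^ k = cis (real k * (2 * pi * t))" unfolding circ_def
    by (induction k) (simp_all add: cis_mult distrib_right)
  also have "real k * (2 * pi * t) = 2 * pi * real k * t" by simp
  finally show ?thesis .
qed

lemma integral_cis_circle:
  "(\<integral>t. cis (2 * pi * (real k - real l) * t) \<partial>arc (1 / 2)) = (if k = l then 1 else 0)"
proof -
  have "2 * pi * (real k - real l) * (1 / 2) = pi * real_of_int (int k - int l)" by simp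
  then have "sin (2 * pi * (real k - real l) * (1 / 2)) = 0" by (metis sin_npi_int)
  then show ?thesis by (subst integral_cis_arc) auto
qed

definition step_symbol :: "real \<Rightarrow> real \<Rightarrow> real \<Rightarrow> real" where
  "step_symbol u x t = (if \<bar>t\<bar> \<le> x then exp u else 1)"

lemma step_symbol_measurable: "step_symbol u x \<in> borel_measurable (arc y)"
  unfolding step_symbol_def arc_def by (intro measurable_restrict_space1) measurable

lemma integral_indicator_arc:
  fixes h :: "real \<Rightarrow> 'b :: {banach, second_countable_topology}"
  assumes "x \<le> 1 / 2"
  shows "(\<integral>t. indicator {-x..x} t *\<^sub>R h t \<partial>arc (1 / 2)) = (\<integral>t. h t \<partial>arc x)"
    and "integrable (arc x) h \<Longrightarrow> integrable (arc (1 / 2)) (\<lambda>t. indicator {-x..x} t *\<^sub>R h t)"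
proof -
  have eq: "(\<lambda>t. indicator {-(1/2)..1/2} t *\<^sub>R (indicator {-x..x} t *\<^sub>R h t)) = (\<lambda>t. indicator {-x..x} t *\<^sub>R h t)"
    using assms by (auto simp: fun_eq_iff indicator_def)
  have "(\<integral>t. indicator {-x..x} t *\<^sub>R h t \<partial>arc (1 / 2)) =
      (\<integral>t. indicator {-(1/2)..1/2} t *\<^sub>R (indicator {-x..x} t *\<^sub>R h t) \<partial>lborel)"
    unfolding arc_def by (rule integral_restrict_space) simp
  also have "\<dots> = (\<integral>t. h t \<partial>arc x)"
    unfolding eq arc_def by (rule integral_restrict_space[symmetric]) simp
  finally show "(\<integral>t. indicator {-x..x} t *\<^sub>R h t \<partial>arc (1 / 2)) = (\<integral>t. h t \<partial>arc x)" .
  have "integrable (arc x) h \<longleftrightarrow> integrable lborel (\<lambda>t. indicator {-x..x} t *\<^sub>R h t)"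
    unfolding arc_def by (rule integrable_restrict_space) simp
  moreover have "integrable (arc (1 / 2)) (\<lambda>t. indicator {-x..x} t *\<^sub>R h t) \<longleftrightarrow>
      integrable lborel (\<lambda>t. indicator {-(1/2)..1/2} t *\<^sub>R (indicator {-x..x} t *\<^sub>R h t))"
    unfolding arc_def by (rule integrable_restrict_space) simp
  ultimately show "integrable (arc (1 / 2)) (\<lambda>t. indicator {-x..x} t *\<^sub>R h t)" if "integrable (arc x) h"
    using that unfolding eq by simp
qed

lemma integral_step_symbol:
  fixes h :: "real \<Rightarrow> complex"
  assumes "x \<le> 1 / 2" "continuous_on UNIV h"
  shows "(\<integral>t. of_real (step_symbol u x t) * h t \<partial>arc (1 / 2)) = (\<integral>t. h t \<partial>arc (1 / 2)) + of_real (exp u - 1) * (\<integral>t. h t \<partial>arc x)"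
    and "integrable (arc (1 / 2)) (\<lambda>t. of_real (step_symbol u x t) * h t)"
proof -
  define k where "k t = indicator {-x..x} t *\<^sub>R h t" for t
  have eq: "of_real (step_symbol u x t) * h t = h t + of_real (exp u - 1) * k t" for t
    by (auto simp: step_symbol_def indicator_def algebra_simps k_def)
  have int: "(\<integral>t. k t \<partial>arc (1 / 2)) = (\<integral>t. h t \<partial>arc x)" "integrable (arc (1 / 2)) k" "integrable (arc (1 / 2)) h"
    unfolding k_def using integral_indicator_arc[OF assms(1), of h] integrable_arc[OF assms(2)] by auto
  show "(\<integral>t. of_real (step_symbol u x t) * h t \<partial>arc (1 / 2)) = (\<integral>t. h t \<partial>arc (1 / 2)) + of_real (exp u - 1) * (\<integral>t. h t \<partial>arc x)"
    unfolding eq using int by (subst Bochner_Integration.integral_add) auto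
  show "integrable (arc (1 / 2)) (\<lambda>t. of_real (step_symbol u x t) * h t)"
    unfolding eq using int by auto
qed

text \<open>A grid sample of the sine kernel, scaled by the mesh, is a Fourier coefficient of an arc.\<close>

definition toeplitz_entry :: "real \<Rightarrow> real \<Rightarrow> nat \<Rightarrow> nat \<Rightarrow> nat \<Rightarrow> real" where
  "toeplitz_entry u c n i j = (if i = j then 1 else 0) + (exp u - 1) * (c / n * sine_kernel (c * real i / n) (c * real j / n))"

lemma toeplitz_entry_eq_integral:
  assumes "0 < n" "0 < c" "c \<le> n"
  shows "complex_of_real (toeplitz_entry u c n i j) =
    (\<integral>t. of_real (step_symbol u (c / (2 * real n)) t) * cis (2 * pi * (real i - real j) * t) \<partial>arc (1 / 2))"
proof -
  have A2: "(\<integral>t. cis (2 * pi * (real i - real j) * t) \<partial>arc (c / (2 * real n))) =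
      of_real (c / n * sine_kernel (c * real i / n) (c * real j / n))"
  proof (cases "i = j")
    case True
    then show ?thesis using assms by (subst integral_cis_arc) (auto simp: sine_kernel_def)
  next
    case False
    then have ne: "c * real i / n \<noteq> c * real j / n" using assms by simp
    have diff: "c * real i / n - c * real j / n = c / n * (real i - real j)"
      by (simp add: right_diff_distrib)
    have arg: "2 * pi * (real i - real j) * (c / (2 * real n)) = pi * (c * real i / n - c * real j / n)"
      unfolding diff by simp
    have "pi * (c * real i / n - c * real j / n) = c / n * (pi * (real i - real j))"
      unfolding diff by simp
    then have "c / n * sine_kernel (c * real i / n) (c * real j / n) = sin (2 * pi * (real i - real j) * (c / (2 * real n))) / (pi * (real i - real j))"
      unfolding arg using ne assms False by (simp add: sine_kernel_def)
    then show ?thesis using assms False by (subst integral_cis_arc) auto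
  qed
  have "c / (2 * real n) \<le> 1 / 2" using assms by (simp add: field_simps)
  then have "(\<integral>t. of_real (step_symbol u (c / (2 * real n)) t) * cis (2 * pi * (real i - real j) * t) \<partial>arc (1 / 2)) =
      (if i = j then 1 else 0) + of_real (exp u - 1) * of_real (c / n * sine_kernel (c * real i / n) (c * real j / n))"
    unfolding integral_cis_circle[symmetric] A2[symmetric] by (intro integral_step_symbol continuous_intros)
  then show ?thesis unfolding toeplitz_entry_def of_real_add of_real_mult by simp
qed

lemma poly_eq_sum_lessThan:
  fixes p :: "'a :: comm_semiring_1 poly"
  assumes "Polynomial.degree p < n"
  shows "poly p z = (\<Sum>k<n. Polynomial.coeff p k * z ^ k)"
  unfolding poly_altdef using assms by (intro sum.mono_neutral_left) (auto intro: le_degree)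

text \<open>Apply \<open>gibbs_det_bound\<close> to the Takenaka-Malmquist functions with weight f
  |q|^2. The coefficients of q v_i form the rows of B, so the Gram matrix is congruent through B to
  the Toeplitz matrix. The weight contributes the double sum of logarithms twice, by the reproducing
  property of the Poisson kernel, and ln |det B|^2 takes one copy back.\<close>

theorem toeplitz_det_lower_bound:
  fixes a :: "nat \<Rightarrow> complex"
  assumes n: "0 < n" and c: "0 < c" "c \<le> n" and u: "0 \<le> u" and a: "\<And>l. l < n \<Longrightarrow> cmod (a l) < 1"
  defines "\<tau> \<equiv> Determinant.det (Matrix.mat n n (\<lambda>(i, j). toeplitz_entry u c n i j))"
  shows "0 < \<tau>"
    and "u * (\<Sum>j<n. \<integral>t. poisson (a j) (circ t) \<partial>arc (c / (2 * real n))) + (\<Sum>i<n. \<Sum>j<n. ln (cmod (1 - cnj (a i) * a j))) \<le> ln \<tau>"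
proof -
  define x where "x = c / (2 * real n)"
  have x: "x \<le> 1 / 2" "0 \<le> x" using n c by (auto simp: x_def field_simps)
  define q where "q z = (\<Prod>l<n. 1 - cnj (a l) * z)" for z
  define f where "f = step_symbol u x"
  define g where "g t = f t * (cmod (q (circ t)))\<^sup>2" for t
  define v where "v i t = tm_fun a i (circ t)" for i t
  define B where "B = tm_mat a n"
  define T where "T = Matrix.mat n n (\<lambda>(i, j). complex_of_real (toeplitz_entry u c n i j))"
  have BT: "B \<in> carrier_mat n n" "T \<in> carrier_mat n n" by (auto simp: B_def T_def tm_mat_def)
  have f_cases: "1 \<le> f t" "f t \<le> exp u" for t using u by (auto simp: f_def step_symbol_def)
  have contq: "continuous_on UNIV (\<lambda>t. q (circ t))" unfolding q_def by (intro continuous_intros)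
  have contv: "continuous_on UNIV (v i)" if "i < n" for i
    unfolding v_def using a that by (intro continuous_on_compose_circ continuous_on_tm_fun) auto
  \<comment> \<open>Crude bounds for |q| on the circle: they only secure boundedness and positivity
    of the weight and do not enter the estimate.\<close>
  define \<delta> where "\<delta> = (\<Prod>l<n. 1 - cmod (a l))"
  have \<delta>: "0 < \<delta>" unfolding \<delta>_def using a by (intro prod_pos) auto
  have norm_ge: "1 - cmod b \<le> cmod (1 - cnj b * z)" if "cmod z = 1" for b z
    using norm_triangle_ineq2[of 1 "cnj b * z"] that by (simp add: norm_mult)
  have qb: "\<delta> \<le> cmod (q (circ t))" "cmod (q (circ t)) \<le> 2 ^ n" for t
  proof -
    show "\<delta> \<le> cmod (q (circ t))" unfolding \<delta>_def q_def prod_norm[symmetric]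
      using a norm_ge[of "circ t"] by (intro prod_mono) (auto intro: less_imp_le)
    have "cmod (1 - cnj (a l) * circ t) \<le> 2" if "l < n" for l
      using norm_triangle_ineq4[of 1 "cnj (a l) * circ t"] a[OF that] by (simp add: norm_mult)
    then have "(\<Prod>l<n. cmod (1 - cnj (a l) * circ t)) \<le> (\<Prod>l<n. 2)" by (intro prod_mono) auto
    then show "cmod (q (circ t)) \<le> 2 ^ n" by (simp add: q_def prod_norm)
  qed
  have vp: "(cmod (v i t))\<^sup>2 = poisson (a i) (circ t)" if "i < n" for i t
    unfolding v_def using a that by (intro norm_tm_fun_square) auto
  define C where "C = (\<Sum>l<n. 1 / (1 - cmod (a l)))"
  have vC: "cmod (v i t) \<le> C" if i: "i < n" for i t
  proof -
    have p: "0 < 1 - cmod (a i)" using a[OF i] by simp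
    have "(cmod (v i t))\<^sup>2 \<le> 1 / (1 - cmod (a i))\<^sup>2"
      unfolding vp[OF i] poisson_def using p norm_ge[of "circ t" "a i"]
      by (intro frac_le power_mono) auto
    also have "\<dots> = (1 / (1 - cmod (a i)))\<^sup>2" by (simp add: power_divide)
    finally have "cmod (v i t) \<le> 1 / (1 - cmod (a i))" by (rule power2_le_imp_le) (use p in simp)
    also have "\<dots> \<le> C" unfolding C_def using i a
      by (intro member_le_sum) (auto intro: less_imp_le)
    finally show ?thesis .
  qed
  have entry: "(\<integral>t. of_real (g t) * (v i t * cnj (v j t)) \<partial>arc (1 / 2)) = (B * T * mat_adjoint B) $$ (i, j)"
    if ij: "i < n" "j < n" for i j
  proof -
    let ?c = "\<lambda>i k. Polynomial.coeff (tm_poly a n i) k"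
    have E: "q (circ t) * v i t = (\<Sum>k<n. ?c i k * cis (2 * pi * real k * t))" if "i < n" for i t
    proof -
      have "q (circ t) * v i t = poly (tm_poly a n i) (circ t)"
        unfolding q_def v_def using poly_tm_poly[of n a i "circ t"] a that by (simp add: mult.commute)
      then show ?thesis
        by (simp add: poly_eq_sum_lessThan[OF degree_tm_poly[OF that]] circ_power)
    qed
    have "of_real (g t) * (v i t * cnj (v j t)) =
        (\<Sum>k<n. \<Sum>l<n. ?c i k * cnj (?c j l) * (of_real (f t) * cis (2 * pi * (real k - real l) * t)))" for t
    proof -
      have "of_real (g t) * (v i t * cnj (v j t)) = of_real (f t) * ((q (circ t) * v i t) * cnj (q (circ t) * v j t))"
        unfolding g_def of_real_mult complex_norm_square by (simp add: mult_ac)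
      also have "(q (circ t) * v i t) * cnj (q (circ t) * v j t) =
        (\<Sum>k<n. \<Sum>l<n. ?c i k * cnj (?c j l) * (cis (2 * pi * real k * t) * cis (- (2 * pi * real l * t))))"
        unfolding E[OF ij(1)] E[OF ij(2)] cnj_sum sum_product by (simp add: cis_cnj mult_ac)
      finally show ?thesis by (simp add: cis_mult sum_distrib_left algebra_simps)
    qed
    then have "(\<integral>t. of_real (g t) * (v i t * cnj (v j t)) \<partial>arc (1 / 2)) =
      (\<integral>t. (\<Sum>k<n. \<Sum>l<n. ?c i k * cnj (?c j l) * (of_real (f t) * cis (2 * pi * (real k - real l) * t))) \<partial>arc (1 / 2))"
      by simp
    also have "\<dots> = (\<Sum>k<n. \<Sum>l<n. ?c i k * cnj (?c j l) * (\<integral>t. of_real (f t) * cis (2 * pi * (real k - real l) * t) \<partial>arc (1 / 2)))"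
    proof -
      have "integrable (arc (1 / 2)) (\<lambda>t. of_real (f t) * cis (2 * pi * (real k - real l) * t))" for k l
        unfolding f_def by (intro integral_step_symbol x continuous_intros)
      then show ?thesis
        by (subst Bochner_Integration.integral_sum; (intro Bochner_Integration.integrable_sum)?; simp?)+
    qed
    also have "\<dots> = (\<Sum>k<n. \<Sum>l<n. ?c i k * cnj (?c j l) * T $$ (k, l))"
      unfolding f_def x_def toeplitz_entry_eq_integral[OF n c, symmetric] by (simp add: T_def)
    also have "\<dots> = (\<Sum>l<n. (\<Sum>k<n. ?c i k * T $$ (k, l)) * cnj (?c j l))"
      by (subst sum.swap) (simp add: sum_distrib_left sum_distrib_right mult_ac)
    also have "\<dots> = (B * T * mat_adjoint B) $$ (i, j)"
      using ij BT by (simp add: scalar_prod_def atLeast0LessThan) (simp add: B_def tm_mat_def)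
    finally show ?thesis .
  qed
  have gm: "g \<in> borel_measurable (arc (1 / 2))"
    unfolding g_def f_def by (intro borel_measurable_times step_symbol_measurable borel_measurable_arc continuous_intros contq)
  have gb: "\<delta>\<^sup>2 \<le> g t \<and> g t \<le> exp u * (2 ^ n)\<^sup>2" for t
  proof
    have "1 * \<delta>\<^sup>2 \<le> f t * (cmod (q (circ t)))\<^sup>2"
      using f_cases[of t] qb[of t] \<delta> by (intro mult_mono power_mono) auto
    then show "\<delta>\<^sup>2 \<le> g t" by (simp add: g_def)
    show "g t \<le> exp u * (2 ^ n)\<^sup>2"
      unfolding g_def using f_cases[of t] qb[of t] by (intro mult_mono power_mono) auto
  qed
  have "\<exists>D>0. Determinant.det (Matrix.mat n n (\<lambda>(i, j). \<integral>t. of_real (g t) * (v i t * cnj (v j t)) \<partial>arc (1 / 2))) = of_real D \<and>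
    (\<Sum>i<n. \<integral>t. ln (g t) * (cmod (v i t))\<^sup>2 \<partial>arc (1 / 2)) \<le> ln D"
  proof (rule gibbs_det_bound[OF finite_measure_arc gm _ gb _ vC])
    show "v i \<in> borel_measurable (arc (1 / 2))" if "i < n" for i using contv[OF that] by (rule borel_measurable_arc)
    show "(\<integral>t. v i t * cnj (v j t) \<partial>arc (1 / 2)) = (if i = j then 1 else 0)" if "i < n" "j < n" for i j
      unfolding v_def using a that by (intro tm_fun_orthonormal) auto
  qed (use \<delta> in auto)
  also have "Matrix.mat n n (\<lambda>(i, j). \<integral>t. of_real (g t) * (v i t * cnj (v j t)) \<partial>arc (1 / 2)) = B * T * mat_adjoint B"
    using BT by (intro eq_matI) (auto simp: entry simp del: index_mult_mat(1))
  also have "Determinant.det (B * T * mat_adjoint B) = of_real ((cmod (Determinant.det B))\<^sup>2 * \<tau>)"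
  proof -
    have "Determinant.det (B * T * mat_adjoint B) = Determinant.det B * Determinant.det T * cnj (Determinant.det B)"
      by (simp add: det_mult[OF mult_carrier_mat[OF BT] mat_adjoint_carrier[OF BT(1)]] det_mult[OF BT] det_mat_adjoint[OF BT(1)])
    moreover have "Determinant.det T = of_real \<tau>"
      unfolding T_def \<tau>_def of_real_det_mat by (simp add: case_prod_unfold)
    ultimately show ?thesis unfolding of_real_mult complex_norm_square by (simp add: mult_ac)
  qed
  finally obtain D where D: "0 < D" "(cmod (Determinant.det B))\<^sup>2 * \<tau> = D"
    "(\<Sum>i<n. \<integral>t. ln (g t) * (cmod (v i t))\<^sup>2 \<partial>arc (1 / 2)) \<le> ln D"
    by (auto simp only: of_real_eq_iff)
  have nz: "cmod (1 - cnj (a i) * a j) \<noteq> 0" if "i < n" "j < n" for i j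
    using one_minus_cnj_mult_nonzero(1)[OF a[OF that(1)], of "a j"] a[OF that(2)] by simp
  have detB: "(cmod (Determinant.det B))\<^sup>2 = (\<Prod>i<n. \<Prod>j<n. cmod (1 - cnj (a i) * a j))"
    unfolding B_def by (rule norm_det_tm_mat_square) (rule a)
  have detB_pos: "0 < (cmod (Determinant.det B))\<^sup>2"
  proof -
    have "0 < cmod (1 - cnj (a i) * a j)" if "i < n" "j < n" for i j
      using nz[OF that] norm_ge_zero[of "1 - cnj (a i) * a j"] by linarith
    then show ?thesis unfolding detB by (intro prod_pos) auto
  qed
  then show \<tau>: "0 < \<tau>" using D(1,2) by (metis zero_less_mult_pos)
  have lnB: "ln ((cmod (Determinant.det B))\<^sup>2) = (\<Sum>i<n. \<Sum>j<n. ln (cmod (1 - cnj (a i) * a j)))"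
  proof -
    have "ln ((cmod (Determinant.det B))\<^sup>2) = (\<Sum>i<n. ln (\<Prod>j<n. cmod (1 - cnj (a i) * a j)))"
      unfolding detB using nz by (intro ln_prod) auto
    also have "\<dots> = (\<Sum>i<n. \<Sum>j<n. ln (cmod (1 - cnj (a i) * a j)))"
      using nz by (intro sum.cong refl ln_prod) auto
    finally show ?thesis .
  qed
  have "ln D = (\<Sum>i<n. \<Sum>j<n. ln (cmod (1 - cnj (a i) * a j))) + ln \<tau>"
    unfolding D(2)[symmetric] lnB[symmetric] using detB_pos \<tau> by (intro ln_mult_pos)
  moreover have "(\<integral>t. ln (g t) * (cmod (v i t))\<^sup>2 \<partial>arc (1 / 2)) =
      u * (\<integral>t. poisson (a i) (circ t) \<partial>arc x) + 2 * (\<Sum>l<n. ln (cmod (1 - cnj (a l) * a i)))" if i: "i < n" for i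
  proof -
    have q0: "0 < cmod (q (circ t))" for t using qb(1)[of t] \<delta> by linarith
    have contp: "continuous_on UNIV (\<lambda>t. poisson (a i) (circ t))"
      unfolding vp[OF i, symmetric] by (intro continuous_intros contv i)
    have "ln (g t) * (cmod (v i t))\<^sup>2 = u * (indicator {-x..x} t *\<^sub>R poisson (a i) (circ t)) +
        2 * (poisson (a i) (circ t) * ln (cmod (q (circ t))))" for t
    proof -
      have "ln (g t) = ln (f t) + 2 * ln (cmod (q (circ t)))"
        unfolding g_def using f_cases(1)[of t] q0[of t] by (simp add: ln_mult_pos ln_realpow)
      moreover have "ln (f t) = u * indicator {-x..x} t"
        by (auto simp: f_def step_symbol_def indicator_def)
      ultimately show ?thesis by (simp add: vp[OF i] algebra_simps)
    qed
    then have "(\<integral>t. ln (g t) * (cmod (v i t))\<^sup>2 \<partial>arc (1 / 2)) =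
      (\<integral>t. u * (indicator {-x..x} t *\<^sub>R poisson (a i) (circ t)) + 2 * (poisson (a i) (circ t) * ln (cmod (q (circ t)))) \<partial>arc (1 / 2))"
      by simp
    also have "\<dots> = u * (\<integral>t. indicator {-x..x} t *\<^sub>R poisson (a i) (circ t) \<partial>arc (1 / 2)) +
      2 * (\<integral>t. poisson (a i) (circ t) * ln (cmod (q (circ t))) \<partial>arc (1 / 2))"
    proof -
      have "integrable (arc (1 / 2)) (\<lambda>t. indicator {-x..x} t *\<^sub>R poisson (a i) (circ t))"
        by (intro integral_indicator_arc(2) x integrable_arc contp)
      moreover have "integrable (arc (1 / 2)) (\<lambda>t. poisson (a i) (circ t) * ln (cmod (q (circ t))))"
        using q0 by (intro integrable_arc continuous_intros contp contq) (auto simp: less_imp_neq)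
      ultimately show ?thesis by (subst Bochner_Integration.integral_add) auto
    qed
    also have "(\<integral>t. indicator {-x..x} t *\<^sub>R poisson (a i) (circ t) \<partial>arc (1 / 2)) = (\<integral>t. poisson (a i) (circ t) \<partial>arc x)"
      by (rule integral_indicator_arc(1)[OF x(1)])
    also have "(\<integral>t. poisson (a i) (circ t) * ln (cmod (q (circ t))) \<partial>arc (1 / 2)) = ln (cmod (q (a i)))"
      unfolding q_def by (rule integral_poisson_ln_norm) (use a i in auto)
    also have "ln (cmod (q (a i))) = (\<Sum>l<n. ln (cmod (1 - cnj (a l) * a i)))"
      unfolding q_def prod_norm[symmetric] by (rule ln_prod) (use nz i in auto)
    finally show ?thesis .
  qed
  moreover have "(\<Sum>i<n. \<Sum>l<n. ln (cmod (1 - cnj (a l) * a i))) = (\<Sum>i<n. \<Sum>j<n. ln (cmod (1 - cnj (a i) * a j)))"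
    by (rule sum.swap)
  ultimately show "u * (\<Sum>j<n. \<integral>t. poisson (a j) (circ t) \<partial>arc (c / (2 * real n))) +
      (\<Sum>i<n. \<Sum>j<n. ln (cmod (1 - cnj (a i) * a j))) \<le> ln \<tau>"
    using D(3) by (simp add: sum.distrib sum_distrib_left[symmetric] x_def)
qed

section \<open>Fourier analysis on the circle\<close>

lemma integral_circ_powers:
  "(\<integral>t. circ t ^ k * cnj (circ t ^ l) \<partial>arc (1 / 2)) = (if k = l then 1 else 0)"
proof -
  have "circ t ^ k * cnj (circ t ^ l) = cis (2 * pi * (real k - real l) * t)" for t
    unfolding circ_power cis_cnj cis_mult by (simp add: algebra_simps)
  then show ?thesis by (simp add: integral_cis_circle)
qed

lemma parseval_circ:
  assumes "finite K"
  shows "(\<integral>t. (cmod (\<Sum>k\<in>K. b k * circ t ^ k))\<^sup>2 \<partial>arc (1 / 2)) = (\<Sum>k\<in>K. (cmod (b k))\<^sup>2)"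
proof -
  have "complex_of_real (\<integral>t. (cmod (\<Sum>k\<in>K. b k * circ t ^ k))\<^sup>2 \<partial>arc (1 / 2)) =
      (\<integral>t. (\<Sum>k\<in>K. \<Sum>l\<in>K. b k * cnj (b l) * (circ t ^ k * cnj (circ t ^ l))) \<partial>arc (1 / 2))"
    unfolding integral_complex_of_real[symmetric] complex_norm_square
    by (simp add: sum_product cnj_sum mult_ac)
  also have "\<dots> = (\<Sum>k\<in>K. \<Sum>l\<in>K. b k * cnj (b l) * (\<integral>t. circ t ^ k * cnj (circ t ^ l) \<partial>arc (1 / 2)))"
  proof -
    have "integrable (arc (1 / 2)) (\<lambda>t. circ t ^ k * cnj (circ t ^ l))" for k l
      by (intro integrable_arc continuous_intros)
    then show ?thesis
      by (subst Bochner_Integration.integral_sum; (intro Bochner_Integration.integrable_sum)?; simp?)+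
  qed
  also have "\<dots> = (\<Sum>k\<in>K. \<Sum>l\<in>K. if k = l then of_real ((cmod (b k))\<^sup>2) else 0)"
    unfolding integral_circ_powers by (intro sum.cong refl) (auto simp: complex_norm_square simp del: of_real_power)
  also have "\<dots> = of_real (\<Sum>k\<in>K. (cmod (b k))\<^sup>2)" using assms by simp
  finally show ?thesis by (simp only: of_real_eq_iff)
qed

text \<open>Integrate |G - S|^2 with S the Fourier sum over K. It later bounds all power sums of
  index above n at once.\<close>

lemma bessel_circ:
  fixes G :: "real \<Rightarrow> complex"
  assumes K: "finite K" and G: "continuous_on UNIV G"
  shows "(\<Sum>k\<in>K. (cmod (\<integral>t. G t * cnj (circ t ^ k) \<partial>arc (1 / 2)))\<^sup>2) \<le> (\<integral>t. (cmod (G t))\<^sup>2 \<partial>arc (1 / 2))"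
proof -
  define g where "g k = (\<integral>t. G t * cnj (circ t ^ k) \<partial>arc (1 / 2))" for k
  define S where "S t = (\<Sum>k\<in>K. g k * circ t ^ k)" for t
  have contS: "continuous_on UNIV S" unfolding S_def by (intro continuous_intros)
  have int: "integrable (arc (1 / 2)) (\<lambda>t. G t * cnj (circ t ^ k))" for k
    by (intro integrable_arc continuous_intros G)
  have GS: "(\<integral>t. G t * cnj (S t) \<partial>arc (1 / 2)) = of_real (\<Sum>k\<in>K. (cmod (g k))\<^sup>2)"
  proof -
    have "(\<integral>t. G t * cnj (S t) \<partial>arc (1 / 2)) = (\<integral>t. (\<Sum>k\<in>K. cnj (g k) * (G t * cnj (circ t ^ k))) \<partial>arc (1 / 2))"
      by (simp add: S_def cnj_sum sum_distrib_left mult_ac)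
    also have "\<dots> = (\<Sum>k\<in>K. cnj (g k) * g k)"
      unfolding g_def using int by (subst Bochner_Integration.integral_sum) auto
    also have "\<dots> = of_real (\<Sum>k\<in>K. (cmod (g k))\<^sup>2)"
      unfolding of_real_sum complex_norm_square by (simp add: mult.commute)
    finally show ?thesis .
  qed
  define X where "X t = Re (G t * cnj (S t))" for t
  have "(cmod (G t - S t))\<^sup>2 = (cmod (G t))\<^sup>2 + (cmod (S t))\<^sup>2 - 2 * X t" for t
    unfolding cmod_power2 X_def by (simp add: power2_eq_square algebra_simps)
  then have "(\<integral>t. (cmod (G t - S t))\<^sup>2 \<partial>arc (1 / 2)) =
      (\<integral>t. (cmod (G t))\<^sup>2 + (cmod (S t))\<^sup>2 - 2 * X t \<partial>arc (1 / 2))" by simp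
  also have "\<dots> = (\<integral>t. (cmod (G t))\<^sup>2 \<partial>arc (1 / 2)) + (\<integral>t. (cmod (S t))\<^sup>2 \<partial>arc (1 / 2)) -
      2 * (\<integral>t. X t \<partial>arc (1 / 2))"
  proof -
    have "integrable (arc (1 / 2)) (\<lambda>t. (cmod (G t))\<^sup>2)" "integrable (arc (1 / 2)) (\<lambda>t. (cmod (S t))\<^sup>2)"
      "integrable (arc (1 / 2)) X"
      unfolding X_def by (intro integrable_arc continuous_intros G contS)+
    then show ?thesis by simp
  qed
  also have "(\<integral>t. X t \<partial>arc (1 / 2)) = Re (\<integral>t. G t * cnj (S t) \<partial>arc (1 / 2))"
    unfolding X_def by (intro integral_Re integrable_arc continuous_intros G contS)
  also have "\<dots> = (\<Sum>k\<in>K. (cmod (g k))\<^sup>2)" unfolding GS by (rule Re_complex_of_real)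
  also have "(\<integral>t. (cmod (S t))\<^sup>2 \<partial>arc (1 / 2)) = (\<Sum>k\<in>K. (cmod (g k))\<^sup>2)"
    unfolding S_def by (rule parseval_circ[OF K])
  finally have "(\<integral>t. (cmod (G t - S t))\<^sup>2 \<partial>arc (1 / 2)) = (\<integral>t. (cmod (G t))\<^sup>2 \<partial>arc (1 / 2)) - (\<Sum>k\<in>K. (cmod (g k))\<^sup>2)" by simp
  moreover have "0 \<le> (\<integral>t. (cmod (G t - S t))\<^sup>2 \<partial>arc (1 / 2))" by (intro integral_nonneg_AE) auto
  ultimately show ?thesis by (simp add: g_def)
qed

text \<open>A zero r outside the closed disc gives the factor 1 - z/r, that is, the reflected point
  1 / conj(r). Missing degrees are filled with the point 0, so exactly n points result.\<close>

lemma poly_factor_outside_disc: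
  fixes q :: "complex poly"
  assumes "poly q 0 = 1" "Polynomial.degree q \<le> n" "\<And>z. cmod z \<le> 1 \<Longrightarrow> poly q z \<noteq> 0"
  shows "\<exists>a. (\<forall>l<n. cmod (a l) < 1) \<and> q = (\<Prod>l<n. [:1, - cnj (a l):])"
  using assms
proof (induction n arbitrary: q)
  case 0
  then have "Polynomial.degree q = 0" by simp
  then obtain b where "q = [:b:]" by (rule degree_eq_zeroE)
  then show ?case using 0 by (intro exI[of _ "\<lambda>_. 0"]) auto
next
  case (Suc n)
  show ?case
  proof (cases "Polynomial.degree q = 0")
    case True
    then obtain b where "q = [:b:]" by (rule degree_eq_zeroE)
    then show ?thesis using Suc.prems(1) by (intro exI[of _ "\<lambda>_. 0"]) (auto simp: one_pCons)
  next
    case False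
    then obtain r where r: "poly q r = 0" using alg_closed_imp_poly_has_root[of q] by auto
    then have nr: "1 < cmod r" using Suc.prems(3)[of r] by force
    then have r0: "r \<noteq> 0" by auto
    have "[:- r, 1:] dvd q" using r by (simp add: poly_eq_0_iff_dvd)
    then obtain p where p: "q = [:- r, 1:] * p" by (rule dvdE)
    define q' where "q' = Polynomial.smult (- r) p"
    have q: "q = [:1, - (1 / r):] * q'"
    proof -
      have e: "[:- r, 1:] = Polynomial.smult (- r) [:1, - (1 / r):]" using r0 by simp
      show ?thesis unfolding p q'_def e by (simp only: mult_smult_left mult_smult_right)
    qed
    have q0: "q' \<noteq> 0" using Suc.prems(1) q by auto
    have "poly q' 0 = 1" using Suc.prems(1) q by simp
    moreover have "Polynomial.degree q' \<le> n"
    proof -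
      have "Polynomial.degree q = Polynomial.degree [:1, - (1 / r):] + Polynomial.degree q'"
        unfolding q by (rule degree_mult_eq) (use q0 in auto)
      then show ?thesis using Suc.prems(2) r0 by simp
    qed
    moreover have "poly q' z \<noteq> 0" if "cmod z \<le> 1" for z using Suc.prems(3)[OF that] q by auto
    ultimately obtain a where a: "\<forall>l<n. cmod (a l) < 1" "q' = (\<Prod>l<n. [:1, - cnj (a l):])"
      using Suc.IH by blast
    define a' where "a' = a(n := cnj (1 / r))"
    have "(\<Prod>l<n. [:1, - cnj (a' l):]) = (\<Prod>l<n. [:1, - cnj (a l):])"
      by (intro prod.cong) (auto simp: a'_def)
    then have "q = (\<Prod>l<Suc n. [:1, - cnj (a' l):])"
      by (simp add: q a(2) a'_def mult.commute del: mult_pCons_left mult_pCons_right)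
    moreover have "cmod (a' l) < 1" if "l < Suc n" for l
      using that a(1) nr by (auto simp: a'_def norm_divide less_Suc_eq divide_less_eq)
    ultimately show ?thesis by blast
  qed
qed

text \<open>The logarithmic derivative of the product, cleared of its denominator.\<close>

lemma poly_pderiv_prod_linear:
  fixes a :: "nat \<Rightarrow> complex"
  assumes "\<And>l. l < n \<Longrightarrow> 1 - cnj (a l) * z \<noteq> 0"
  defines "q \<equiv> \<Prod>l<n. [:1, - cnj (a l):]"
  shows "poly (pderiv q) z = - (\<Sum>l<n. cnj (a l) / (1 - cnj (a l) * z)) * poly q z"
  unfolding q_def using assms(1)
proof (induction n)
  case 0
  then show ?case by simp
next
  case (Suc n)
  let ?q = "\<Prod>l<n. [:1, - cnj (a l):]"
  have "poly (pderiv (?q * [:1, - cnj (a n):])) z = poly ?q z * (- cnj (a n)) + (1 - cnj (a n) * z) * poly (pderiv ?q) z"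
    by (simp add: pderiv_mult pderiv_pCons mult_ac del: mult_pCons_left mult_pCons_right)
  also have "poly (pderiv ?q) z = - (\<Sum>l<n. cnj (a l) / (1 - cnj (a l) * z)) * poly ?q z"
    using Suc by simp
  also have "poly ?q z * (- cnj (a n)) + (1 - cnj (a n) * z) * (- (\<Sum>l<n. cnj (a l) / (1 - cnj (a l) * z)) * poly ?q z) =
      - ((\<Sum>l<n. cnj (a l) / (1 - cnj (a l) * z)) + cnj (a n) / (1 - cnj (a n) * z)) * (poly ?q z * (1 - cnj (a n) * z))"
  proof -
    have "Q * (- b) + d * (- S * Q) = - (S + b / d) * (Q * d)" if "d \<noteq> 0" for Q S b d :: complex
      using that by (simp add: field_simps)
    then show ?thesis using Suc.prems[of n] by blast
  qed
  also have "poly ?q z * (1 - cnj (a n) * z) = poly (?q * [:1, - cnj (a n):]) z"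
    by (simp add: mult.commute[of z] del: mult_pCons_left mult_pCons_right)
  finally show ?case by simp
qed

text \<open>The kernel is 1 plus twice the real part of the series of positive powers of conj(a) z.
  Summed over the points, the second summand becomes - 2 Re (z q'/q), which links the arc integral
  to the logarithmic derivative of q.\<close>

lemma poisson_eq_Re:
  assumes "cmod a < 1" "cmod z = 1"
  shows "poisson a z = 1 + 2 * Re (z * (cnj a / (1 - cnj a * z)))"
proof -
  define w where "w = cnj a * z"
  have w: "w \<noteq> 1" unfolding w_def using assms by (intro one_minus_cnj_mult_nonzero) auto
  have nw: "cmod w = cmod a" using assms by (simp add: w_def norm_mult)
  have D0: "(cmod (1 - w))\<^sup>2 \<noteq> 0" using w by simp
  have R1: "Re (w / (1 - w)) = Re (w * cnj (1 - w)) / (cmod (1 - w))\<^sup>2"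
    by (subst complex_div_cnj) (simp only: Re_divide_of_real)
  have R2: "Re (w * cnj (1 - w)) = Re w - (cmod w)\<^sup>2"
    unfolding cmod_power2 by (simp add: power2_eq_square algebra_simps)
  have D1: "(cmod (1 - w))\<^sup>2 = 1 - 2 * Re w + (cmod w)\<^sup>2"
    unfolding cmod_power2 by (simp add: power2_eq_square algebra_simps)
  have alg: "(1 - N) / D = 1 + 2 * ((R - N) / D)" if "D \<noteq> 0" "D = 1 - 2 * R + N" for N D R :: real
    using that by (simp add: field_simps)
  have "poisson a z = (1 - (cmod w)\<^sup>2) / (cmod (1 - w))\<^sup>2" unfolding poisson_def nw unfolding w_def ..
  also have "\<dots> = 1 + 2 * Re (w / (1 - w))" unfolding R1 R2 by (rule alg[OF D0 D1])
  also have "w / (1 - w) = z * (cnj a / (1 - cnj a * z))" by (simp add: w_def)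
  finally show ?thesis .
qed

text \<open>The coefficient of z^k in a geometric series; conjugating the integrand on the circle
  reduces it to Cauchy's formula. Summed over the points, these coefficients are the power
  sums.\<close>

lemma integral_poisson_kernel_coeff:
  assumes a: "cmod a < 1"
  shows "(\<integral>t. cnj a / (1 - cnj a * circ t) * cnj (circ t ^ k) \<partial>arc (1 / 2)) = cnj a ^ Suc k"
proof -
  have eq: "cnj a / (1 - cnj a * circ t) * cnj (circ t ^ k) = cnj (a * circ t ^ k * circ t / (circ t - a))" for t
  proof -
    have "circ t - a \<noteq> 0" "1 - cnj a * circ t \<noteq> 0"
      using a norm_circ[of t] one_minus_cnj_mult_nonzero(1)[of a "circ t"] by auto
    moreover have "cnj (circ t - a) = (1 - cnj a * circ t) / circ t"
      by (simp add: cnj_circ field_simps)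
    ultimately show ?thesis by (simp only: complex_cnj_divide complex_cnj_mult) (simp add: cnj_circ field_simps)
  qed
  have "(\<integral>t. a * circ t ^ k * circ t / (circ t - a) \<partial>arc (1 / 2)) = a * a ^ k"
    by (rule circle_mean_Cauchy[of "\<lambda>z. a * z ^ k"]) (auto intro!: continuous_intros holomorphic_intros a)
  then show ?thesis unfolding eq by (subst Bochner_Integration.integral_cnj) simp
qed

text \<open>The logarithmic series; its term at k = 0 is 0, because division by 0 yields 0.\<close>

lemma sums_ln_norm_one_minus:
  assumes "cmod w < 1"
  shows "(\<lambda>k. - Re (w ^ k) / real k) sums ln (cmod (1 - w))"
proof -
  have "(\<lambda>k. - ((- (- w)) ^ k) / of_nat k) sums Ln (1 + (- w))"
    by (rule Ln_series') (use assms in simp)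
  then have "(\<lambda>k. - (w ^ k) / of_nat k) sums Ln (1 - w)" by simp
  then have "(\<lambda>k. Re (- (w ^ k) / of_nat k)) sums Re (Ln (1 - w))" by (rule sums_Re)
  moreover have "1 - w \<noteq> 0" using assms by auto
  ultimately show ?thesis by (simp add: Re_Ln)
qed

text \<open>In the logarithmic series the sum of (conj(a_i) a_j)^k over i and j factors into the
  squared modulus of a power sum, so the interaction of the points becomes diagonal in the
  frequency.\<close>

lemma sums_ln_energy:
  fixes a :: "nat \<Rightarrow> complex"
  assumes "\<And>l. l < n \<Longrightarrow> cmod (a l) < 1"
  shows "(\<lambda>k. - (cmod (\<Sum>l<n. cnj (a l) ^ k))\<^sup>2 / real k) sums (\<Sum>i<n. \<Sum>j<n. ln (cmod (1 - cnj (a i) * a j)))"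
proof -
  have "cmod (cnj (a i) * a j) < 1" if "i < n" "j < n" for i j
  proof -
    have "cmod (cnj (a i) * a j) \<le> cmod (a i) * 1"
      unfolding norm_mult complex_mod_cnj using assms[OF that(2)] by (intro mult_left_mono) auto
    then show ?thesis using assms[OF that(1)] by simp
  qed
  then have "(\<lambda>k. \<Sum>i<n. \<Sum>j<n. - Re ((cnj (a i) * a j) ^ k) / real k) sums (\<Sum>i<n. \<Sum>j<n. ln (cmod (1 - cnj (a i) * a j)))"
    by (intro sums_sum sums_ln_norm_one_minus) auto
  moreover have "(\<Sum>i<n. \<Sum>j<n. - Re ((cnj (a i) * a j) ^ k) / real k) = - (cmod (\<Sum>l<n. cnj (a l) ^ k))\<^sup>2 / real k" for k
  proof -
    have "complex_of_real ((cmod (\<Sum>l<n. cnj (a l) ^ k))\<^sup>2) = (\<Sum>i<n. \<Sum>j<n. (cnj (a i) * a j) ^ k)"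
      unfolding complex_norm_square cnj_sum sum_product by (simp add: power_mult_distrib)
    from arg_cong[OF this, of Re]
    have "(cmod (\<Sum>l<n. cnj (a l) ^ k))\<^sup>2 = (\<Sum>i<n. \<Sum>j<n. Re ((cnj (a i) * a j) ^ k))"
      by (simp only: Re_complex_of_real Re_sum)
    then show ?thesis by (simp add: sum_negf sum_divide_distrib)
  qed
  ultimately show ?thesis by simp
qed

section \<open>Truncated exponentials as trial polynomials\<close>

text \<open>The Taylor coefficients of $e^{-P}$, where $P' = \sum_k b_k z^k$ and $P(0) = 0$.\<close>

function trial_coeff :: "(nat \<Rightarrow> real) \<Rightarrow> nat \<Rightarrow> real" where
  "trial_coeff b 0 = 1"
| "trial_coeff b (Suc l) = - (\<Sum>k\<le>l. b k * trial_coeff b (l - k)) / real (Suc l)"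
  by pat_completeness auto
termination by (relation "Wellfounded.measure snd") auto

lemma trial_coeff_recurrence: "real (Suc l) * trial_coeff b (Suc l) + (\<Sum>k\<le>l. b k * trial_coeff b (l - k)) = 0"
  by simp

text \<open>Indices are shifted by one: \<open>b k\<close> stands for (k + 1) times the coefficient
  of z^(k+1) in the exponent. The cutoff m bounds the frequencies in use; n is both the truncation
  degree and the size of the Toeplitz matrix.\<close>

locale trial_polynomial =
  fixes b :: "nat \<Rightarrow> real" and m n :: nat and B :: real
  assumes m_pos: "0 < m" and m_le_n: "m \<le> n"
    and b_support: "\<And>k. m \<le> k \<Longrightarrow> b k = 0"
    and b_bound: "\<And>k. \<bar>b k\<bar> \<le> B"
begin

text \<open>Bounds |P| on the closed unit disc.\<close>

definition S :: real where "S = (\<Sum>k<m. \<bar>b k\<bar> / real (Suc k))"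

text \<open>Bounds every coefficient of the residual \<open>r\<close>: only the last m Taylor
  coefficients feel the truncation.\<close>

definition \<epsilon> :: real where "\<epsilon> = B * (\<Sum>i\<in>{n - m<..n}. \<bar>trial_coeff b i\<bar>)"

text \<open>Bounds |Q e^P - 1| on the closed disc, the relative error of the truncation.\<close>

definition \<eta> :: real where "\<eta> = \<epsilon> * exp S"

definition Q :: "complex poly" where "Q = (\<Sum>l\<le>n. Polynomial.monom (of_real (trial_coeff b l)) l)"

definition P' :: "complex poly" where "P' = (\<Sum>k<m. Polynomial.monom (of_real (b k)) k)"

definition P :: "complex \<Rightarrow> complex" where "P z = (\<Sum>k<m. of_real (b k / real (Suc k)) * z ^ Suc k)"

text \<open>The untruncated exponential solves y' + P' y = 0; this is the residual left by its
  truncation Q.\<close>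

definition r :: "complex poly" where "r = pderiv Q + P' * Q"

definition r_quot :: "complex \<Rightarrow> complex" where "r_quot z = (\<Sum>j<m. Polynomial.coeff r (n + j) * z ^ j)"

lemma n_pos: "0 < n" using m_pos m_le_n by simp

lemma B_nonneg: "0 \<le> B" using b_bound[of 0] by linarith

lemma \<epsilon>_nonneg: "0 \<le> \<epsilon>" unfolding \<epsilon>_def by (intro mult_nonneg_nonneg B_nonneg sum_nonneg) auto

lemma \<eta>_nonneg: "0 \<le> \<eta>" unfolding \<eta>_def by (intro mult_nonneg_nonneg \<epsilon>_nonneg) auto

lemma coeff_Q: "Polynomial.coeff Q l = (if l \<le> n then of_real (trial_coeff b l) else 0)"
  by (simp add: Q_def coeff_sum coeff_monom)

lemma coeff_P': "Polynomial.coeff P' k = of_real (b k)"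
  using b_support[of k] by (auto simp: P'_def coeff_sum coeff_monom)

lemma poly_Q_0: "poly Q 0 = 1"
  by (simp add: poly_0_coeff_0 coeff_Q)

lemma degree_Q: "Polynomial.degree Q \<le> n"
  by (intro degree_le) (simp add: coeff_Q)

text \<open>Below degree n the residual involves only coefficients that were kept, and for them the
  recurrence is exactly this vanishing.\<close>

lemma coeff_r_low:
  assumes "l < n"
  shows "Polynomial.coeff r l = 0"
proof -
  have "Polynomial.coeff r l = of_real (real (Suc l) * trial_coeff b (Suc l) + (\<Sum>k\<le>l. b k * trial_coeff b (l - k)))"
  proof -
    have "l - i \<le> n" for i using assms by simp
    then show ?thesis
      using assms by (simp add: r_def coeff_pderiv coeff_mult coeff_Q coeff_P' del: trial_coeff.simps)
  qed
  then show ?thesis unfolding trial_coeff_recurrence by simp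
qed

text \<open>For l \<ge> n, the product of \<open>b i\<close> with the Taylor coefficient of index l
  - i survives only if i < m and l - i \<le> n; then l - i lies among the last m indices up to
  n.\<close>

lemma norm_coeff_r_high:
  assumes l: "n \<le> l"
  shows "cmod (Polynomial.coeff r l) \<le> \<epsilon>" "n + m \<le> l \<Longrightarrow> Polynomial.coeff r l = 0"
proof -
  define I where "I = {i. i \<le> l \<and> i < m \<and> l - i \<le> n}"
  have finI: "finite I" by (rule finite_subset[of _ "{..l}"]) (auto simp: I_def)
  have "Polynomial.coeff r l = (\<Sum>i\<le>l. of_real (b i) * Polynomial.coeff Q (l - i))"
    using l by (simp add: r_def coeff_pderiv coeff_mult coeff_P') (simp add: coeff_Q)
  also have "\<dots> = (\<Sum>i\<in>I. of_real (b i) * of_real (trial_coeff b (l - i)))"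
  proof -
    have "i < m" if "b i \<noteq> 0" for i using b_support[of i] that by (meson not_le)
    then show ?thesis by (intro sum.mono_neutral_cong_right) (auto simp: I_def coeff_Q)
  qed
  finally have eq: "Polynomial.coeff r l = (\<Sum>i\<in>I. of_real (b i) * of_real (trial_coeff b (l - i)))" .
  have "cmod (Polynomial.coeff r l) \<le> (\<Sum>i\<in>I. \<bar>b i\<bar> * \<bar>trial_coeff b (l - i)\<bar>)"
    unfolding eq by (rule order_trans[OF norm_sum]) (simp add: norm_mult)
  also have "\<dots> \<le> (\<Sum>i\<in>I. B * \<bar>trial_coeff b (l - i)\<bar>)"
    using b_bound by (intro sum_mono mult_right_mono) auto
  also have "\<dots> = B * (\<Sum>i\<in>(\<lambda>i. l - i) ` I. \<bar>trial_coeff b i\<bar>)"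
    by (subst sum.reindex) (auto simp: sum_distrib_left inj_on_def I_def)
  also have "\<dots> \<le> \<epsilon>" unfolding \<epsilon>_def
    using l m_le_n by (intro mult_left_mono sum_mono2 B_nonneg) (auto simp: I_def)
  finally show "cmod (Polynomial.coeff r l) \<le> \<epsilon>" .
  show "Polynomial.coeff r l = 0" if "n + m \<le> l"
  proof -
    have "I = {}" using that by (auto simp: I_def)
    then show ?thesis by (simp add: eq)
  qed
qed

lemma poly_r: "poly r z = z ^ n * r_quot z"
proof -
  have "Polynomial.degree r \<le> n + m - 1"
    using m_pos by (intro degree_le) (auto intro: norm_coeff_r_high(2))
  then have "poly r z = (\<Sum>l<n + m. Polynomial.coeff r l * z ^ l)"
    using m_pos by (intro poly_eq_sum_lessThan) simp
  also have "\<dots> = (\<Sum>l\<in>{n..<n + m}. Polynomial.coeff r l * z ^ l)"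
    by (intro sum.mono_neutral_right) (auto simp: coeff_r_low not_le)
  also have "\<dots> = (\<Sum>j<m. Polynomial.coeff r (n + j) * z ^ (n + j))"
    by (rule sum.reindex_bij_witness[of _ "\<lambda>j. n + j" "\<lambda>l. l - n"]) auto
  finally show ?thesis by (simp add: r_quot_def sum_distrib_left power_add mult_ac)
qed

lemma norm_r_quot:
  assumes "cmod z \<le> 1"
  shows "cmod (r_quot z) \<le> real m * \<epsilon>"
proof -
  have "cmod (r_quot z) \<le> (\<Sum>j<m. cmod (Polynomial.coeff r (n + j)) * cmod z ^ j)"
    unfolding r_quot_def by (rule order_trans[OF norm_sum]) (simp add: norm_mult norm_power)
  also have "\<dots> \<le> (\<Sum>j<m. \<epsilon> * 1)"
    using assms by (intro sum_mono mult_mono norm_coeff_r_high power_le_one \<epsilon>_nonneg) auto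
  finally show ?thesis by simp
qed

lemma norm_P:
  assumes "cmod z \<le> 1"
  shows "cmod (P z) \<le> S"
proof -
  have "cmod (P z) \<le> (\<Sum>k<m. \<bar>b k\<bar> / real (Suc k) * cmod z ^ Suc k)"
    unfolding P_def by (rule order_trans[OF norm_sum]) (simp add: norm_mult norm_power norm_divide del: power_Suc of_nat_Suc)
  also have "\<dots> \<le> (\<Sum>k<m. \<bar>b k\<bar> / real (Suc k) * 1)"
    using assms by (intro sum_mono mult_left_mono power_le_one) auto
  finally show ?thesis by (simp add: S_def)
qed

lemma P_deriv: "(P has_field_derivative poly P' z) (at z)"
proof -
  have "poly P' z = (\<Sum>k<m. of_real (b k) * z ^ k)"
    by (simp add: P'_def poly_sum poly_monom)
  moreover have "((\<lambda>z. \<Sum>k<m. of_real (b k / real (Suc k)) * z ^ Suc k) has_field_derivative (\<Sum>k<m. of_real (b k) * z ^ k)) (at z)"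
  proof (intro DERIV_sum)
    fix k
    have "((\<lambda>z. of_real (b k / real (Suc k)) * z ^ Suc k) has_field_derivative
        of_real (b k / real (Suc k)) * ((1 + of_nat k) * (1 * z ^ k))) (at z)"
      by (intro DERIV_cmult DERIV_power_Suc DERIV_ident)
    also have "complex_of_real (b k / real (Suc k)) * ((1 + of_nat k) * (1 * z ^ k)) = of_real (b k / real (Suc k) * (1 + real k)) * z ^ k"
      by (simp only: of_real_mult of_real_add of_real_1 of_real_of_nat_eq mult_1 mult.assoc)
    also have "b k / real (Suc k) * (1 + real k) = b k" by simp
    finally show "((\<lambda>z. of_real (b k / real (Suc k)) * z ^ Suc k) has_field_derivative of_real (b k) * z ^ k) (at z)" .
  qed
  ultimately show ?thesis unfolding P_def[abs_def] by simp
qed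

text \<open>The derivative of $Q e^P$ is $r e^P$, which vanishes to order $n$ at the origin.\<close>

lemma Q_exp_P_close:
  assumes z: "cmod z \<le> 1"
  shows "cmod (poly Q z * exp (P z) - 1) \<le> \<eta>"
proof -
  define \<phi> where "\<phi> w = poly Q (w * z) * exp (P (w * z))" for w
  have deriv: "(\<phi> has_field_derivative z * poly r (w * z) * exp (P (w * z))) (at w)" for w
    unfolding \<phi>_def[abs_def] r_def
    by (rule derivative_eq_intros DERIV_chain2[OF P_deriv] DERIV_chain2[OF poly_DERIV] refl)+
      (simp add: algebra_simps)
  \<comment> \<open>At s the derivative is at most m \<epsilon> e^S s^n, because r carries a factor
    z^n. Integrating over s gives m / (n + 1) < 1, which absorbs the m.\<close>
  have "cmod (\<phi> (of_real 1) - \<phi> (of_real 0)) \<le> real m * \<epsilon> * exp S * 1 ^ Suc n / real (Suc n) - real m * \<epsilon> * exp S * 0 ^ Suc n / real (Suc n)"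
  proof (rule differentiable_bound_general[of 0 1 "\<lambda>s. \<phi> (of_real s)" "\<lambda>s. real m * \<epsilon> * exp S * s ^ Suc n / real (Suc n)"
        "\<lambda>s. z * poly r (of_real s * z) * exp (P (of_real s * z))" "\<lambda>s. real m * \<epsilon> * exp S * s ^ n"])
    have vd: "((\<lambda>s. \<phi> (of_real s)) has_vector_derivative z * poly r (of_real s * z) * exp (P (of_real s * z))) (at s within A)" for s A
      by (rule has_vector_derivative_real_field[OF deriv])
    then show "((\<lambda>s. \<phi> (of_real s)) has_vector_derivative z * poly r (of_real s * z) * exp (P (of_real s * z))) (at s)" for s .
    show "continuous_on {0..1} (\<lambda>s. \<phi> (of_real s))"
      using vd by (intro continuous_on_vector_derivative) auto
    show "continuous_on {0..1} (\<lambda>s. real m * \<epsilon> * exp S * s ^ Suc n / real (Suc n))"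
      by (intro continuous_intros) auto
    show "((\<lambda>s. real m * \<epsilon> * exp S * s ^ Suc n / real (Suc n)) has_vector_derivative real m * \<epsilon> * exp S * s ^ n) (at s)" for s
    proof -
      have "((\<lambda>s. (real m * \<epsilon> * exp S / real (Suc n)) * s ^ Suc n) has_field_derivative
          (real m * \<epsilon> * exp S / real (Suc n)) * ((1 + of_nat n) * (1 * s ^ n))) (at s)"
        by (intro DERIV_cmult DERIV_power_Suc DERIV_ident)
      then show ?thesis
        unfolding has_real_derivative_iff_has_vector_derivative[symmetric] by (simp add: mult.assoc)
    qed
    fix s :: real assume s: "0 < s" "s < 1"
    have "cmod (of_real s * z) \<le> s * 1" unfolding norm_mult using s z by (intro mult_mono) auto
    then have w: "cmod (of_real s * z) \<le> s" "cmod (of_real s * z) \<le> 1" using s by auto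
    have "cmod (z * poly r (of_real s * z) * exp (P (of_real s * z))) =
        cmod z * (cmod (of_real s * z) ^ n * cmod (r_quot (of_real s * z))) * cmod (exp (P (of_real s * z)))"
      by (simp add: poly_r norm_mult norm_power power_mult_distrib)
    also have "\<dots> \<le> 1 * (s ^ n * (real m * \<epsilon>)) * exp S"
    proof (intro mult_mono power_mono norm_r_quot)
      show "cmod (exp (P (of_real s * z))) \<le> exp S"
        using norm_P[OF w(2)] norm_exp[of "P (of_real s * z)"] by (meson exp_le_cancel_iff order_trans)
    qed (use w s z \<epsilon>_nonneg in auto)
    finally show "cmod (z * poly r (of_real s * z) * exp (P (of_real s * z))) \<le> real m * \<epsilon> * exp S * s ^ n"
      by (simp add: mult_ac)
  qed auto
  moreover have "\<phi> 1 - \<phi> 0 = poly Q z * exp (P z) - 1"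
    by (simp add: \<phi>_def poly_Q_0 P_def)
  ultimately have "cmod (poly Q z * exp (P z) - 1) \<le> real m / real (Suc n) * \<eta>"
    by (simp add: \<eta>_def)
  also have "\<dots> \<le> 1 * \<eta>" using m_le_n by (intro mult_right_mono \<eta>_nonneg) (auto simp: field_simps)
  finally show ?thesis by simp
qed

text \<open>Q e^P stays within 1/2 of 1 while |e^P| \<le> e^S; this keeps the truncation free of
  zeros in the closed disc.\<close>

lemma norm_Q_lower:
  assumes z: "cmod z \<le> 1" and small: "\<eta> \<le> 1 / 2"
  shows "exp (- S) / 2 \<le> cmod (poly Q z)" "poly Q z \<noteq> 0"
proof -
  have "1 - \<eta> \<le> cmod (poly Q z * exp (P z))"
    using Q_exp_P_close[OF z] norm_triangle_ineq2[of 1 "1 - poly Q z * exp (P z)"] by (simp add: norm_minus_commute)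
  also have "\<dots> \<le> cmod (poly Q z) * exp S"
    unfolding norm_mult using norm_P[OF z] norm_exp[of "P z"]
    by (intro mult_left_mono) (auto intro: order_trans)
  finally have "1 / 2 \<le> cmod (poly Q z) * exp S" using small by linarith
  then have "1 / 2 * exp (- S) \<le> cmod (poly Q z) * exp S * exp (- S)" by (intro mult_right_mono) auto
  also have "\<dots> = cmod (poly Q z)" by (simp add: exp_minus)
  finally show "exp (- S) / 2 \<le> cmod (poly Q z)" by simp
  then show "poly Q z \<noteq> 0" using exp_gt_zero[of "- S"] by (auto simp del: exp_gt_zero)
qed

end

lemma holomorphic_on_poly_complex: "poly q holomorphic_on A"
  unfolding holomorphic_on_def field_differentiable_def
  using poly_DERIV has_field_derivative_at_within by blast

text \<open>With the points obtained from the zeros of Q, A = - Q'/Q equals P' - G, where G = r/Q is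
  the error. The Fourier coefficients of A are the power sums, and those of P' are the
  \<open>b k\<close>. So both terms of \<open>toeplitz_det_lower_bound\<close> are the ideal ones up
  to errors controlled by \<eta>.\<close>

theorem (in trial_polynomial) toeplitz_det_trial_bound:
  fixes c u :: real
  assumes c: "0 < c" "c \<le> real n" and u: "0 \<le> u" and small: "\<eta> \<le> 1 / 2"
  defines "\<tau> \<equiv> Determinant.det (Matrix.mat n n (\<lambda>(i, j). toeplitz_entry u c n i j))"
  shows "0 < \<tau>"
    and "u * c + (\<Sum>k<m. 2 * u * b k * sin (pi * real (Suc k) * c / n) / (pi * real (Suc k)) - (b k)\<^sup>2 / real (Suc k))
      - 4 * u * c * \<eta> - 4 * \<eta>\<^sup>2 \<le> ln \<tau>"
proof -
  define x where "x = c / (2 * real n)"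
  have x: "0 \<le> x" "x * (2 * real n) = c" using c n_pos by (auto simp: x_def)
  obtain a where a: "\<And>l. l < n \<Longrightarrow> cmod (a l) < 1" and Qa: "Q = (\<Prod>l<n. [:1, - cnj (a l):])"
    using poly_factor_outside_disc[OF poly_Q_0 degree_Q norm_Q_lower(2)[OF _ small]] by blast
  have anz: "1 - cnj (a l) * z \<noteq> 0" if "l < n" "cmod z \<le> 1" for l z
    using one_minus_cnj_mult_nonzero(1)[OF a[OF that(1)] that(2)] .
  define G where "G z = poly r z / poly Q z" for z
  define A where "A z = (\<Sum>l<n. cnj (a l) / (1 - cnj (a l) * z))" for z
  have AG: "A z = poly P' z - G z" if z: "cmod z \<le> 1" for z
  proof -
    have "poly r z = poly (pderiv Q) z + poly P' z * poly Q z" by (simp add: r_def)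
    also have "poly (pderiv Q) z = - A z * poly Q z"
      unfolding Qa A_def using anz z by (intro poly_pderiv_prod_linear) auto
    finally show ?thesis using norm_Q_lower(2)[OF z small] by (simp add: G_def field_simps)
  qed
  have contG: "continuous_on UNIV (\<lambda>t. G (circ t))"
    unfolding G_def using norm_Q_lower(2)[OF _ small] by (intro continuous_intros) auto
  have contP': "continuous_on UNIV (\<lambda>t. poly P' (circ t))" by (intro continuous_intros)
  have normG: "cmod (G z) \<le> 2 * exp S * cmod (r_quot z)" if z: "cmod z = 1" for z
  proof -
    have "cmod (G z) = cmod (r_quot z) / cmod (poly Q z)"
      using z by (simp add: G_def poly_r norm_divide norm_mult norm_power)
    also have "\<dots> \<le> cmod (r_quot z) / (exp (- S) / 2)"
      using norm_Q_lower[OF _ small, of z] z by (intro divide_left_mono) auto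
    finally show ?thesis by (simp add: exp_minus field_simps)
  qed
  define \<sigma> where "\<sigma> k = (\<Sum>l<n. cnj (a l) ^ k)" for k
  have intG: "(\<integral>t. G (circ t) * cnj (circ t ^ k) \<partial>arc (1 / 2)) = of_real (b k) - \<sigma> (Suc k)" for k
  proof -
    have "(\<integral>t. A (circ t) * cnj (circ t ^ k) \<partial>arc (1 / 2)) =
        (\<integral>t. (\<Sum>l<n. cnj (a l) / (1 - cnj (a l) * circ t) * cnj (circ t ^ k)) \<partial>arc (1 / 2))"
      by (simp add: A_def sum_distrib_right)
    also have "\<dots> = (\<Sum>l<n. \<integral>t. cnj (a l) / (1 - cnj (a l) * circ t) * cnj (circ t ^ k) \<partial>arc (1 / 2))"
      using anz by (intro Bochner_Integration.integral_sum integrable_arc continuous_intros) auto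
    also have "\<dots> = \<sigma> (Suc k)"
      unfolding \<sigma>_def using a by (intro sum.cong refl integral_poisson_kernel_coeff) auto
    finally have 1: "(\<integral>t. A (circ t) * cnj (circ t ^ k) \<partial>arc (1 / 2)) = \<sigma> (Suc k)" .
    have "(\<integral>t. poly P' (circ t) * cnj (circ t ^ k) \<partial>arc (1 / 2)) =
        (\<integral>t. (\<Sum>i<m. of_real (b i) * (circ t ^ i * cnj (circ t ^ k))) \<partial>arc (1 / 2))"
      by (simp add: P'_def poly_sum poly_monom sum_distrib_left sum_distrib_right mult_ac)
    also have "\<dots> = (\<Sum>i<m. of_real (b i) * (\<integral>t. circ t ^ i * cnj (circ t ^ k) \<partial>arc (1 / 2)))"
    proof -
      have "integrable (arc (1 / 2)) (\<lambda>t. circ t ^ i * cnj (circ t ^ k))" for i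
        by (intro integrable_arc continuous_intros)
      then show ?thesis by (subst Bochner_Integration.integral_sum) simp_all
    qed
    also have "\<dots> = (\<Sum>i<m. if i = k then of_real (b k) else 0)"
      unfolding integral_circ_powers by (intro sum.cong refl) auto
    also have "\<dots> = of_real (b k)" using b_support[of k] by (cases "k < m") auto
    finally have 2: "(\<integral>t. poly P' (circ t) * cnj (circ t ^ k) \<partial>arc (1 / 2)) = of_real (b k)" .
    have "G (circ t) * cnj (circ t ^ k) = poly P' (circ t) * cnj (circ t ^ k) - A (circ t) * cnj (circ t ^ k)" for t
      by (simp add: AG algebra_simps)
    then have "(\<integral>t. G (circ t) * cnj (circ t ^ k) \<partial>arc (1 / 2)) =
        (\<integral>t. poly P' (circ t) * cnj (circ t ^ k) - A (circ t) * cnj (circ t ^ k) \<partial>arc (1 / 2))" by simp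
    also have "\<dots> = of_real (b k) - \<sigma> (Suc k)"
      unfolding 1[symmetric] 2[symmetric] A_def using anz
      by (intro Bochner_Integration.integral_diff integrable_arc continuous_intros contP') auto
    finally show ?thesis .
  qed
  \<comment> \<open>G vanishes to order n at 0, so multiplying it by z^(-k) with k < n leaves a
    holomorphic function that is 0 at 0 and has mean 0: the power sums up to index n are
    exact.\<close>
  have \<sigma>_low: "\<sigma> (Suc k) = of_real (b k)" if k: "k < n" for k
  proof -
    define h where "h z = z ^ (n - k) * r_quot z / poly Q z" for z
    have "G (circ t) * cnj (circ t ^ k) = h (circ t)" for t
    proof -
      have "circ t ^ n * cnj (circ t ^ k) = circ t ^ (n - k) * (circ t * cnj (circ t)) ^ k"
        using k by (simp add: power_mult_distrib power_add[symmetric] mult.assoc[symmetric])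
      also have "circ t * cnj (circ t) = 1" by (simp add: cnj_circ)
      finally show ?thesis by (simp add: G_def h_def poly_r mult_ac)
    qed
    then have "(\<integral>t. G (circ t) * cnj (circ t ^ k) \<partial>arc (1 / 2)) = (\<integral>t. h (circ t) \<partial>arc (1 / 2))" by simp
    also have "\<dots> = h 0"
    proof (rule circle_mean_value)
      show "continuous_on (cball 0 1) h" unfolding h_def r_quot_def
        using norm_Q_lower(2)[OF _ small] by (intro continuous_intros) auto
      show "h holomorphic_on ball 0 1" unfolding h_def r_quot_def
        using norm_Q_lower(2)[OF _ small] by (intro holomorphic_intros holomorphic_on_poly_complex) auto
    qed
    also have "h 0 = 0" using k by (simp add: h_def)
    finally show ?thesis using intG[of k] by simp
  qed
  \<comment> \<open>From index n + 1 on, b contributes nothing and the power sums are Fourier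
    coefficients of -G. Bessel, followed by Parseval for the m coefficients of
    \<open>r_quot\<close>, gives m \<epsilon>^2 instead of the (m \<epsilon>)^2 of a supremum
    bound.\<close>
  have tail: "(\<Sum>k\<in>{n..<N}. (cmod (\<sigma> (Suc k)))\<^sup>2) \<le> 4 * real m * \<eta>\<^sup>2" for N
  proof -
    have "(\<Sum>k\<in>{n..<N}. (cmod (\<sigma> (Suc k)))\<^sup>2) = (\<Sum>k\<in>{n..<N}. (cmod (\<integral>t. G (circ t) * cnj (circ t ^ k) \<partial>arc (1 / 2)))\<^sup>2)"
      unfolding intG using b_support m_le_n by (intro sum.cong refl) auto
    also have "\<dots> \<le> (\<integral>t. (cmod (G (circ t)))\<^sup>2 \<partial>arc (1 / 2))"
      by (intro bessel_circ contG) auto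
    also have "\<dots> \<le> (\<integral>t. (2 * exp S)\<^sup>2 * (cmod (\<Sum>j<m. Polynomial.coeff r (n + j) * circ t ^ j))\<^sup>2 \<partial>arc (1 / 2))"
    proof (rule integral_mono)
      show "integrable (arc (1 / 2)) (\<lambda>t. (cmod (G (circ t)))\<^sup>2)"
        by (intro integrable_arc continuous_intros contG)
      show "integrable (arc (1 / 2)) (\<lambda>t. (2 * exp S)\<^sup>2 * (cmod (\<Sum>j<m. Polynomial.coeff r (n + j) * circ t ^ j))\<^sup>2)"
        by (intro integrable_arc continuous_intros)
      show "(cmod (G (circ t)))\<^sup>2 \<le> (2 * exp S)\<^sup>2 * (cmod (\<Sum>j<m. Polynomial.coeff r (n + j) * circ t ^ j))\<^sup>2" for t
        using power_mono[OF normG[of "circ t"], of 2] by (simp add: r_quot_def power_mult_distrib)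
    qed
    also have "\<dots> = (2 * exp S)\<^sup>2 * (\<Sum>j<m. (cmod (Polynomial.coeff r (n + j)))\<^sup>2)"
      by (subst integral_mult_right_zero) (simp only: parseval_circ finite_lessThan)
    also have "\<dots> \<le> (2 * exp S)\<^sup>2 * (\<Sum>j<m. \<epsilon>\<^sup>2)"
      by (intro mult_left_mono sum_mono power_mono norm_coeff_r_high) auto
    also have "\<dots> = 4 * real m * \<eta>\<^sup>2" by (simp add: \<eta>_def power_mult_distrib)
    finally show ?thesis .
  qed
  define E where "E = (\<Sum>i<n. \<Sum>j<n. ln (cmod (1 - cnj (a i) * a j)))"
  have energy: "- (\<Sum>k<m. (b k)\<^sup>2 / real (Suc k)) - 4 * \<eta>\<^sup>2 \<le> E"
  proof -
    have "(\<lambda>k. - (cmod (\<sigma> k))\<^sup>2 / real k) sums E"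
      unfolding \<sigma>_def E_def using a by (rule sums_ln_energy)
    then have "(\<lambda>k. - (cmod (\<sigma> (Suc k)))\<^sup>2 / real (Suc k)) sums E"
      by (subst sums_Suc_iff) simp
    then have lim: "(\<lambda>N. \<Sum>k<N. - (cmod (\<sigma> (Suc k)))\<^sup>2 / real (Suc k)) \<longlonglongrightarrow> E"
      by (simp add: sums_def)
    have "- (\<Sum>k<m. (b k)\<^sup>2 / real (Suc k)) - 4 * \<eta>\<^sup>2 \<le> (\<Sum>k<N. - (cmod (\<sigma> (Suc k)))\<^sup>2 / real (Suc k))" for N
    proof -
      have "(\<Sum>k<N. (cmod (\<sigma> (Suc k)))\<^sup>2 / real (Suc k)) \<le> (\<Sum>k\<in>{..<n} \<union> {n..<N}. (cmod (\<sigma> (Suc k)))\<^sup>2 / real (Suc k))"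
        by (intro sum_mono2) auto
      also have "\<dots> = (\<Sum>k<n. (cmod (\<sigma> (Suc k)))\<^sup>2 / real (Suc k)) + (\<Sum>k\<in>{n..<N}. (cmod (\<sigma> (Suc k)))\<^sup>2 / real (Suc k))"
        by (rule sum.union_disjoint) auto
      also have "(\<Sum>k<n. (cmod (\<sigma> (Suc k)))\<^sup>2 / real (Suc k)) = (\<Sum>k<n. (b k)\<^sup>2 / real (Suc k))"
        by (intro sum.cong refl) (simp add: \<sigma>_low)
      also have "\<dots> = (\<Sum>k<m. (b k)\<^sup>2 / real (Suc k))"
        using m_le_n b_support by (intro sum.mono_neutral_right) auto
      \<comment> \<open>The weight 1/(k + 1) is below 1/n here, and m \<le> n then removes the
        factor m of the tail bound.\<close>
      also have "(\<Sum>k\<in>{n..<N}. (cmod (\<sigma> (Suc k)))\<^sup>2 / real (Suc k)) \<le> (\<Sum>k\<in>{n..<N}. (cmod (\<sigma> (Suc k)))\<^sup>2 / real n)"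
        using n_pos by (intro sum_mono divide_left_mono) auto
      also have "\<dots> = (\<Sum>k\<in>{n..<N}. (cmod (\<sigma> (Suc k)))\<^sup>2) / real n" by (simp add: sum_divide_distrib)
      also have "\<dots> \<le> (4 * real m * \<eta>\<^sup>2) / real n" by (intro divide_right_mono tail) auto
      also have "\<dots> \<le> 4 * \<eta>\<^sup>2"
      proof -
        have "4 * real m * \<eta>\<^sup>2 \<le> 4 * real n * \<eta>\<^sup>2" using m_le_n by (intro mult_right_mono) auto
        then show ?thesis using n_pos by (simp add: field_simps)
      qed
      finally show ?thesis by (simp add: sum_negf)
    qed
    then show ?thesis by (intro LIMSEQ_le_const[OF lim]) auto
  qed
  \<comment> \<open>The arc has length 2 x = c/n. The constant n integrates to c, the frequency k +
    1 to the Fourier coefficient of the arc, and since |G| \<le> 2 m \<eta> the error is at most 4 c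
    \<eta> m/n.\<close>
  have arc_sum: "c + 2 * (\<Sum>k<m. b k * sin (pi * real (Suc k) * c / n) / (pi * real (Suc k))) - 4 * c * \<eta> \<le>
      (\<Sum>j<n. \<integral>t. poisson (a j) (circ t) \<partial>arc x)"
  proof -
    have contpo: "continuous_on UNIV (\<lambda>t. poisson (a j) (circ t))" if "j < n" for j
      unfolding poisson_def using anz[OF that] by (intro continuous_intros) auto
    have "(\<Sum>j<n. \<integral>t. poisson (a j) (circ t) \<partial>arc x) = (\<integral>t. (\<Sum>j<n. poisson (a j) (circ t)) \<partial>arc x)"
      using contpo by (intro Bochner_Integration.integral_sum[symmetric] integrable_arc) auto
    also have "\<dots> = (\<integral>t. real n + 2 * Re (circ t * poly P' (circ t)) - 2 * Re (circ t * G (circ t)) \<partial>arc x)"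
    proof (rule Bochner_Integration.integral_cong[OF refl])
      fix t
      have "(\<Sum>j<n. poisson (a j) (circ t)) = (\<Sum>j<n. 1 + 2 * Re (circ t * (cnj (a j) / (1 - cnj (a j) * circ t))))"
        using a by (intro sum.cong refl poisson_eq_Re) auto
      also have "\<dots> = real n + 2 * Re (circ t * A (circ t))"
        by (simp add: A_def sum.distrib sum_distrib_left Re_sum del: times_complex.simps)
      also have "\<dots> = real n + 2 * Re (circ t * poly P' (circ t)) - 2 * Re (circ t * G (circ t))"
        by (simp add: AG right_diff_distrib del: times_complex.simps)
      finally show "(\<Sum>j<n. poisson (a j) (circ t)) = real n + 2 * Re (circ t * poly P' (circ t)) - 2 * Re (circ t * G (circ t))" .
    qed
    also have "\<dots> = (\<integral>t. real n \<partial>arc x) + 2 * (\<integral>t. Re (circ t * poly P' (circ t)) \<partial>arc x) - 2 * (\<integral>t. Re (circ t * G (circ t)) \<partial>arc x)"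
    proof -
      have "integrable (arc x) (\<lambda>t. Re (circ t * poly P' (circ t)))" "integrable (arc x) (\<lambda>t. Re (circ t * G (circ t)))"
        "integrable (arc x) (\<lambda>t. real n)"
        by (intro integrable_arc continuous_intros contG contP')+
      then show ?thesis by (simp del: times_complex.simps lebesgue_integral_const)
    qed
    also have "(\<integral>t. real n \<partial>arc x) = c"
      using x by (subst integral_arc) (auto intro!: continuous_intros)
    also have "(\<integral>t. Re (circ t * poly P' (circ t)) \<partial>arc x) = (\<Sum>k<m. b k * sin (pi * real (Suc k) * c / n) / (pi * real (Suc k)))"
    proof -
      have "(\<integral>t. Re (circ t * poly P' (circ t)) \<partial>arc x) = Re (\<integral>t. circ t * poly P' (circ t) \<partial>arc x)"
        by (intro integral_Re integrable_arc continuous_intros contP')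
      also have "(\<integral>t. circ t * poly P' (circ t) \<partial>arc x) = (\<integral>t. (\<Sum>k<m. of_real (b k) * circ t ^ Suc k) \<partial>arc x)"
        by (simp add: P'_def poly_sum poly_monom sum_distrib_left mult_ac)
      also have "\<dots> = (\<Sum>k<m. of_real (b k) * (\<integral>t. circ t ^ Suc k \<partial>arc x))"
      proof -
        have "integrable (arc x) (\<lambda>t. circ t ^ Suc k)" for k
          by (intro integrable_arc continuous_intros)
        then show ?thesis by (subst Bochner_Integration.integral_sum) (simp_all del: power_Suc)
      qed
      also have "\<dots> = of_real (\<Sum>k<m. b k * sin (pi * real (Suc k) * c / n) / (pi * real (Suc k)))"
        unfolding of_real_sum
      proof (intro sum.cong refl)
        fix k
        have "2 * pi * real (Suc k) * x = pi * real (Suc k) * c / n" using n_pos by (simp add: x_def)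
        then have "(\<integral>t. circ t ^ Suc k \<partial>arc x) = of_real (sin (pi * real (Suc k) * c / n) / (pi * real (Suc k)))"
          unfolding circ_power by (subst integral_cis_arc[OF x(1)]) (simp del: of_nat_Suc)
        then show "of_real (b k) * (\<integral>t. circ t ^ Suc k \<partial>arc x) =
            complex_of_real (b k * sin (pi * real (Suc k) * c / n) / (pi * real (Suc k)))" by (simp del: of_nat_Suc power_Suc)
      qed
      finally show ?thesis by (simp only: Re_complex_of_real)
    qed
    finally have eq: "(\<Sum>j<n. \<integral>t. poisson (a j) (circ t) \<partial>arc x) =
      c + 2 * (\<Sum>k<m. b k * sin (pi * real (Suc k) * c / n) / (pi * real (Suc k))) - 2 * (\<integral>t. Re (circ t * G (circ t)) \<partial>arc x)" .
    have "(\<integral>t. Re (circ t * G (circ t)) \<partial>arc x) \<le> (\<integral>t. 2 * exp S * (real m * \<epsilon>) \<partial>arc x)"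
    proof (rule integral_mono)
      show "integrable (arc x) (\<lambda>t. Re (circ t * G (circ t)))" "integrable (arc x) (\<lambda>t. 2 * exp S * (real m * \<epsilon>))"
        by (intro integrable_arc continuous_intros contG)+
      show "Re (circ t * G (circ t)) \<le> 2 * exp S * (real m * \<epsilon>)" for t
      proof -
        have "Re (circ t * G (circ t)) \<le> cmod (circ t * G (circ t))" by (rule complex_Re_le_cmod)
        also have "\<dots> = cmod (G (circ t))" by (simp add: norm_mult)
        also have "\<dots> \<le> 2 * exp S * cmod (r_quot (circ t))" by (rule normG) simp
        also have "\<dots> \<le> 2 * exp S * (real m * \<epsilon>)" by (intro mult_left_mono norm_r_quot) auto
        finally show ?thesis .
      qed
    qed
    also have "\<dots> = 2 * x * (2 * exp S * (real m * \<epsilon>))"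
      using x by (subst integral_arc) (auto intro!: continuous_intros)
    also have "\<dots> = 4 * x * real m * \<eta>" by (simp add: \<eta>_def)
    also have "\<dots> \<le> 4 * x * real n * \<eta>" using m_le_n x(1) by (intro mult_right_mono mult_left_mono \<eta>_nonneg) auto
    also have "\<dots> = 2 * c * \<eta>" using x(2) by (simp add: mult_ac)
    finally show ?thesis unfolding eq by simp
  qed
  show "0 < \<tau>" unfolding \<tau>_def by (rule toeplitz_det_lower_bound(1)[of n c u a, OF n_pos c u a])
  have bound: "u * (\<Sum>j<n. \<integral>t. poisson (a j) (circ t) \<partial>arc x) + E \<le> ln \<tau>"
    unfolding \<tau>_def E_def x_def by (rule toeplitz_det_lower_bound(2)[OF n_pos c u a])
  define X where "X = (\<Sum>k<m. b k * sin (pi * real (Suc k) * c / n) / (pi * real (Suc k)))"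
  have "u * (c + 2 * X - 4 * c * \<eta>) \<le> u * (\<Sum>j<n. \<integral>t. poisson (a j) (circ t) \<partial>arc x)"
    unfolding X_def by (rule mult_left_mono[OF arc_sum u])
  also have "u * (c + 2 * X - 4 * c * \<eta>) = u * c + 2 * u * X - 4 * u * c * \<eta>" by (simp add: algebra_simps)
  finally have "u * c + 2 * u * X - 4 * u * c * \<eta> - (\<Sum>k<m. (b k)\<^sup>2 / real (Suc k)) - 4 * \<eta>\<^sup>2 \<le> ln \<tau>"
    using bound energy by linarith
  moreover have "(\<Sum>k<m. 2 * u * b k * sin (pi * real (Suc k) * c / n) / (pi * real (Suc k)) - (b k)\<^sup>2 / real (Suc k)) =
      2 * u * X - (\<Sum>k<m. (b k)\<^sup>2 / real (Suc k))"
    unfolding X_def sum_subtractf sum_distrib_left by (simp add: mult.assoc)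
  ultimately show "u * c + (\<Sum>k<m. 2 * u * b k * sin (pi * real (Suc k) * c / n) / (pi * real (Suc k)) - (b k)\<^sup>2 / real (Suc k))
      - 4 * u * c * \<eta> - 4 * \<eta>\<^sup>2 \<le> ln \<tau>"
    by linarith
qed

section \<open>Decay of the truncation error\<close>

context trial_polynomial
begin

text \<open>A Gronwall argument for partial sums: by the recurrence, f' \<le> g' f, so f e^(-g) does
  not increase from its value 1 at 0. Passing to absolute values first makes all terms nonnegative,
  so cutting off at N only helps.\<close>

lemma sum_trial_coeff_le:
  assumes R: "0 \<le> R"
  shows "(\<Sum>l\<le>N. \<bar>trial_coeff b l\<bar> * R ^ l) \<le> exp (\<Sum>k<m. \<bar>b k\<bar> / real (Suc k) * R ^ Suc k)"
proof -
  define e where "e l = \<bar>trial_coeff b l\<bar>" for l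
  define f where "f x = (\<Sum>l\<le>N. e l * x ^ l)" for x :: real
  define g where "g x = (\<Sum>k<m. \<bar>b k\<bar> / real (Suc k) * x ^ Suc k)" for x :: real
  define f' where "f' x = (\<Sum>l<N. real (Suc l) * e (Suc l) * x ^ l)" for x :: real
  define g' where "g' x = (\<Sum>k<m. \<bar>b k\<bar> * x ^ k)" for x :: real
  have e_nonneg: "0 \<le> e l" for l by (simp add: e_def)
  have e_rec: "real (Suc l) * e (Suc l) \<le> (\<Sum>k\<le>l. \<bar>b k\<bar> * e (l - k))" for l
  proof -
    have "real (Suc l) * e (Suc l) = \<bar>real (Suc l) * trial_coeff b (Suc l)\<bar>"
      unfolding e_def abs_mult by simp
    also have "\<dots> = \<bar>\<Sum>k\<le>l. b k * trial_coeff b (l - k)\<bar>"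
      using trial_coeff_recurrence[of l b] by linarith
    also have "\<dots> \<le> (\<Sum>k\<le>l. \<bar>b k * trial_coeff b (l - k)\<bar>)" by (rule sum_abs)
    finally show ?thesis by (simp add: abs_mult e_def)
  qed
  have f_deriv: "(f has_real_derivative f' x) (at x)" for x
  proof -
    have f_alt: "f = (\<lambda>x. e 0 + (\<Sum>l<N. e (Suc l) * x ^ Suc l))"
      unfolding f_def lessThan_Suc_atMost[symmetric] by (subst sum.lessThan_Suc_shift) simp
    have "((\<lambda>x. e 0 + (\<Sum>l<N. e (Suc l) * x ^ Suc l)) has_real_derivative 0 + (\<Sum>l<N. e (Suc l) * ((1 + real l) * (1 * x ^ l)))) (at x)"
      by (intro DERIV_add DERIV_const DERIV_sum DERIV_cmult DERIV_power_Suc DERIV_ident)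
    then show ?thesis unfolding f_alt f'_def by (simp add: mult_ac)
  qed
  have g_deriv: "(g has_real_derivative g' x) (at x)" for x
  proof -
    have "((\<lambda>x. \<Sum>k<m. \<bar>b k\<bar> / real (Suc k) * x ^ Suc k) has_real_derivative (\<Sum>k<m. \<bar>b k\<bar> / real (Suc k) * ((1 + real k) * (1 * x ^ k)))) (at x)"
      by (intro DERIV_sum DERIV_cmult DERIV_power_Suc DERIV_ident)
    moreover have "\<bar>b k\<bar> / real (Suc k) * ((1 + real k) * (1 * x ^ k)) = \<bar>b k\<bar> * x ^ k" for k by simp
    ultimately show ?thesis unfolding g_def[abs_def] g'_def by simp
  qed
  have le: "f' x \<le> g' x * f x" if x: "0 \<le> x" for x
  proof -
    have "f' x \<le> (\<Sum>l<N. \<Sum>k\<le>l. (\<bar>b k\<bar> * x ^ k) * (e (l - k) * x ^ (l - k)))"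
      unfolding f'_def
    proof (rule sum_mono)
      fix l
      have "real (Suc l) * e (Suc l) * x ^ l \<le> (\<Sum>k\<le>l. \<bar>b k\<bar> * e (l - k)) * x ^ l"
        using x by (intro mult_right_mono e_rec) auto
      also have "\<dots> = (\<Sum>k\<le>l. (\<bar>b k\<bar> * x ^ k) * (e (l - k) * x ^ (l - k)))"
        unfolding sum_distrib_right
      proof (intro sum.cong refl)
        fix k assume "k \<in> {..l}"
        then have "x ^ l = x ^ k * x ^ (l - k)" by (simp add: power_add[symmetric])
        then show "\<bar>b k\<bar> * e (l - k) * x ^ l = \<bar>b k\<bar> * x ^ k * (e (l - k) * x ^ (l - k))" by simp
      qed
      finally show "real (Suc l) * e (Suc l) * x ^ l \<le> (\<Sum>k\<le>l. (\<bar>b k\<bar> * x ^ k) * (e (l - k) * x ^ (l - k)))" .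
    qed
    also have "\<dots> = (\<Sum>(k, i)\<in>{(k, i). k + i < N}. (\<bar>b k\<bar> * x ^ k) * (e i * x ^ i))"
      by (rule sum.triangle_reindex[symmetric])
    \<comment> \<open>The triangle is enlarged to a rectangle of nonnegative terms; the range N + m
      covers both the triangle and the support of b, so the first factor becomes g'.\<close>
    also have "\<dots> \<le> (\<Sum>(k, i)\<in>{..<N + m} \<times> {..N}. (\<bar>b k\<bar> * x ^ k) * (e i * x ^ i))"
      using x e_nonneg by (intro sum_mono2) auto
    also have "\<dots> = (\<Sum>k<N + m. \<bar>b k\<bar> * x ^ k) * f x"
      unfolding f_def sum_product by (rule sum.cartesian_product[symmetric])
    also have "(\<Sum>k<N + m. \<bar>b k\<bar> * x ^ k) = g' x"
      unfolding g'_def using b_support by (intro sum.mono_neutral_right) auto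
    finally show ?thesis .
  qed
  have "f R * exp (- g R) \<le> f 0 * exp (- g 0)"
  proof (rule DERIV_nonpos_imp_nonincreasing[OF R])
    fix x :: real assume x: "0 \<le> x"
    have "((\<lambda>x. f x * exp (- g x)) has_real_derivative (f' x - g' x * f x) * exp (- g x)) (at x)"
      by (rule derivative_eq_intros f_deriv g_deriv refl)+ (simp add: algebra_simps)
    moreover have "(f' x - g' x * f x) * exp (- g x) \<le> 0"
      using le[OF x] by (intro mult_nonpos_nonneg) auto
    ultimately show "\<exists>y. ((\<lambda>x. f x * exp (- g x)) has_real_derivative y) (at x) \<and> y \<le> 0" by blast
  qed
  moreover have "f 0 = 1" unfolding f_def lessThan_Suc_atMost[symmetric] by (subst sum.lessThan_Suc_shift) (simp add: e_def)
  moreover have "g 0 = 0" by (simp add: g_def)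
  ultimately have "f R * exp (- g R) \<le> 1" by simp
  then have "f R \<le> exp (g R)" by (simp add: exp_minus field_simps)
  then show ?thesis by (simp add: f_def g_def e_def)
qed

text \<open>Weight the coefficient of index l by R^l with R = e^(1/m). Frequencies up to m grow by
  at most e < 3, so the majorant is e^(3 S), while each of the last m coefficients carries at least
  R^(n-m) = e^(n/m - 1). The fourth S is the factor e^S in \<eta>.\<close>

lemma \<eta>_le: "\<eta> \<le> B * exp (1 - real n / real m + 4 * S)"
proof -
  define R where "R = exp (1 / real m)"
  have R1: "1 \<le> R" by (simp add: R_def)
  have Rpow: "R ^ k = exp (real k / real m)" for k
    by (simp add: R_def exp_of_nat_mult[symmetric])
  have "R ^ (n - m) * (\<Sum>i\<in>{n - m<..n}. \<bar>trial_coeff b i\<bar>) \<le> (\<Sum>i\<in>{n - m<..n}. \<bar>trial_coeff b i\<bar> * R ^ i)"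
    unfolding sum_distrib_left using R1
    by (intro sum_mono) (auto simp: mult.commute[of "R ^ (n - m)"] intro!: mult_left_mono power_increasing)
  also have "\<dots> \<le> (\<Sum>l\<le>n. \<bar>trial_coeff b l\<bar> * R ^ l)"
    using R1 by (intro sum_mono2) auto
  also have "\<dots> \<le> exp (\<Sum>k<m. \<bar>b k\<bar> / real (Suc k) * R ^ Suc k)"
    using R1 by (intro sum_trial_coeff_le) auto
  also have "\<dots> \<le> exp (3 * S)"
  proof -
    have "(\<Sum>k<m. \<bar>b k\<bar> / real (Suc k) * R ^ Suc k) \<le> (\<Sum>k<m. \<bar>b k\<bar> / real (Suc k) * 3)"
    proof (intro sum_mono mult_left_mono)
      fix k assume "k \<in> {..<m}"
      then have "R ^ Suc k \<le> exp 1" unfolding Rpow using m_pos by (simp add: field_simps)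
      then show "R ^ Suc k \<le> 3" using exp_le by linarith
    qed auto
    also have "\<dots> = 3 * S" unfolding S_def sum_distrib_left by (intro sum.cong refl) simp
    finally show ?thesis by simp
  qed
  finally have "(\<Sum>i\<in>{n - m<..n}. \<bar>trial_coeff b i\<bar>) \<le> exp (3 * S) / R ^ (n - m)"
    using R1 by (simp add: field_simps)
  also have "\<dots> = exp (1 - real n / real m + 3 * S)"
    using m_pos m_le_n by (simp add: Rpow exp_diff[symmetric] of_nat_diff diff_divide_distrib)
  finally have "\<epsilon> \<le> B * exp (1 - real n / real m + 3 * S)"
    unfolding \<epsilon>_def by (intro mult_left_mono B_nonneg)
  then have "\<eta> \<le> B * exp (1 - real n / real m + 3 * S) * exp S"
    unfolding \<eta>_def by (intro mult_right_mono) auto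
  also have "\<dots> = B * exp (1 - real n / real m + 4 * S)"
    unfolding mult.assoc exp_add[symmetric] by simp
  finally show ?thesis .
qed

end

section \<open>Asymptotics\<close>

text \<open>ln (1 + 1/j) lies between 1/(j + 1) and 1/j, and these logarithms telescope.\<close>

lemma harmonic_sum_bounds:
  assumes "1 \<le> k" "k \<le> m"
  shows "ln (real (Suc m) / real k) \<le> (\<Sum>j\<in>{k..m}. 1 / real j)"
    and "(\<Sum>j\<in>{k..m}. 1 / real j) \<le> 1 / real k + ln (real m / real k)"
proof -
  have up: "ln (real (Suc j) / real j) \<le> 1 / real j" if "1 \<le> j" for j
  proof -
    have "real (Suc j) / real j = 1 + 1 / real j" using that by (simp add: field_simps)
    then show ?thesis using ln_add_one_self_le_self[of "1 / real j"] by simp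
  qed
  have low: "1 / real (Suc j) \<le> ln (real (Suc j) / real j)" if "1 \<le> j" for j
  proof -
    have "ln (real j / real (Suc j)) \<le> real j / real (Suc j) - 1" using that by (intro ln_le_minus_one) auto
    moreover have "real j / real (Suc j) - 1 = - (1 / real (Suc j))" by (simp add: field_simps)
    moreover have "ln (real (Suc j) / real j) = - ln (real j / real (Suc j))" using that by (simp add: ln_div)
    ultimately show ?thesis by linarith
  qed
  show "ln (real (Suc m) / real k) \<le> (\<Sum>j\<in>{k..m}. 1 / real j)"
    using assms(2)
  proof (induction m rule: dec_induct)
    case base
    then show ?case using up[of k] assms(1) by simp
  next
    case (step m)
    then have "ln (real (Suc (Suc m)) / real k) = ln (real (Suc m) / real k) + ln (real (Suc (Suc m)) / real (Suc m))"
      using assms(1) by (simp add: ln_div del: of_nat_Suc)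
    then show ?case using step up[of "Suc m"] by (simp del: of_nat_Suc)
  qed
  show "(\<Sum>j\<in>{k..m}. 1 / real j) \<le> 1 / real k + ln (real m / real k)"
    using assms(2)
  proof (induction m rule: dec_induct)
    case base
    then show ?case using assms(1) by simp
  next
    case (step m)
    then have "ln (real (Suc m) / real k) = ln (real m / real k) + ln (real (Suc m) / real m)"
      using assms(1) by (simp add: ln_div del: of_nat_Suc)
    then show ?case using step low[of m] assms(1) by (simp del: of_nat_Suc)
  qed
qed

text \<open>Summation by parts against $2 \sin(\theta/2) \cos(j\theta) = \sin((j+1/2)\theta) - \sin((j-1/2)\theta)$.\<close>

lemma sum_cos_over_nat_le:
  assumes k: "1 \<le> k" "k \<le> m" and s: "0 < sin (\<theta> / 2)"
  shows "(\<Sum>j\<in>{k..m}. cos (real j * \<theta>) / real j) \<le> 1 / (real k * sin (\<theta> / 2))"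
proof -
  define A where "A j = sin ((real j + 1 / 2) * \<theta>)" for j :: nat
  have A1: "A j \<le> 1" "- 1 \<le> A j" for j by (simp_all add: A_def)
  have tel: "2 * sin (\<theta> / 2) * cos (real (Suc j) * \<theta>) = A (Suc j) - A j" for j
  proof -
    have "(real (Suc j) + 1 / 2) * \<theta> = real (Suc j) * \<theta> + \<theta> / 2" "(real j + 1 / 2) * \<theta> = real (Suc j) * \<theta> - \<theta> / 2"
      by (simp_all add: algebra_simps)
    then show ?thesis unfolding A_def by (simp only: sin_add sin_diff) simp
  qed
  have inv: "(\<Sum>j\<in>{k..m}. 2 * sin (\<theta> / 2) * (cos (real j * \<theta>) / real j)) \<le> A m / real m + 2 / real k - 1 / real m"
    using k(2)
  proof (induction m rule: dec_induct)
    case base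
    obtain i where i: "k = Suc i" using k(1) by (cases k) auto
    have "2 * sin (\<theta> / 2) * (cos (real k * \<theta>) / real k) = (A k - A i) / real k"
      using tel[of i] i by (simp del: of_nat_Suc)
    also have "\<dots> \<le> (A k + 1) / real k" using A1(2)[of i] by (intro divide_right_mono) auto
    finally show ?case by (simp add: add_divide_distrib)
  next
    case (step m)
    have m: "0 < real m" using step k by simp
    have "(\<Sum>j\<in>{k..Suc m}. 2 * sin (\<theta> / 2) * (cos (real j * \<theta>) / real j)) =
        (\<Sum>j\<in>{k..m}. 2 * sin (\<theta> / 2) * (cos (real j * \<theta>) / real j)) + (A (Suc m) - A m) / real (Suc m)"
      using step tel[of m] by (simp del: of_nat_Suc)
    also have "\<dots> \<le> A m * (1 / real m - 1 / real (Suc m)) + A (Suc m) / real (Suc m) + 2 / real k - 1 / real m"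
      using step.IH by (simp add: algebra_simps diff_divide_distrib del: of_nat_Suc)
    also have "\<dots> \<le> 1 * (1 / real m - 1 / real (Suc m)) + A (Suc m) / real (Suc m) + 2 / real k - 1 / real m"
    proof -
      have "1 / real (Suc m) \<le> 1 / real m" using m by (intro divide_left_mono) auto
      then show ?thesis using A1(1)[of m] by (intro add_right_mono diff_right_mono mult_right_mono) auto
    qed
    finally show ?case by (simp del: of_nat_Suc)
  qed
  also have "\<dots> \<le> 2 / real k"
  proof -
    have "A m / real m \<le> 1 / real m" using A1(1)[of m] by (intro divide_right_mono) auto
    then show ?thesis by simp
  qed
  finally have "2 * sin (\<theta> / 2) * (\<Sum>j\<in>{k..m}. cos (real j * \<theta>) / real j) \<le> 2 / real k"
    by (simp add: sum_distrib_left)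
  then show ?thesis using s k by (simp add: field_simps)
qed

lemma half_le_sin:
  fixes y :: real
  assumes "0 \<le> y" "y \<le> 1"
  shows "y / 2 \<le> sin y"
proof -
  have "sin 0 - 0 / 2 \<le> sin y - y / 2"
  proof (rule DERIV_nonneg_imp_nondecreasing[OF assms(1)])
    fix t assume t: "0 \<le> t" "t \<le> y"
    have "cos (pi / 3) \<le> cos t" using t assms pi_gt3 by (intro cos_monotone_0_pi_le) auto
    moreover have "((\<lambda>t. sin t - t / 2) has_real_derivative cos t - 1 / 2) (at t)"
      by (auto intro!: derivative_eq_intros)
    ultimately show "\<exists>y. ((\<lambda>t. sin t - t / 2) has_real_derivative y) (at t) \<and> 0 \<le> y"
      by (auto simp: cos_60)
  qed
  then show ?thesis by simp
qed

text \<open>The bound of \<open>\<eta>_le\<close> without its prefactor, after inserting n/m \<ge>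
  c^(1/4) and S \<le> \<alpha> ln c (1 + ln c). It decays faster than every power of c and is free
  of n and u.\<close>

definition trial_error :: "real \<Rightarrow> real \<Rightarrow> real" where
  "trial_error \<alpha> c = exp (1 - c powr (1 / 4) + 4 * (\<alpha> * ln c * (1 + ln c)))"

text \<open>The window of frequencies runs from k, about n/c, to m, about n/c^(1/4): below it sin(pi
  j c/n) is so small that only O(1) is lost, above it truncation is too costly. The bound n \<ge> 4
  c keeps the phase pi c/n below 1, \<open>8 \<le> c powr (3 / 4)\<close> makes the window nonempty,
  and the second part of \<open>err\<close> is the final comparison divided by u^2, so that it
  concerns c alone.\<close>

lemma toeplitz_det_ge:
  assumes n: "4 * c \<le> real n" and u: "0 < u" "u \<le> \<alpha> * ln c"
    and c: "2 \<le> c powr (1 / 4)" "8 \<le> c powr (3 / 4)" "1 < c"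
    and err: "\<alpha> * ln c * trial_error \<alpha> c \<le> 1 / 2"
      "1 / (4 * pi\<^sup>2) * ln c \<le> 1 / (2 * pi\<^sup>2) * (3 / 4 * ln c - ln 2 - 1) - 4 * c * trial_error \<alpha> c - 4 * (trial_error \<alpha> c)\<^sup>2"
  defines "\<tau> \<equiv> Determinant.det (Matrix.mat n n (\<lambda>(i, j). toeplitz_entry u c n i j))"
  shows "0 < \<tau>" "u * c + u\<^sup>2 / (4 * pi\<^sup>2) * ln c \<le> ln \<tau>"
proof -
  define w where "w = c powr (1 / 4)"
  define \<omega> where "\<omega> = trial_error \<alpha> c"
  define m where "m = nat \<lfloor>real n / w\<rfloor>"
  define k where "k = nat \<lceil>real n / c\<rceil>"
  \<comment> \<open>\<open>b i = (i + 1) A\<^sub>i\<^sub>+\<^sub>1\<close>, where \<open>A\<^sub>j\<close> is \<open>u\<close> times the \<open>j\<close>-th Fourier coefficient of the indicator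
    function of the arc if \<open>k \<le> j \<le> m\<close>, and \<open>0\<close> otherwise\<close>
  define b where "b i = (if k \<le> Suc i \<and> i < m then u / pi * sin (pi * real (Suc i) * c / n) else 0)" for i
  have w: "2 \<le> w" "w * c powr (3 / 4) = c"
    using c by (simp_all add: w_def powr_add[symmetric])
  have n0: "0 < real n" using n c by linarith
  have cn: "real n / c = real n / w / c powr (3 / 4)" using w(2) by (metis divide_divide_eq_left)
  have nc4: "4 \<le> real n / c" using n c by (simp add: field_simps)
  have big: "8 * (real n / c) \<le> real n / w"
  proof -
    have "8 * (real n / c) \<le> c powr (3 / 4) * (real n / c)" using c n0 by (intro mult_right_mono) auto
    also have "\<dots> = real n / w" unfolding cn using c by simp
    finally show ?thesis .
  qed
  have k_ge: "real n / c \<le> real k" and k_le: "real k \<le> real n / c + 1"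
    using nc4 unfolding k_def by linarith+
  have m_le: "real m \<le> real n / w" and m_ge: "real n / w \<le> real (Suc m)"
    using nc4 big unfolding m_def by linarith+
  have k1: "1 \<le> k" using k_ge nc4 by linarith
  have km: "k \<le> m" using k_le m_ge big nc4 by linarith
  have m_n: "m \<le> n"
  proof -
    have "real n / w \<le> real n / 1" using w n0 by (intro divide_left_mono) auto
    then show ?thesis using m_le by simp
  qed
  interpret T: trial_polynomial b m n u
  proof
    show "0 < m" using k1 km by simp
    show "b i = 0" if "m \<le> i" for i using that by (simp add: b_def)
    show "\<bar>b i\<bar> \<le> u" for i
    proof -
      have "\<bar>u / pi * sin (pi * real (Suc i) * c / n)\<bar> \<le> u / pi * 1"
        unfolding abs_mult using u by (intro mult_mono) auto
      also have "\<dots> \<le> u" using u pi_gt3 by (simp add: divide_le_eq)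
      finally show ?thesis using u by (simp add: b_def)
    qed
  qed (rule m_n)
  have shift: "(\<Sum>i<m. if k \<le> Suc i \<and> i < m then h (Suc i) else 0) = (\<Sum>j\<in>{k..m}. h j)" for h :: "nat \<Rightarrow> real"
  proof -
    have "(\<Sum>i<m. if k \<le> Suc i \<and> i < m then h (Suc i) else 0) = (\<Sum>i\<in>{i. k \<le> Suc i \<and> i < m}. h (Suc i))"
      by (intro sum.mono_neutral_cong_right) auto
    also have "\<dots> = (\<Sum>j\<in>{k..m}. h j)"
      using k1 by (intro sum.reindex_bij_witness[of _ "\<lambda>j. j - 1" Suc]) auto
    finally show ?thesis .
  qed
  have S_le: "T.S \<le> \<alpha> * ln c * (1 + ln c)"
  proof -
    have "T.S \<le> (\<Sum>i<m. if k \<le> Suc i \<and> i < m then u * (1 / real (Suc i)) else 0)"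
      unfolding T.S_def
    proof (rule sum_mono)
      fix i
      have "\<bar>b i\<bar> / real (Suc i) \<le> u / real (Suc i)" by (intro divide_right_mono T.b_bound) auto
      then show "\<bar>b i\<bar> / real (Suc i) \<le> (if k \<le> Suc i \<and> i < m then u * (1 / real (Suc i)) else 0)"
        by (auto simp: b_def simp del: of_nat_Suc)
    qed
    also have "\<dots> = u * (\<Sum>j\<in>{k..m}. 1 / real j)"
      unfolding shift[of "\<lambda>j. u * (1 / real j)"] sum_distrib_left ..
    also have "\<dots> \<le> u * (1 / real k + ln (real m / real k))"
      using u by (intro mult_left_mono harmonic_sum_bounds k1 km) auto
    also have "\<dots> \<le> u * (1 + ln c)"
    proof -
      have "real m / real k \<le> c"
      proof -
        have "real m \<le> real n" using m_n by simp
        also have "\<dots> \<le> c * real k" using k_ge c by (simp add: field_simps)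
        finally show ?thesis using k1 by (simp add: divide_le_eq)
      qed
      then have "ln (real m / real k) \<le> ln c" using k1 km c by (subst ln_le_cancel_iff) auto
      moreover have "1 / real k \<le> 1" using k1 by simp
      ultimately show ?thesis using u by (intro mult_left_mono) auto
    qed
    also have "\<dots> \<le> \<alpha> * ln c * (1 + ln c)" using u c by (intro mult_right_mono) auto
    finally show ?thesis .
  qed
  have \<eta>_le: "T.\<eta> \<le> u * \<omega>"
  proof -
    \<comment> \<open>Rounding m down keeps n/m at least c^(1/4).\<close>
    have "w \<le> real n / real m" using m_le km k1 w by (simp add: field_simps)
    then have "exp (1 - real n / real m + 4 * T.S) \<le> \<omega>"
      unfolding \<omega>_def trial_error_def w_def[symmetric] using S_le by simp
    then have "u * exp (1 - real n / real m + 4 * T.S) \<le> u * \<omega>" using u by (intro mult_left_mono) auto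
    then show ?thesis using T.\<eta>_le by linarith
  qed
  have \<omega>: "0 < \<omega>" by (simp add: \<omega>_def trial_error_def)
  have small: "T.\<eta> \<le> 1 / 2"
  proof -
    have "u * \<omega> \<le> \<alpha> * ln c * \<omega>" using u \<omega> by (intro mult_right_mono) auto
    then show ?thesis using \<eta>_le err(1) by (simp add: \<omega>_def)
  qed
  have cn': "0 < c" "c \<le> n" "0 \<le> u" using c n u by auto
  note bound = T.toeplitz_det_trial_bound[OF cn' small, folded \<tau>_def]
  show "0 < \<tau>" by (rule bound(1))
  define \<theta> where "\<theta> = 2 * pi * c / real n"
  \<comment> \<open>At b = (u/pi) sin y the quadratic 2 u b sin y / pi - b^2 attains its maximum u^2
    sin^2 y / pi^2; then sin^2 y = (1 - cos 2y)/2 splits off the harmonic sum from an oscillating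
    one.\<close>
  have "(\<Sum>i<m. 2 * u * b i * sin (pi * real (Suc i) * c / n) / (pi * real (Suc i)) - (b i)\<^sup>2 / real (Suc i)) =
      (\<Sum>i<m. if k \<le> Suc i \<and> i < m then u\<^sup>2 / (2 * pi\<^sup>2) * (1 / real (Suc i) - cos (real (Suc i) * \<theta>) / real (Suc i)) else 0)"
  proof (intro sum.cong refl)
    fix i
    define y where "y = pi * real (Suc i) * c / n"
    have y: "real (Suc i) * \<theta> = 2 * y" by (simp add: y_def \<theta>_def)
    have "2 * u * (u / pi * sin y) * sin y / (pi * q) - (u / pi * sin y)\<^sup>2 / q = u\<^sup>2 / (2 * pi\<^sup>2) * (1 / q - cos (2 * y) / q)"
      if "0 < q" for q :: real
    proof -
      have "2 * u * (u / pi * sin y) * sin y / (pi * q) - (u / pi * sin y)\<^sup>2 / q = u\<^sup>2 / pi\<^sup>2 * (sin y)\<^sup>2 / q"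
        using that by (simp add: field_simps power2_eq_square)
      also have "(sin y)\<^sup>2 = (1 - cos (2 * y)) / 2" by (simp add: cos_double_sin)
      finally show ?thesis by (simp add: diff_divide_distrib right_diff_distrib)
    qed
    from this[of "real (Suc i)"]
    show "2 * u * b i * sin (pi * real (Suc i) * c / n) / (pi * real (Suc i)) - (b i)\<^sup>2 / real (Suc i) =
      (if k \<le> Suc i \<and> i < m then u\<^sup>2 / (2 * pi\<^sup>2) * (1 / real (Suc i) - cos (real (Suc i) * \<theta>) / real (Suc i)) else 0)"
      unfolding b_def y_def[symmetric] y by (simp del: of_nat_Suc)
  qed
  also have "\<dots> = u\<^sup>2 / (2 * pi\<^sup>2) * ((\<Sum>j\<in>{k..m}. 1 / real j) - (\<Sum>j\<in>{k..m}. cos (real j * \<theta>) / real j))"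
    unfolding shift[of "\<lambda>j. u\<^sup>2 / (2 * pi\<^sup>2) * (1 / real j - cos (real j * \<theta>) / real j)"]
      sum_subtractf[symmetric] sum_distrib_left ..
  also have "\<dots> \<ge> u\<^sup>2 / (2 * pi\<^sup>2) * ((3 / 4 * ln c - ln 2) - 1)"
  proof (intro mult_left_mono diff_mono)
    have "3 / 4 * ln c - ln 2 = ln (c powr (3 / 4) / 2)" using c by (simp add: ln_div ln_powr)
    also have "\<dots> \<le> ln (real (Suc m) / real k)"
    proof -
      \<comment> \<open>Rounding up gives k \<le> 2 n/c, and m + 1 \<ge> n/c^(1/4); this factor 2 is
        the origin of \<open>ln 2\<close>.\<close>
      have "c powr (3 / 4) / 2 * real k \<le> c powr (3 / 4) / 2 * (2 * (real n / c))"
        using k_le nc4 by (intro mult_left_mono) auto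
      also have "\<dots> = real n / w" unfolding cn using c by simp
      also have "\<dots> \<le> real (Suc m)" by (rule m_ge)
      finally have "c powr (3 / 4) / 2 \<le> real (Suc m) / real k" using k1 by (simp add: le_divide_eq del: of_nat_Suc)
      then show ?thesis using c by (intro ln_mono) auto
    qed
    also have "\<dots> \<le> (\<Sum>j\<in>{k..m}. 1 / real j)" by (rule harmonic_sum_bounds(1)[OF k1 km])
    finally show "3 / 4 * ln c - ln 2 \<le> (\<Sum>j\<in>{k..m}. 1 / real j)" .
    have y: "0 < \<theta> / 2" "\<theta> / 2 \<le> 1"
    proof -
      show "0 < \<theta> / 2" using c n0 by (simp add: \<theta>_def)
      have "pi * c \<le> 4 * c" using pi_less_4 c by (intro mult_right_mono) auto
      then show "\<theta> / 2 \<le> 1" using n n0 by (simp add: \<theta>_def divide_le_eq)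
    qed
    have s: "\<theta> / 2 / 2 \<le> sin (\<theta> / 2)" using y by (intro half_le_sin) auto
    have "(\<Sum>j\<in>{k..m}. cos (real j * \<theta>) / real j) \<le> 1 / (real k * sin (\<theta> / 2))"
      using s y by (intro sum_cos_over_nat_le k1 km) linarith
    also have "\<dots> \<le> 1 / 1"
    proof (intro divide_left_mono)
      \<comment> \<open>The lower end k \<ge> n/c is chosen for this: (n/c) (\<theta>/4) = pi/2,
        which keeps the oscillating sum at most 1.\<close>
      have "1 \<le> real n / c * (\<theta> / 2 / 2)" using n0 c pi_gt3 by (simp add: \<theta>_def)
      also have "\<dots> \<le> real k * sin (\<theta> / 2)" using k_ge s y c n0 by (intro mult_mono) auto
      finally show "1 \<le> real k * sin (\<theta> / 2)" .
      then show "0 < real k * sin (\<theta> / 2) * 1" by linarith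
    qed auto
    finally show "(\<Sum>j\<in>{k..m}. cos (real j * \<theta>) / real j) \<le> 1" by simp
  qed auto
  finally have gain: "u\<^sup>2 / (2 * pi\<^sup>2) * ((3 / 4 * ln c - ln 2) - 1) \<le>
      (\<Sum>i<m. 2 * u * b i * sin (pi * real (Suc i) * c / n) / (pi * real (Suc i)) - (b i)\<^sup>2 / real (Suc i))" .
  have e1: "4 * u * c * T.\<eta> \<le> u\<^sup>2 * (4 * c * \<omega>)"
  proof -
    have "4 * u * c * T.\<eta> \<le> 4 * u * c * (u * \<omega>)" using u c by (intro mult_left_mono \<eta>_le) auto
    then show ?thesis by (simp add: power2_eq_square mult_ac)
  qed
  have e2: "4 * T.\<eta>\<^sup>2 \<le> u\<^sup>2 * (4 * \<omega>\<^sup>2)"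
    using power_mono[OF \<eta>_le T.\<eta>_nonneg, of 2] by (simp add: power_mult_distrib)
  have "u\<^sup>2 * (1 / (4 * pi\<^sup>2) * ln c) \<le> u\<^sup>2 * (1 / (2 * pi\<^sup>2) * (3 / 4 * ln c - ln 2 - 1) - 4 * c * \<omega> - 4 * \<omega>\<^sup>2)"
    using err(2) unfolding \<omega>_def by (intro mult_left_mono) auto
  then have "u\<^sup>2 / (4 * pi\<^sup>2) * ln c \<le> u\<^sup>2 / (2 * pi\<^sup>2) * ((3 / 4 * ln c - ln 2) - 1) - u\<^sup>2 * (4 * c * \<omega>) - u\<^sup>2 * (4 * \<omega>\<^sup>2)"
    by (simp add: right_diff_distrib)
  then show "u * c + u\<^sup>2 / (4 * pi\<^sup>2) * ln c \<le> ln \<tau>"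
    using bound(2) gain e1 e2 by linarith
qed

text \<open>The threshold is a point beyond which all conditions of \<open>toeplitz_det_ge\<close>
  on c hold; they involve \<alpha> but neither u nor n.\<close>

theorem corollary1p16:
  fixes \<alpha> :: real
  assumes "\<alpha> > 0"
  shows "\<exists>c\<^sub>T::real. c\<^sub>T > 1 \<and>
    (\<forall>c u :: real. c \<ge> c\<^sub>T \<and> 2 \<le> u \<and> u \<le> \<alpha> * ln c \<longrightarrow>
       F c (- u / 2) = ln (sine_det c (exp u - 1)) \<and>
       ln (sine_det c (exp u - 1)) \<ge> u * c + u\<^sup>2 / (4 * pi\<^sup>2) * ln c)"
proof -
  have "eventually (\<lambda>c::real. 2 \<le> c powr (1 / 4)) at_top" by real_asymp
  moreover have "eventually (\<lambda>c::real. 8 \<le> c powr (3 / 4)) at_top" by real_asymp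
  moreover have "eventually (\<lambda>c::real. 1 < c) at_top" by (rule eventually_gt_at_top)
  moreover have "eventually (\<lambda>c. \<alpha> * ln c * trial_error \<alpha> c \<le> 1 / 2) at_top"
    using assms unfolding trial_error_def by real_asymp
  \<comment> \<open>On the right ln c has coefficient 3/(8 pi^2), on the left only 2/(8 pi^2); the
    difference absorbs the constants and the rapidly decaying errors.\<close>
  moreover have "eventually (\<lambda>c. 1 / (4 * pi\<^sup>2) * ln c \<le> 1 / (2 * pi\<^sup>2) * (3 / 4 * ln c - ln 2 - 1) - 4 * c * trial_error \<alpha> c - 4 * (trial_error \<alpha> c)\<^sup>2) at_top"
    using assms unfolding trial_error_def by real_asymp
  ultimately have "eventually (\<lambda>c. 2 \<le> c powr (1 / 4) \<and> 8 \<le> c powr (3 / 4) \<and> 1 < c \<and> \<alpha> * ln c * trial_error \<alpha> c \<le> 1 / 2 \<and>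
    1 / (4 * pi\<^sup>2) * ln c \<le> 1 / (2 * pi\<^sup>2) * (3 / 4 * ln c - ln 2 - 1) - 4 * c * trial_error \<alpha> c - 4 * (trial_error \<alpha> c)\<^sup>2) at_top"
    by eventually_elim auto
  then obtain c\<^sub>T where c\<^sub>T: "\<And>c. c\<^sub>T \<le> c \<Longrightarrow> 2 \<le> c powr (1 / 4) \<and> 8 \<le> c powr (3 / 4) \<and> 1 < c \<and> \<alpha> * ln c * trial_error \<alpha> c \<le> 1 / 2 \<and>
    1 / (4 * pi\<^sup>2) * ln c \<le> 1 / (2 * pi\<^sup>2) * (3 / 4 * ln c - ln 2 - 1) - 4 * c * trial_error \<alpha> c - 4 * (trial_error \<alpha> c)\<^sup>2"
    unfolding eventually_at_top_linorder by blast
  show ?thesis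
  proof (intro exI[of _ c\<^sub>T] conjI allI impI)
    show "1 < c\<^sub>T" using c\<^sub>T[of c\<^sub>T] by simp
    fix c u :: real assume cu: "c \<ge> c\<^sub>T \<and> 2 \<le> u \<and> u \<le> \<alpha> * ln c"
    show "F c (- u / 2) = ln (sine_det c (exp u - 1))" by (simp add: F_def)
    note c = c\<^sub>T[of c]
    define L where "L = u * c + u\<^sup>2 / (4 * pi\<^sup>2) * ln c"
    \<comment> \<open>The bound is put on the determinants, not on their logarithms: the limit then
      inherits positivity along with it, and ln is applied afterwards.\<close>
    have "eventually (\<lambda>n. exp L \<le> Determinant.det (Matrix.mat n n (\<lambda>(i, j). toeplitz_entry u c n i j))) sequentially"
      using eventually_ge_at_top[of "nat \<lceil>4 * c\<rceil>"]
    proof eventually_elim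
      case (elim n)
      then have "4 * c \<le> real n" by linarith
      then have "0 < Determinant.det (Matrix.mat n n (\<lambda>(i, j). toeplitz_entry u c n i j))"
        "L \<le> ln (Determinant.det (Matrix.mat n n (\<lambda>(i, j). toeplitz_entry u c n i j)))"
        unfolding L_def using cu c by (intro toeplitz_det_ge[where \<alpha> = \<alpha>]; simp)+
      then show ?case by (simp add: ln_ge_iff)
    qed
    moreover have "(\<lambda>n. Determinant.det (Matrix.mat n n (\<lambda>(i, j). toeplitz_entry u c n i j))) \<longlonglongrightarrow> sine_det c (exp u - 1)"
      unfolding toeplitz_entry_def using c cu by (intro toeplitz_det_tendsto_sine_det) auto
    ultimately have "exp L \<le> sine_det c (exp u - 1)"
      by (intro tendsto_lowerbound) auto
    then have "ln (exp L) \<le> ln (sine_det c (exp u - 1))" by (intro ln_mono) auto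
    then show "ln (sine_det c (exp u - 1)) \<ge> u * c + u\<^sup>2 / (4 * pi\<^sup>2) * ln c" by (simp add: L_def)
  qed
qed

end
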